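(* The composition maps of the properad $\mathsf{BIB}^!$ along connected directed graphs of positive genus are trivial (zero); that is, $\mathsf{BIB}^!$ is a dioperad.
   Context: Ground field $\Bbbk$ of characteristic $0$; graded modules, Koszul sign rule. A $\Sigma$-bimodule $\mathsf{E}$ is a collection of $(\Sigma_m,\Sigma_n)$-bimodules $\mathsf{E}(m,n)$ ($m$ outputs, $n$ inputs) with $\mathsf{E}(0,n)=0$. A properad is an algebra over the monad $\mathcal{G}$ of connected directed graphs (without directed cycles) with vertices decorated by $\mathsf{E}$; the genus of a graph is the first Betti number of the underlying undirected graph. A properad is called a dioperad here if its composition maps along graphs of positive genus are zero. Elements are written as composites of operations: $f\circ g$ means that $g$ is applied first, $f\otimes g=(f\otimes\mathrm{id})\circ(\mathrm{id}\otimes g)$, and $\tau$ is the symmetry exchanging two strands (degree $0$; it only permutes labels). $\mathsf{BIB}^!$ is the Koszul dual properad of the properad of balanced infinitesimal bialgebras with coproduct of degree $-1$: it is generated by $m$ of arity $(1,2)$ and degree $-1$, and $\Delta$ of arity $(2,1)$ and degree $0$ (each generating a free $\Sigma_2$-module), with relations generated by $m(\mathrm{id}\otimes m)+m(m\otimes \mathrm{id})$; $(\mathrm{id}\otimes\Delta)\Delta-(\Delta\otimes\mathrm{id})\Delta$; $-\Delta m+(m\otimes \mathrm{id})(\mathrm{id}\otimes\Delta)$; $-\Delta m+(\mathrm{id}\otimes m)(\Delta\otimes\mathrm{id})$; $B+\tau B\tau$; $B+D\tau$; $m\Delta$; $m\tau\Delta$, where $B=(\mathrm{id}\otimes m)(\tau\otimes\mathrm{id})(\mathrm{id}\otimes\Delta)$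 and $D=(m\otimes\mathrm{id})(\mathrm{id}\otimes\tau)(\Delta\otimes\mathrm{id})$. *)

theory Defs
  imports Complex_Main "HOL-Library.Poly_Mapping"
begin

section \<open>Directed graphs with legs\<close>

text \<open>
  Edges are named by natural numbers. A vertex is the pair of the list of its outgoing and the list
  of its incoming edges. \<open>outs\<close> and \<open>ins\<close> list the outgoing and the incoming
  legs. An edge that is both an incoming and an outgoing leg is a strand without vertices.
  The order of the list \<open>verts\<close> is the order of the tensor factors decorating the vertices;
  it matters only through Koszul signs.
\<close>

type_synonym vertex = "nat list \<times> nat list"

datatype graph = Graph (verts: "vertex list") (outs: "nat list") (ins: "nat list")

definition edge_sources :: "graph \<Rightarrow> nat list" where
  "edge_sources G = ins G @ concat (map fst (verts G))"

definition edge_targets :: "graph \<Rightarrow> nat list" where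
  "edge_targets G = outs G @ concat (map snd (verts G))"

text \<open>Every edge starts at exactly one place and ends at exactly one place.\<close>

definition wf_graph :: "graph \<Rightarrow> bool" where
  "wf_graph G \<longleftrightarrow> distinct (edge_sources G) \<and> distinct (edge_targets G)
     \<and> set (edge_sources G) = set (edge_targets G)"

definition adj :: "graph \<Rightarrow> (nat \<times> nat) set" where
  "adj G = {(u, v). u < length (verts G) \<and> v < length (verts G)
     \<and> set (fst (verts G ! u)) \<inter> set (snd (verts G ! v)) \<noteq> {}}"

definition linked :: "graph \<Rightarrow> (nat \<times> nat) set" where
  "linked G = {(u, v). u < length (verts G) \<and> v < length (verts G)
     \<and> (u, v) \<in> (adj G \<union> (adj G)\<inverse>)\<^sup>*}"

text \<open>The strand without vertices is a connected graph; it gives the unit.\<close>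

definition connected_graph :: "graph \<Rightarrow> bool" where
  "connected_graph G \<longleftrightarrow>
     (verts G = [] \<and> length (ins G) = 1) \<or>
     (verts G \<noteq> [] \<and> set (ins G) \<inter> set (outs G) = {}
       \<and> (\<forall>u < length (verts G). \<forall>v < length (verts G). (u, v) \<in> linked G))"

definition cdag :: "graph \<Rightarrow> bool" where
  "cdag G \<longleftrightarrow> wf_graph G \<and> connected_graph G \<and> acyclic (adj G)"

definition internal_edges :: "graph \<Rightarrow> nat set" where
  "internal_edges G = set (concat (map fst (verts G))) \<inter> set (concat (map snd (verts G)))"

text \<open>First Betti number: edges + components - vertices (the subtraction never truncates;
  legs do not contribute).\<close>

definition genus :: "graph \<Rightarrow> nat" where
  "genus G = card (internal_edges G) + card ({..<length (verts G)} // linked G) - length (verts G)"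

text \<open>
  \<open>is_subst G Hs K\<close>: the graph \<open>K\<close> arises from \<open>G\<close> by replacing
  the \<open>i\<close>-th vertex by \<open>Hs ! i\<close>, the vertices of \<open>K\<close> being ordered
  lexicographically. The maps \<open>\<sigma>\<close> and \<open>\<rho> i\<close> send the edges of
  \<open>G\<close> and of \<open>Hs ! i\<close> to the edges of \<open>K\<close> they become part of
  (edges are joined when a strand is inserted). For acyclic \<open>G\<close> and \<open>Hs\<close>,
  well-formedness of \<open>K\<close> forces these maps to make exactly the identifications prescribed by
  the legs, so \<open>K\<close> is determined up to renaming edges.
\<close>

definition is_subst :: "graph \<Rightarrow> graph list \<Rightarrow> graph \<Rightarrow> bool" where
  "is_subst G Hs K \<longleftrightarrow> length Hs = length (verts G) \<and> wf_graph K \<and>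
    (\<exists>\<sigma> \<rho>.
       outs K = map \<sigma> (outs G) \<and> ins K = map \<sigma> (ins G) \<and>
       (\<forall>i < length Hs. map (\<rho> i) (outs (Hs ! i)) = map \<sigma> (fst (verts G ! i))
                      \<and> map (\<rho> i) (ins (Hs ! i)) = map \<sigma> (snd (verts G ! i))) \<and>
       verts K = concat (map (\<lambda>i. map (map_prod (map (\<rho> i)) (map (\<rho> i))) (verts (Hs ! i)))
                             [0..<length Hs]))"

definition corolla :: "nat \<Rightarrow> nat \<Rightarrow> graph" where
  "corolla m n = Graph [([0..<m], [m..<m+n])] [0..<m] [m..<m+n]"

section \<open>Properads\<close>

text \<open>
  \<open>hom P m n d\<close> is the space of operations with \<open>m\<close> outputs, \<open>n\<close> inputs
  and degree \<open>d\<close>, a subspace of an ambient vector space; spaces for different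
  \<open>(m, n)\<close> are unrelated and may overlap. \<open>compose P G ps\<close> is the composition of
  the operations \<open>ps\<close> along \<open>G\<close>. The bimodule structure is the composition along
  graphs with one vertex whose legs are a permutation of those of the corolla.
\<close>

record ('k, 'a) properad =
  scal :: "'k \<Rightarrow> 'a \<Rightarrow> 'a"
  hom :: "nat \<Rightarrow> nat \<Rightarrow> int \<Rightarrow> 'a set"
  compose :: "graph \<Rightarrow> 'a list \<Rightarrow> 'a"

definition ops :: "('k::field_char_0, 'a::ab_group_add) properad \<Rightarrow> nat \<Rightarrow> nat \<Rightarrow> 'a set" where
  "ops P m n = module.span (scal P) (\<Union>d. hom P m n d)"

definition decoration ::
    "('k::field_char_0, 'a::ab_group_add) properad \<Rightarrow> graph \<Rightarrow> 'a list \<Rightarrow> bool" where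
  "decoration P G ps \<longleftrightarrow>
     list_all2 (\<lambda>v p. p \<in> ops P (length (fst v)) (length (snd v))) (verts G) ps"

definition koszul_sign :: "int \<Rightarrow> int \<Rightarrow> 'k::field_char_0" where
  "koszul_sign d e = (if odd d \<and> odd e then - 1 else 1)"

text \<open>
  Algebras over the monad of connected directed acyclic graphs. A structure map on the tensor
  product over the unordered vertex set of a graph amounts to the maps \<open>compose P G\<close> for
  ordered vertices together with the Koszul sign rule, which need only be required for the
  transposition of two neighbouring vertices. Invariance under renaming edges follows from
  \<open>assoc\<close> and \<open>unit\<close>. No sign occurs in \<open>assoc\<close> because compositions
  have degree 0 and \<open>is_subst\<close> keeps the order of the factors.
\<close>

locale is_properad =
  fixes P :: "('k::field_char_0, 'a::ab_group_add) properad"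
  assumes vector_space: "vector_space (scal P)"
    and subspace: "module.subspace (scal P) (hom P m n d)"
    and degrees_independent:
      "\<lbrakk>finite D; \<And>d. d \<in> D \<Longrightarrow> f d \<in> hom P m n d; (\<Sum>d\<in>D. f d) = 0; d \<in> D\<rbrakk> \<Longrightarrow> f d = 0"
    and no_outputs: "hom P 0 n d = {0}"
    and compose_hom:
      "\<lbrakk>cdag G; length ps = length (verts G); length ds = length (verts G);
        \<And>i. i < length ps \<Longrightarrow>
          ps ! i \<in> hom P (length (fst (verts G ! i))) (length (snd (verts G ! i))) (ds ! i)\<rbrakk>
       \<Longrightarrow> compose P G ps \<in> hom P (length (outs G)) (length (ins G)) (sum_list ds)"
    and compose_add:
      "\<lbrakk>cdag G; decoration P G (ps @ x # qs); decoration P G (ps @ y # qs)\<rbrakk>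
       \<Longrightarrow> compose P G (ps @ (x + y) # qs) = compose P G (ps @ x # qs) + compose P G (ps @ y # qs)"
    and compose_scal:
      "\<lbrakk>cdag G; decoration P G (ps @ x # qs)\<rbrakk>
       \<Longrightarrow> compose P G (ps @ scal P c x # qs) = scal P c (compose P G (ps @ x # qs))"
    and symmetry:
      "\<lbrakk>cdag (Graph (us @ v # w # ws) os is);
        decoration P (Graph (us @ v # w # ws) os is) (ps @ x # y # qs);
        length ps = length us;
        x \<in> hom P (length (fst v)) (length (snd v)) d;
        y \<in> hom P (length (fst w)) (length (snd w)) e\<rbrakk>
       \<Longrightarrow> compose P (Graph (us @ v # w # ws) os is) (ps @ x # y # qs)
         = scal P (koszul_sign d e) (compose P (Graph (us @ w # v # ws) os is) (ps @ y # x # qs))"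
    and unit: "p \<in> ops P m n \<Longrightarrow> compose P (corolla m n) [p] = p"
    and assoc:
      "\<lbrakk>cdag G; length Hs = length (verts G); length pss = length (verts G);
        \<And>i. i < length Hs \<Longrightarrow> cdag (Hs ! i) \<and> decoration P (Hs ! i) (pss ! i);
        is_subst G Hs K\<rbrakk>
       \<Longrightarrow> compose P G (map2 (compose P) Hs pss) = compose P K (concat pss)"

definition is_dioperad :: "('k::field_char_0, 'a::ab_group_add) properad \<Rightarrow> bool" where
  "is_dioperad P \<longleftrightarrow> is_properad P \<and>
     (\<forall>G ps. cdag G \<and> genus G > 0 \<and> decoration P G ps \<longrightarrow> compose P G ps = 0)"

definition properad_morphism ::
    "('k::field_char_0, 'a::ab_group_add) properad \<Rightarrow> ('k, 'b::ab_group_add) properad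
      \<Rightarrow> (nat \<Rightarrow> nat \<Rightarrow> 'a \<Rightarrow> 'b) \<Rightarrow> bool" where
  "properad_morphism P Q \<phi> \<longleftrightarrow>
     (\<forall>m n d. \<forall>x \<in> hom P m n d. \<phi> m n x \<in> hom Q m n d) \<and>
     (\<forall>m n. \<forall>x \<in> ops P m n. \<forall>y \<in> ops P m n. \<phi> m n (x + y) = \<phi> m n x + \<phi> m n y) \<and>
     (\<forall>m n c. \<forall>x \<in> ops P m n. \<phi> m n (scal P c x) = scal Q c (\<phi> m n x)) \<and>
     (\<forall>G ps. cdag G \<and> decoration P G ps \<longrightarrow>
        \<phi> (length (outs G)) (length (ins G)) (compose P G ps)
        = compose Q G (map2 (\<lambda>v p. \<phi> (length (fst v)) (length (snd v)) p) (verts G) ps))"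

section \<open>The properad \<open>BIB\<^sup>!\<close>\<close>

abbreviation mul :: "nat \<Rightarrow> nat \<Rightarrow> nat \<Rightarrow> vertex" where
  "mul a b c \<equiv> ([c], [a, b])"

abbreviation cop :: "nat \<Rightarrow> nat \<Rightarrow> nat \<Rightarrow> vertex" where
  "cop a b c \<equiv> ([b, c], [a])"

text \<open>
  So \<open>mul a b c\<close> is a product with inputs \<open>a\<close>, \<open>b\<close> and output
  \<open>c\<close>, and \<open>cop a b c\<close> a coproduct with input \<open>a\<close> and outputs
  \<open>b\<close>, \<open>c\<close>. A composite \<open>f \<circ> g\<close> is read as a graph with the
  vertices of \<open>f\<close> listed before those of \<open>g\<close>; pre- and postcomposition with
  \<open>\<tau>\<close> swaps the incoming and outgoing legs.
\<close>

definition bib_relations ::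
    "('k::field_char_0, 'a::ab_group_add) properad \<Rightarrow> 'a \<Rightarrow> 'a \<Rightarrow> bool" where
  "bib_relations P m \<Delta> \<longleftrightarrow>
    (let
       m_id_m = compose P (Graph [mul 0 4 3, mul 1 2 4] [3] [0, 1, 2]) [m, m];
       m_m_id = compose P (Graph [mul 4 2 3, mul 0 1 4] [3] [0, 1, 2]) [m, m];
       id_\<Delta>_\<Delta> = compose P (Graph [cop 4 2 3, cop 0 1 4] [1, 2, 3] [0]) [\<Delta>, \<Delta>];
       \<Delta>_id_\<Delta> = compose P (Graph [cop 4 1 2, cop 0 4 3] [1, 2, 3] [0]) [\<Delta>, \<Delta>];
       \<Delta>_m = compose P (Graph [cop 4 2 3, mul 0 1 4] [2, 3] [0, 1]) [\<Delta>, m];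
       m_id_id_\<Delta> = compose P (Graph [mul 0 4 2, cop 1 4 3] [2, 3] [0, 1]) [m, \<Delta>];
       id_m_\<Delta>_id = compose P (Graph [mul 4 1 3, cop 0 2 4] [2, 3] [0, 1]) [m, \<Delta>];
       B = compose P (Graph [mul 0 4 3, cop 1 2 4] [2, 3] [0, 1]) [m, \<Delta>];
       \<tau>_B_\<tau> = compose P (Graph [mul 0 4 3, cop 1 2 4] [3, 2] [1, 0]) [m, \<Delta>];
       D_\<tau> = compose P (Graph [mul 4 1 2, cop 0 4 3] [2, 3] [1, 0]) [m, \<Delta>];
       m_\<Delta> = compose P (Graph [mul 2 3 1, cop 0 2 3] [1] [0]) [m, \<Delta>];
       m_\<tau>_\<Delta> = compose P (Graph [mul 3 2 1, cop 0 2 3] [1] [0]) [m, \<Delta>]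
     in m_id_m + m_m_id = 0
      \<and> id_\<Delta>_\<Delta> - \<Delta>_id_\<Delta> = 0
      \<and> - \<Delta>_m + m_id_id_\<Delta> = 0
      \<and> - \<Delta>_m + id_m_\<Delta>_id = 0
      \<and> B + \<tau>_B_\<tau> = 0
      \<and> B + D_\<tau> = 0
      \<and> m_\<Delta> = 0
      \<and> m_\<tau>_\<Delta> = 0)"

text \<open>A properad with a chosen product and coproduct subject to the relations.\<close>

definition bib_structure ::
    "('k::field_char_0, 'a::ab_group_add) properad \<Rightarrow> 'a \<Rightarrow> 'a \<Rightarrow> bool" where
  "bib_structure P m \<Delta> \<longleftrightarrow> is_properad P \<and>
     m \<in> hom P 1 2 (- 1) \<and> \<Delta> \<in> hom P 2 1 0 \<and> bib_relations P m \<Delta>"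

text \<open>The smallest subproperad containing \<open>m\<close> and \<open>\<Delta>\<close>.\<close>

inductive generated ::
    "('k::field_char_0, 'a::ab_group_add) properad \<Rightarrow> 'a \<Rightarrow> 'a \<Rightarrow> nat \<Rightarrow> nat \<Rightarrow> 'a \<Rightarrow> bool"
  for P m \<Delta> where
  "generated P m \<Delta> 1 2 m"
| "generated P m \<Delta> 2 1 \<Delta>"
| "generated P m \<Delta> k l 0"
| "generated P m \<Delta> k l x \<Longrightarrow> generated P m \<Delta> k l y \<Longrightarrow> generated P m \<Delta> k l (x + y)"
| "generated P m \<Delta> k l x \<Longrightarrow> generated P m \<Delta> k l (scal P c x)"
| "cdag G
    \<Longrightarrow> list_all2 (\<lambda>v p. generated P m \<Delta> (length (fst v)) (length (snd v)) p) (verts G) ps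
    \<Longrightarrow> generated P m \<Delta> (length (outs G)) (length (ins G)) (compose P G ps)"

text \<open>
  \<open>P\<close> is the properad presented by the generators \<open>m\<close> (free, arity (1,2), degree -1)
  and \<open>\<Delta>\<close> (free, arity (2,1), degree 0) and the relations: it is generated by them and
  maps to every properad with such a structure. The latter is required for properads
  \<open>Q\<close> inside the vector space \<open>nat \<Rightarrow>\<^sub>0 'k\<close> of countable dimension. This is no
  restriction: the presented properad itself, being generated by two elements, can be realised there
  and is a possible \<open>Q\<close>, so that \<open>P\<close> is determined up to isomorphism.
\<close>

definition is_BIB_dual ::
    "('k::field_char_0, 'a::ab_group_add) properad \<Rightarrow> 'a \<Rightarrow> 'a \<Rightarrow> bool" where
  "is_BIB_dual P m \<Delta> \<longleftrightarrow> bib_structure P m \<Delta> \<and>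
     (\<forall>k l. \<forall>x \<in> ops P k l. generated P m \<Delta> k l x) \<and>
     (\<forall>(Q :: ('k, nat \<Rightarrow>\<^sub>0 'k) properad) m' \<Delta>'. bib_structure Q m' \<Delta>' \<longrightarrow>
        (\<exists>\<phi>. properad_morphism P Q \<phi> \<and> \<phi> 1 2 m = m' \<and> \<phi> 2 1 \<Delta> = \<Delta>'))"

end

theory Submission
  imports Defs "HOL-Library.Multiset"
begin

text \<open>
  The properad is spanned by composites of products and coproducts (and the identity), so the claim
  reduces to connected acyclic graphs all of whose vertices are products and coproducts. Draw such a
  vertex as a trivalent ribbon vertex: the product \<open>mul a b c\<close> with the cyclic order
  \<open>a, b, c\<close>, the coproduct \<open>cop a b c\<close> with the cyclic order
  \<open>a, c, b\<close>. The relations with four legs then all say the same thing: the composite of two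
  vertices joined by one edge depends, up to a nonzero scalar, only on the cyclic order of the four
  legs. In other words an edge may be flipped (lemma \<open>flip\<close>), with any admissible direction
  of the new edge. The two relations with two legs say that a double edge gives zero.

  A flip inside a larger graph replaces a two-vertex subgraph. This is legitimate if contracting the
  edge leaves an acyclic graph, that is, unless there is a second directed path between its ends
  (lemmas \<open>replacement\<close> and \<open>path_if_not_collapsible\<close>).

  Take a counterexample with the least number of vertices, where positive genus means that there are
  at least as many inner edges as vertices. A subgraph that has this property too and can be contracted
  has the value zero, and so has the whole graph. Therefore nothing can be cut off: the graph has no
  bridge, and removing a sink shows that it has exactly as many inner edges as vertices. So every
  vertex has two inner edges and one leg (lemma \<open>critical_exactly_two_inner\<close>), and the
  graph is one unoriented cycle with each leg on its left or on its right. A flip of an edge whose legs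
  lie on opposite sides keeps all of this, and the result is again a smallest counterexample.

  If an edge can be flipped and the legs at its two ends lie on the same side, the flip puts both legs on
  one vertex, which is impossible (\<open>same_side_contradiction\<close>). If they lie on opposite sides,
  the flip exchanges them; if the two neighbouring edges had their legs on opposite sides as
  well, these edges now have theirs on the same side, and one of them can be flipped. Hence each edge that
  can be flipped has a neighbour that cannot (\<open>not_collapsible_neighbour\<close>). An edge that
  cannot be flipped joins a source to a sink that is also reached by the rest of the cycle, directed the
  same way. The two facts together leave only the triangle of \<open>s\<close>, \<open>x\<close>,
  \<open>t\<close> with the three edges \<open>s\<close> to \<open>x\<close>, \<open>x\<close> to
  \<open>t\<close> and \<open>s\<close> to \<open>t\<close>. There a flip with a well chosen direction
  of the new edge yields an edge with both legs on one side (\<open>no_critical\<close>).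
\<close>

section \<open>Substitution at one vertex\<close>

lemma acyclic_adj_corolla: "adj (corolla m n) = {}"
  by (auto simp: adj_def corolla_def)

lemma cdag_corolla: "cdag (corolla m n)"
proof -
  have "wf_graph (corolla m n)"
    by (auto simp: wf_graph_def corolla_def edge_sources_def edge_targets_def)
  moreover have "connected_graph (corolla m n)"
    by (auto simp: connected_graph_def linked_def corolla_def)
  ultimately show ?thesis
    by (simp add: cdag_def acyclic_adj_corolla acyclic_def)
qed

abbreviation relabel :: "(nat \<Rightarrow> nat) \<Rightarrow> vertex \<Rightarrow> vertex" where
  "relabel f \<equiv> map_prod (map f) (map f)"

abbreviation arity_corolla :: "vertex \<Rightarrow> graph" where
  "arity_corolla v \<equiv> corolla (length (fst v)) (length (snd v))"

lemma map_corolla_labels: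
  "map (\<lambda>j. f ((xs @ ys) ! j)) [0..<length xs] = map f xs"
  "map (\<lambda>j. f ((xs @ ys) ! j)) [length xs..<length xs + length ys] = map f ys"
  by (auto intro!: nth_equalityI simp: nth_append)

lemma corolla_sel:
  "verts (corolla k l) = [([0..<k], [k..<k+l])]"
  "outs (corolla k l) = [0..<k]" "ins (corolla k l) = [k..<k+l]"
  by (simp_all add: corolla_def)

context is_properad
begin

lemma hom_imp_ops: "x \<in> hom P k l d \<Longrightarrow> x \<in> ops P k l"
  unfolding ops_def
  by (rule module.span_base) (use vector_space in \<open>auto simp: vector_space_def module_def\<close>)

lemma module_scal: "module (scal P)"
  using vector_space by (auto simp: vector_space_def module_def)

text \<open>
  Associativity when corollas are inserted at all vertices but one. The maps
  \<open>\<sigma>\<close> and \<open>\<rho>\<close> cover three uses: inserting a graph whose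
  legs already carry the right names, renaming edges, and removing a vertex decorated by the
  identity, where two edges are merged.
\<close>

lemma compose_subst_one:
  assumes G: "cdag (Graph (vs1 @ v # vs2) os is)"
    and H: "cdag H" "decoration P H qs"
    and dec1: "list_all2 (\<lambda>v p. p \<in> ops P (length (fst v)) (length (snd v))) vs1 ps1"
    and dec2: "list_all2 (\<lambda>v p. p \<in> ops P (length (fst v)) (length (snd v))) vs2 ps2"
    and legs: "map \<rho> (outs H) = map \<sigma> (fst v)" "map \<rho> (ins H) = map \<sigma> (snd v)"
    and K: "K = Graph (map (relabel \<sigma>) vs1 @ map (relabel \<rho>) (verts H) @ map (relabel \<sigma>) vs2)
              (map \<sigma> os) (map \<sigma> is)"
    and wfK: "wf_graph K"
  shows "compose P (Graph (vs1 @ v # vs2) os is) (ps1 @ compose P H qs # ps2)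
       = compose P K (ps1 @ qs @ ps2)"
proof -
  let ?G = "Graph (vs1 @ v # vs2) os is"
  let ?Hs = "map arity_corolla vs1 @ H # map arity_corolla vs2"
  let ?pss = "map (\<lambda>p. [p]) ps1 @ qs # map (\<lambda>p. [p]) ps2"
  \<comment> \<open>a corolla numbers first the outputs and then the inputs of its vertex\<close>
  define lab where "lab i j = \<sigma> ((fst (verts ?G ! i) @ snd (verts ?G ! i)) ! j)" for i j
  define \<rho>s where "\<rho>s i = (if i = length vs1 then \<rho> else lab i)" for i
  have len: "length ps1 = length vs1" "length ps2 = length vs2"
    using dec1 dec2 by (auto dest: list_all2_lengthD)
  have nthH: "?Hs ! i = (if i = length vs1 then H else arity_corolla (verts ?G ! i))"
    if "i < length ?Hs" for i
    using that by (auto simp: nth_append nth_Cons split: nat.splits)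
  have pieces: "map (\<lambda>i. map (relabel (\<rho>s i)) (verts (?Hs ! i))) [0..<length ?Hs]
      = map (\<lambda>v. [relabel \<sigma> v]) vs1 @ map (relabel \<rho>) (verts H) # map (\<lambda>v. [relabel \<sigma> v]) vs2"
    (is "?L = ?R")
  proof (rule nth_equalityI)
    show "length ?L = length ?R" by simp
    fix i assume "i < length ?L"
    then have i: "i < length ?Hs" by simp
    show "?L ! i = ?R ! i"
    proof (cases "i = length vs1")
      case True
      then show ?thesis by (simp add: \<rho>s_def nth_append)
    next
      case False
      have "?L ! i = map (relabel (\<rho>s i)) (verts (?Hs ! i))"
        using i by (simp del: upt_Suc)
      also have "\<dots> = [relabel \<sigma> (verts ?G ! i)]"
        unfolding nthH[OF i] using False by (simp add: corolla_sel \<rho>s_def lab_def[abs_def] map_corolla_labels prod_eq_iff)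
      also have "\<dots> = ?R ! i"
        using False i by (auto simp: nth_append nth_Cons split: nat.splits)
      finally show ?thesis .
    qed
  qed
  have sub: "is_subst ?G ?Hs K"
    unfolding is_subst_def
  proof (intro conjI exI[of _ \<sigma>] exI[of _ \<rho>s])
    show "verts K = concat (map (\<lambda>i. map (relabel (\<rho>s i)) (verts (?Hs ! i))) [0..<length ?Hs])"
      unfolding pieces K by simp
    show "\<forall>i<length ?Hs. map (\<rho>s i) (outs (?Hs ! i)) = map \<sigma> (fst (verts ?G ! i))
             \<and> map (\<rho>s i) (ins (?Hs ! i)) = map \<sigma> (snd (verts ?G ! i))"
    proof (intro allI impI)
      fix i assume i: "i < length ?Hs"
      show "map (\<rho>s i) (outs (?Hs ! i)) = map \<sigma> (fst (verts ?G ! i))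
             \<and> map (\<rho>s i) (ins (?Hs ! i)) = map \<sigma> (snd (verts ?G ! i))"
      proof (cases "i = length vs1")
        case True
        then show ?thesis using legs by (simp add: \<rho>s_def nth_append)
      next
        case False
        then show ?thesis
          unfolding nthH[OF i] by (simp add: corolla_sel \<rho>s_def lab_def[abs_def] map_corolla_labels)
      qed
    qed
  qed (use K wfK in auto)
  have each: "cdag (?Hs ! i) \<and> decoration P (?Hs ! i) (?pss ! i)" if i: "i < length ?Hs" for i
  proof (cases "i = length vs1")
    case True
    then show ?thesis using H len by (simp add: nth_append)
  next
    case False
    have "?pss ! i = [(ps1 @ undefined # ps2) ! i]"
      using i len False by (auto simp: nth_append nth_Cons split: nat.splits)
    moreover have "(ps1 @ undefined # ps2) ! i
        \<in> ops P (length (fst (verts ?G ! i))) (length (snd (verts ?G ! i)))"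
      using i len False dec1 dec2
      by (auto simp: nth_append nth_Cons list_all2_conv_all_nth split: nat.splits)
    ultimately show ?thesis
      unfolding nthH[OF i] using False by (simp add: cdag_corolla decoration_def corolla_sel)
  qed
  have units: "map2 (compose P) (map arity_corolla vs) (map (\<lambda>p. [p]) ps) = ps"
    if "list_all2 (\<lambda>v p. p \<in> ops P (length (fst v)) (length (snd v))) vs ps" for vs ps
    using that by (induction) (auto simp: unit)
  have "compose P ?G (map2 (compose P) ?Hs ?pss) = compose P K (concat ?pss)"
    by (rule assoc[OF G]) (use len each sub in auto)
  moreover have "map2 (compose P) ?Hs ?pss = ps1 @ compose P H qs # ps2"
    using units[OF dec1] units[OF dec2] len by (simp add: zip_append)
  moreover have "concat ?pss = ps1 @ qs @ ps2"
    by simp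
  ultimately show ?thesis by simp
qed

lemma compose_insert:
  assumes "cdag (Graph (vs1 @ (hos, his) # vs2) os is)"
    and "cdag (Graph us hos his)" "decoration P (Graph us hos his) qs"
    and "list_all2 (\<lambda>v p. p \<in> ops P (length (fst v)) (length (snd v))) vs1 ps1"
    and "list_all2 (\<lambda>v p. p \<in> ops P (length (fst v)) (length (snd v))) vs2 ps2"
    and "wf_graph (Graph (vs1 @ us @ vs2) os is)"
  shows "compose P (Graph (vs1 @ us @ vs2) os is) (ps1 @ qs @ ps2)
       = compose P (Graph (vs1 @ (hos, his) # vs2) os is)
           (ps1 @ compose P (Graph us hos his) qs # ps2)"
  by (rule compose_subst_one[symmetric, where \<sigma> = id and \<rho> = id]) (use assms in \<open>auto simp: map_prod.id\<close>)

lemma compose_relabel: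
  assumes "cdag (Graph vs os is)" "vs \<noteq> []" "decoration P (Graph vs os is) ps"
    and "wf_graph (Graph (map (relabel \<sigma>) vs) (map \<sigma> os) (map \<sigma> is))"
  shows "compose P (Graph (map (relabel \<sigma>) vs) (map \<sigma> os) (map \<sigma> is)) ps
       = compose P (Graph vs os is) ps"
proof -
  obtain v vs2 where vs: "vs = v # vs2" using assms(2) by (cases vs) auto
  obtain p ps2 where ps: "ps = p # ps2"
    using assms(3) vs by (cases ps) (auto simp: decoration_def)
  let ?\<rho> = "\<lambda>j. \<sigma> ((fst v @ snd v) ! j)"
  have p: "p \<in> ops P (length (fst v)) (length (snd v))"
    using assms(3) by (auto simp: decoration_def vs ps)
  have rel: "map (relabel ?\<rho>) (verts (arity_corolla v)) = [relabel \<sigma> v]"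
    by (simp add: corolla_sel map_corolla_labels prod_eq_iff)
  have "compose P (Graph ([] @ v # vs2) os is) ([] @ compose P (arity_corolla v) [p] # ps2)
      = compose P (Graph (map (relabel \<sigma>) vs) (map \<sigma> os) (map \<sigma> is)) ([] @ [p] @ ps2)"
    by (rule compose_subst_one[where \<rho> = ?\<rho> and \<sigma> = \<sigma>])
      (use assms p rel in \<open>auto simp: vs ps cdag_corolla decoration_def corolla_sel map_corolla_labels\<close>)
  then show ?thesis by (simp add: vs ps unit[OF p])
qed

lemma zero_in_ops: "0 \<in> ops P k l"
  unfolding ops_def by (rule module.span_zero[OF module_scal])

lemma scal_zero: "scal P 0 x = 0"
  using module.scale_zero_left[OF module_scal] .

lemma compose_zero:
  assumes "cdag G" "decoration P G (ps @ 0 # qs)"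
  shows "compose P G (ps @ 0 # qs) = 0"
  using compose_scal[OF assms, of 0] by (simp add: scal_zero)

end

section \<open>Graphs as sets of vertices\<close>

definition out_labels :: "vertex set \<Rightarrow> nat set" where
  "out_labels S = (\<Union>v\<in>S. set (fst v))"

definition in_labels :: "vertex set \<Rightarrow> nat set" where
  "in_labels S = (\<Union>v\<in>S. set (snd v))"

definition inner :: "vertex set \<Rightarrow> nat set" where
  "inner S = out_labels S \<inter> in_labels S"

definition arrows :: "vertex set \<Rightarrow> vertex rel" where
  "arrows S = {(u, v). u \<in> S \<and> v \<in> S \<and> set (fst u) \<inter> set (snd v) \<noteq> {}}"

text \<open>
  Outgoing lists are required to be nonempty because then distinct vertices of a well-formed
  graph are distinct as pairs of lists, so that a graph is determined, up to the order of the
  vertices and of the legs, by its set of vertices.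
\<close>

definition separated :: "vertex set \<Rightarrow> bool" where
  "separated S \<longleftrightarrow> finite S \<and> (\<forall>v\<in>S. fst v \<noteq> [])
     \<and> (\<forall>v\<in>S. distinct (fst v)) \<and> pairwise (\<lambda>u v. set (fst u) \<inter> set (fst v) = {}) S
     \<and> (\<forall>v\<in>S. distinct (snd v)) \<and> pairwise (\<lambda>u v. set (snd u) \<inter> set (snd v) = {}) S"

text \<open>
  Connectedness in the form in which it is used below: every cut is crossed by an edge.
\<close>

definition connected_set :: "vertex set \<Rightarrow> bool" where
  "connected_set S \<longleftrightarrow> S \<noteq> {} \<and>
     (\<forall>A. A \<subseteq> S \<and> A \<noteq> {} \<and> A \<noteq> S \<longrightarrow> (\<exists>u\<in>A. \<exists>v\<in>S - A. (u, v) \<in> arrows S \<or> (v, u) \<in> arrows S))"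

definition ranked :: "vertex set \<Rightarrow> bool" where
  "ranked S \<longleftrightarrow> (\<exists>r :: vertex \<Rightarrow> nat. \<forall>(u, v) \<in> arrows S. r u < r v)"

text \<open>
  The graph stays acyclic when \<open>U\<close> is contracted to a point. This is stated by a
  rank function that is constant on \<open>U\<close>, since it serves at once as a rank function
  of the contracted graph.
\<close>

definition collapsible :: "vertex set \<Rightarrow> vertex set \<Rightarrow> bool" where
  "collapsible S U \<longleftrightarrow> (\<exists>r :: vertex \<Rightarrow> nat. (\<forall>x\<in>U. \<forall>y\<in>U. r x = r y)
     \<and> (\<forall>(x, y) \<in> arrows S. x \<in> U \<and> y \<in> U \<or> r x < r y))"

definition good :: "vertex set \<Rightarrow> bool" where
  "good S \<longleftrightarrow> separated S \<and> connected_set S \<and> ranked S"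

definition legs :: "vertex set \<Rightarrow> nat list \<Rightarrow> nat list \<Rightarrow> bool" where
  "legs S os is \<longleftrightarrow> distinct os \<and> distinct is
     \<and> set os = out_labels S - in_labels S \<and> set is = in_labels S - out_labels S"

lemma arrowsI: "\<lbrakk>u \<in> S; v \<in> S; e \<in> set (fst u); e \<in> set (snd v)\<rbrakk> \<Longrightarrow> (u, v) \<in> arrows S"
  by (auto simp: arrows_def)

lemma arrowsE:
  assumes "(u, v) \<in> arrows S"
  obtains e where "u \<in> S" "v \<in> S" "e \<in> set (fst u)" "e \<in> set (snd v)"
  using assms by (auto simp: arrows_def)

lemma label_unique:
  assumes "separated S" "u \<in> S" "v \<in> S"
  shows "e \<in> set (fst u) \<Longrightarrow> e \<in> set (fst v) \<Longrightarrow> u = v"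
    and "e \<in> set (snd u) \<Longrightarrow> e \<in> set (snd v) \<Longrightarrow> u = v"
  using assms unfolding separated_def pairwise_def by blast+

lemma finite_labels:
  assumes "separated S" shows "finite (out_labels S)" "finite (in_labels S)" "finite (inner S)"
  using assms by (auto simp: separated_def out_labels_def in_labels_def inner_def)

lemma separated_subset: "separated S \<Longrightarrow> T \<subseteq> S \<Longrightarrow> separated T"
  unfolding separated_def by (meson finite_subset subset_iff pairwise_subset)

lemma arrows_mono: "T \<subseteq> S \<Longrightarrow> arrows T \<subseteq> arrows S"
  by (auto simp: arrows_def)

lemma arrows_restrict: "(u, v) \<in> arrows S \<Longrightarrow> u \<in> T \<Longrightarrow> v \<in> T \<Longrightarrow> (u, v) \<in> arrows T"
  by (auto simp: arrows_def)

lemma ranked_subset: "ranked S \<Longrightarrow> T \<subseteq> S \<Longrightarrow> ranked T"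
  unfolding ranked_def using arrows_mono by blast

text \<open>
  The rank of a vertex is its number of ancestors.
\<close>

lemma acyclic_imp_rank:
  assumes "finite S" "acyclic R" "R \<subseteq> S \<times> S"
  shows "\<exists>r :: 'b \<Rightarrow> nat. \<forall>(u, v) \<in> R. r u < r v"
proof -
  define r where "r v = card {u \<in> S. (u, v) \<in> R\<^sup>+}" for v
  have "r u < r v" if uv: "(u, v) \<in> R" for u v
  proof -
    have sub: "{x \<in> S. (x, u) \<in> R\<^sup>+} \<subseteq> {x \<in> S. (x, v) \<in> R\<^sup>+}"
      using uv by auto
    have "u \<in> {x \<in> S. (x, v) \<in> R\<^sup>+}" "u \<notin> {x \<in> S. (x, u) \<in> R\<^sup>+}"
      using uv assms(2,3) by (auto simp: acyclic_def)
    with sub have "{x \<in> S. (x, u) \<in> R\<^sup>+} \<subset> {x \<in> S. (x, v) \<in> R\<^sup>+}" by blast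
    then show ?thesis unfolding r_def by (rule psubset_card_mono[rotated]) (simp add: assms(1))
  qed
  then show ?thesis by blast
qed

lemma rank_imp_acyclic:
  assumes "\<forall>(u, v) \<in> R. (r u :: nat) < r v" shows "acyclic R"
proof -
  have "r u < r v" if "(u, v) \<in> R\<^sup>+" for u v
    using that by (induction) (use assms in fastforce)+
  then show ?thesis unfolding acyclic_def by blast
qed

lemma rank_trancl:
  assumes "\<forall>(u, v) \<in> R. (r u :: nat) < r v" "(u, v) \<in> R\<^sup>+" shows "r u < r v"
  using assms(2) by (induction) (use assms(1) in fastforce)+

lemma distinct_concat_map_iff:
  assumes "distinct vs"
  shows "distinct (concat (map f vs)) \<longleftrightarrow> (\<forall>v\<in>set vs. distinct (f v)) \<and>
    pairwise (\<lambda>u v. set (f u) \<inter> set (f v) = {}) (set vs)"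
  using assms
proof (induction vs)
  case (Cons a vs)
  have "set (f a) \<inter> set (concat (map f vs)) = {}
      \<longleftrightarrow> (\<forall>v. v \<in> set vs \<and> v \<noteq> a \<longrightarrow> set (f a) \<inter> set (f v) = {} \<and> set (f v) \<inter> set (f a) = {})"
    using Cons.prems by auto
  moreover have "distinct (concat (map f (a # vs))) \<longleftrightarrow> distinct (f a)
      \<and> distinct (concat (map f vs)) \<and> set (f a) \<inter> set (concat (map f vs)) = {}"
    unfolding list.map concat.simps distinct_append by blast
  moreover have "distinct (concat (map f vs)) \<longleftrightarrow> (\<forall>v\<in>set vs. distinct (f v)) \<and>
      pairwise (\<lambda>u v. set (f u) \<inter> set (f v) = {}) (set vs)"
    using Cons by simp
  ultimately show ?case
    unfolding list.set ball_simps pairwise_insert by blast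
qed simp

lemma distinct_if_distinct_concat_map:
  assumes "distinct (concat (map f vs))" "\<forall>v\<in>set vs. f v \<noteq> []"
  shows "distinct vs"
  using assms
proof (induction vs)
  case (Cons a vs)
  have "a \<notin> set vs"
  proof
    assume "a \<in> set vs"
    then have "set (f a) \<subseteq> set (f a) \<inter> set (concat (map f vs))" by auto
    with Cons.prems show False by simp
  qed
  with Cons show ?case by simp
qed simp

lemma wf_graph_iff:
  assumes "\<forall>v\<in>set vs. fst v \<noteq> []"
  shows "wf_graph (Graph vs os is) \<and> set is \<inter> set os = {}
    \<longleftrightarrow> distinct vs \<and> separated (set vs) \<and> legs (set vs) os is"
proof -
  have o: "set (concat (map fst vs)) = out_labels (set vs)"
    and i: "set (concat (map snd vs)) = in_labels (set vs)"
    by (auto simp: out_labels_def in_labels_def)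
  have "wf_graph (Graph vs os is) \<longleftrightarrow>
      (distinct is \<and> distinct os \<and> distinct (concat (map fst vs)) \<and> distinct (concat (map snd vs))) \<and>
      set is \<inter> out_labels (set vs) = {} \<and> set os \<inter> in_labels (set vs) = {} \<and>
      set is \<union> out_labels (set vs) = set os \<union> in_labels (set vs)"
    unfolding wf_graph_def edge_sources_def edge_targets_def graph.sel distinct_append set_append o i
    by blast
  also have "\<dots> \<and> set is \<inter> set os = {} \<longleftrightarrow>
      (distinct is \<and> distinct os \<and> distinct (concat (map fst vs)) \<and> distinct (concat (map snd vs))) \<and>
      set os = out_labels (set vs) - in_labels (set vs) \<and> set is = in_labels (set vs) - out_labels (set vs)"
    by blast
  also have "\<dots> \<longleftrightarrow> distinct vs \<and> separated (set vs) \<and> legs (set vs) os is"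
  proof (cases "distinct vs")
    case True
    show ?thesis
      unfolding distinct_concat_map_iff[OF True] separated_def legs_def
      using True assms by auto
  next
    case False
    then show ?thesis using distinct_if_distinct_concat_map[OF _ assms] by blast
  qed
  finally show ?thesis .
qed

lemma adj_nth_iff:
  "(i, j) \<in> adj (Graph vs os is) \<longleftrightarrow>
     i < length vs \<and> j < length vs \<and> (vs ! i, vs ! j) \<in> arrows (set vs)"
  by (auto simp: adj_def arrows_def)

lemma acyclic_adj_iff:
  "acyclic (adj (Graph vs os is)) \<longleftrightarrow> ranked (set vs)" if "distinct vs"
proof
  assume "ranked (set vs)"
  then obtain r :: "vertex \<Rightarrow> nat" where r: "\<forall>(u, v) \<in> arrows (set vs). r u < r v"
    unfolding ranked_def by blast
  then have "\<forall>(i, j) \<in> adj (Graph vs os is). r (vs ! i) < r (vs ! j)"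
    by (auto simp: adj_nth_iff)
  then show "acyclic (adj (Graph vs os is))"
    using rank_imp_acyclic[of _ "\<lambda>i. r (vs ! i)"] by blast
next
  assume "acyclic (adj (Graph vs os is))"
  moreover have "adj (Graph vs os is) \<subseteq> {..<length vs} \<times> {..<length vs}"
    by (auto simp: adj_nth_iff)
  ultimately obtain r :: "nat \<Rightarrow> nat" where r: "\<forall>(i, j) \<in> adj (Graph vs os is). r i < r j"
    using acyclic_imp_rank[of "{..<length vs}"] by blast
  define ix where "ix v = (THE i. i < length vs \<and> vs ! i = v)" for v
  have ix: "ix (vs ! i) = i" if "i < length vs" for i
    unfolding ix_def using that \<open>distinct vs\<close> by (auto simp: nth_eq_iff_index_eq)
  have "r (ix u) < r (ix v)" if uv: "(u, v) \<in> arrows (set vs)" for u v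
  proof -
    obtain i j where "i < length vs" "j < length vs" "vs ! i = u" "vs ! j = v"
      using uv by (auto simp: arrows_def in_set_conv_nth)
    with uv r ix show ?thesis by (force simp: adj_nth_iff)
  qed
  then show "ranked (set vs)" unfolding ranked_def by (auto intro!: exI[of _ "\<lambda>v. r (ix v)"])
qed

lemma connected_graph_iff:
  assumes "distinct vs" "vs \<noteq> []"
  shows "connected_graph (Graph vs os is) \<longleftrightarrow> set is \<inter> set os = {} \<and> connected_set (set vs)"
proof -
  let ?A = "adj (Graph vs os is)"
  let ?R = "(?A \<union> ?A\<inverse>)\<^sup>*"
  have "(\<forall>i<length vs. \<forall>j<length vs. (i, j) \<in> linked (Graph vs os is)) \<longleftrightarrow> connected_set (set vs)"
  proof
    assume L: "\<forall>i<length vs. \<forall>j<length vs. (i, j) \<in> linked (Graph vs os is)"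
    show "connected_set (set vs)" unfolding connected_set_def
    proof (intro conjI allI impI)
      show "set vs \<noteq> {}" using assms by simp
      fix A assume A: "A \<subseteq> set vs \<and> A \<noteq> {} \<and> A \<noteq> set vs"
      then obtain u v where "u \<in> A" "u \<in> set vs" "v \<in> set vs" "v \<notin> A" by blast
      then obtain i j where ij: "i < length vs" "vs ! i \<in> A" "j < length vs" "vs ! j \<notin> A"
        unfolding in_set_conv_nth by blast
      with L have "(i, j) \<in> ?R" by (auto simp: linked_def)
      then show "\<exists>u\<in>A. \<exists>v\<in>set vs - A. (u, v) \<in> arrows (set vs) \<or> (v, u) \<in> arrows (set vs)"
        using ij(2,4)
      proof (induction rule: converse_rtrancl_induct)
        case (step y z)
        show ?case
        proof (cases "vs ! z \<in> A")
          case True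
          then show ?thesis using step by blast
        next
          case False
          then have "vs ! z \<in> set vs - A" "(vs ! y, vs ! z) \<in> arrows (set vs) \<or> (vs ! z, vs ! y) \<in> arrows (set vs)"
            using step(1) by (auto simp: adj_nth_iff)
          then show ?thesis using step(4) by blast
        qed
      qed simp
    qed
  next
    assume C: "connected_set (set vs)"
    show "\<forall>i<length vs. \<forall>j<length vs. (i, j) \<in> linked (Graph vs os is)"
    proof (intro allI impI)
      fix i j assume ij: "i < length vs" "j < length vs"
      let ?B = "{vs ! k | k. k < length vs \<and> (i, k) \<in> ?R}"
      have "?B = set vs"
      proof (rule ccontr)
        assume "?B \<noteq> set vs"
        moreover have "vs ! i \<in> ?B" using ij by blast
        moreover have "?B \<subseteq> set vs" by auto
        ultimately have "?B \<subseteq> set vs \<and> ?B \<noteq> {} \<and> ?B \<noteq> set vs" by blast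
        from C[unfolded connected_set_def, THEN conjunct2, rule_format, OF this]
        obtain u v where uv: "u \<in> ?B" "v \<in> set vs - ?B"
            "(u, v) \<in> arrows (set vs) \<or> (v, u) \<in> arrows (set vs)"
          by (elim bexE)
        then obtain k l where kl: "u = vs ! k" "k < length vs" "(i, k) \<in> ?R" "v = vs ! l" "l < length vs"
          by (auto simp: in_set_conv_nth)
        then have "(k, l) \<in> ?A \<union> ?A\<inverse>" using uv by (auto simp: adj_nth_iff)
        with kl(3) have "(i, l) \<in> ?R" by (rule rtrancl.rtrancl_into_rtrancl)
        then show False using uv kl by blast
      qed
      then have "vs ! j \<in> ?B" using ij by simp
      then show "(i, j) \<in> linked (Graph vs os is)"
        using ij assms by (auto simp: linked_def nth_eq_iff_index_eq)
    qed
  qed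
  then show ?thesis using assms by (simp add: connected_graph_def)
qed

text \<open>
  From here on all arguments on graphs are about finite sets of vertices.
\<close>

lemma cdag_iff:
  assumes "\<forall>v\<in>set vs. fst v \<noteq> []" "vs \<noteq> []"
  shows "cdag (Graph vs os is) \<longleftrightarrow> distinct vs \<and> good (set vs) \<and> legs (set vs) os is"
proof (cases "distinct vs")
  case True
  show ?thesis
    unfolding cdag_def good_def acyclic_adj_iff[OF True] connected_graph_iff[OF True assms(2)]
    using wf_graph_iff[OF assms(1), of os "is"] by blast
next
  case False
  have "set is \<inter> set os = {}" if "connected_graph (Graph vs os is)"
    using that assms by (auto simp: connected_graph_def)
  then show ?thesis
    using False wf_graph_iff[OF assms(1), of os "is"] by (auto simp: cdag_def)
qed

lemma inner_internal_edges: "internal_edges (Graph vs os is) = inner (set vs)"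
  by (auto simp: internal_edges_def inner_def out_labels_def in_labels_def)

text \<open>
  A connected graph has genus \<open>E - V + 1\<close>.
\<close>

lemma genus_pos_iff:
  assumes "cdag G" "distinct (verts G)"
  shows "genus G > 0 \<longleftrightarrow> verts G \<noteq> [] \<and> length (verts G) \<le> card (inner (set (verts G)))"
proof (cases "verts G = []")
  case True
  then show ?thesis by (simp add: genus_def internal_edges_def linked_def)
next
  case False
  obtain vs os "is" where G: "G = Graph vs os is" by (cases G)
  have L: "linked G = {..<length vs} \<times> {..<length vs}"
    using assms(1) False by (auto simp: cdag_def connected_graph_def linked_def G)
  have "{..<length vs} // linked G = {{..<length vs}}"
  proof -
    have "{..<length vs} // linked G = (\<lambda>i. {..<length vs}) ` {..<length vs}"
      unfolding L quotient_def by auto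
    then show ?thesis using False by (auto simp: G)
  qed
  then show ?thesis
    using False by (simp add: genus_def G inner_internal_edges less_Suc_eq_le)
qed

section \<open>Inserting and contracting subgraphs\<close>

definition crossing :: "vertex set \<Rightarrow> vertex set \<Rightarrow> bool" where
  "crossing S A \<longleftrightarrow> (\<exists>u\<in>A. \<exists>v\<in>S - A. (u, v) \<in> arrows S \<or> (v, u) \<in> arrows S)"

lemma connected_set_crossing:
  "connected_set S \<longleftrightarrow> S \<noteq> {} \<and> (\<forall>A. A \<subseteq> S \<and> A \<noteq> {} \<and> A \<noteq> S \<longrightarrow> crossing S A)"
  by (simp add: connected_set_def crossing_def)

lemma crossing_compl: "A \<subseteq> S \<Longrightarrow> crossing S (S - A) \<longleftrightarrow> crossing S A"
  unfolding crossing_def by (auto simp: double_diff)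

lemma crossingI_arrow:
  "\<lbrakk>(u, v) \<in> arrows S \<or> (v, u) \<in> arrows S; u \<in> A; v \<in> S; v \<notin> A\<rbrakk> \<Longrightarrow> crossing S A"
  unfolding crossing_def by blast

lemma out_labelsI: "u \<in> S \<Longrightarrow> e \<in> set (fst u) \<Longrightarrow> e \<in> out_labels S"
  and in_labelsI: "u \<in> S \<Longrightarrow> e \<in> set (snd u) \<Longrightarrow> e \<in> in_labels S"
  by (auto simp: out_labels_def in_labels_def)

lemma labels_Un: "out_labels (S \<union> T) = out_labels S \<union> out_labels T"
    "in_labels (S \<union> T) = in_labels S \<union> in_labels T"
  and labels_insert: "out_labels (insert v S) = set (fst v) \<union> out_labels S"
    "in_labels (insert v S) = set (snd v) \<union> in_labels S"
  by (auto simp: out_labels_def in_labels_def)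

lemma labels_split:
  assumes "legs U hos his"
  shows "out_labels U = set hos \<union> inner U" "in_labels U = set his \<union> inner U"
    "set hos \<inter> in_labels U = {}" "set his \<inter> out_labels U = {}"
    "set hos \<inter> inner U = {}" "set his \<inter> inner U = {}" "set hos \<inter> set his = {}"
  using assms by (auto simp: legs_def inner_def)

lemma separated_insertI:
  assumes "separated T" "fst v \<noteq> []" "distinct (fst v)" "distinct (snd v)"
    and disj: "\<And>t. t \<in> T \<Longrightarrow> set (fst v) \<inter> set (fst t) = {} \<and> set (snd v) \<inter> set (snd t) = {}"
  shows "separated (insert v T)"
proof -
  have "set (fst t) \<inter> set (fst v) = {} \<and> set (snd t) \<inter> set (snd v) = {}" if "t \<in> T" for t
    using disj[OF that] by blast
  with assms show ?thesis unfolding separated_def pairwise_insert by simp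
qed

text \<open>
  The vertex \<open>(hos, his)\<close> of a graph is replaced by a graph \<open>U\<close> whose
  legs carry the names of the edges at that vertex, while its inner edges are new. Read
  backwards, \<open>U\<close> is contracted to a vertex. A flip is a contraction followed by an
  insertion.
\<close>

locale insertion =
  fixes T U :: "vertex set" and hos his :: "nat list"
  assumes sepT: "separated (insert (hos, his) T)" and vT: "(hos, his) \<notin> T"
    and sepU: "separated U" and legsU: "legs U hos his"
    and fresh: "inner U \<inter> (out_labels T \<union> in_labels T) = {}"
begin

abbreviation "G \<equiv> insert (hos, his) T"

lemma out_TU: "out_labels T \<inter> out_labels U = {}"
proof -
  have "set hos \<inter> out_labels T = {}"
    using label_unique(1)[OF sepT, of "(hos, his)"] vT by (fastforce simp: out_labels_def)
  then show ?thesis using fresh labels_split(1)[OF legsU] by blast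
qed

lemma in_TU: "in_labels T \<inter> in_labels U = {}"
proof -
  have "set his \<inter> in_labels T = {}"
    using label_unique(2)[OF sepT, of "(hos, his)"] vT by (fastforce simp: in_labels_def)
  then show ?thesis using fresh labels_split(2)[OF legsU] by blast
qed

lemma disjoint: "T \<inter> U = {}"
proof -
  have "u \<notin> U" if "u \<in> T" for u
  proof
    assume "u \<in> U"
    obtain e where "e \<in> set (fst u)"
      using sepU \<open>u \<in> U\<close> by (cases "fst u") (auto simp: separated_def)
    then show False using out_TU that \<open>u \<in> U\<close> out_labelsI by blast
  qed
  then show ?thesis by blast
qed

lemma separated_insertion: "separated (T \<union> U)"
proof -
  have T: "separated T" using sepT by (rule separated_subset) auto
  have cross: "set (fst t) \<inter> set (fst u) = {} \<and> set (snd t) \<inter> set (snd u) = {}"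
    if "t \<in> T" "u \<in> U" for t u
    using that out_TU in_TU out_labelsI in_labelsI by blast
  have "pairwise R (T \<union> U)" if "pairwise R T" "pairwise R U" "\<And>t u. t \<in> T \<Longrightarrow> u \<in> U \<Longrightarrow> R t u \<and> R u t"
    for R :: "vertex \<Rightarrow> vertex \<Rightarrow> bool"
    using that unfolding pairwise_def by (metis Un_iff)
  then show ?thesis
    using T sepU cross unfolding separated_def by (simp add: ball_Un Int_commute)
qed

lemma arrow_TU:
  assumes "t \<in> T" "u \<in> U" "(t, u) \<in> arrows (T \<union> U)"
  shows "(t, (hos, his)) \<in> arrows G"
proof -
  obtain e where e: "e \<in> set (fst t)" "e \<in> set (snd u)" using assms(3) by (auto elim: arrowsE)
  then have "e \<in> out_labels T" "e \<in> in_labels U" using assms out_labelsI in_labelsI by auto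
  then have "e \<in> set his" using fresh labels_split(2)[OF legsU] by blast
  then show ?thesis using e assms(1) by (intro arrowsI[of _ _ _ e]) auto
qed

lemma arrow_UT:
  assumes "t \<in> T" "u \<in> U" "(u, t) \<in> arrows (T \<union> U)"
  shows "((hos, his), t) \<in> arrows G"
proof -
  obtain e where e: "e \<in> set (snd t)" "e \<in> set (fst u)" using assms(3) by (auto elim: arrowsE)
  then have "e \<in> in_labels T" "e \<in> out_labels U" using assms out_labelsI in_labelsI by auto
  then have "e \<in> set hos" using fresh labels_split(1)[OF legsU] by blast
  then show ?thesis using e assms(1) by (intro arrowsI[of _ _ _ e]) auto
qed

lemma arrow_Tv:
  assumes "t \<in> T" "(t, (hos, his)) \<in> arrows G" obtains u where "u \<in> U" "(t, u) \<in> arrows (T \<union> U)"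
proof -
  obtain e where e: "e \<in> set (fst t)" "e \<in> set his" using assms(2) by (auto elim: arrowsE)
  then have "e \<in> in_labels U" using labels_split(2)[OF legsU] by blast
  then obtain u where "u \<in> U" "e \<in> set (snd u)" by (auto simp: in_labels_def)
  then show ?thesis using that e assms(1) by (meson UnI1 UnI2 arrowsI)
qed

lemma arrow_vT:
  assumes "t \<in> T" "((hos, his), t) \<in> arrows G" obtains u where "u \<in> U" "(u, t) \<in> arrows (T \<union> U)"
proof -
  obtain e where e: "e \<in> set (snd t)" "e \<in> set hos" using assms(2) by (auto elim: arrowsE)
  then have "e \<in> out_labels U" using labels_split(1)[OF legsU] by blast
  then obtain u where "u \<in> U" "e \<in> set (fst u)" by (auto simp: out_labels_def)
  then show ?thesis using that e assms(1) by (meson UnI1 UnI2 arrowsI)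
qed

text \<open>
  A cut that does not separate \<open>U\<close> comes from a cut of the original graph; any
  other cut is crossed inside \<open>U\<close>.
\<close>

lemma connected_insertion:
  assumes "connected_set G" "connected_set U" shows "connected_set (T \<union> U)"
proof -
  have away: "crossing (T \<union> U) A" if A: "A \<subseteq> T" "A \<noteq> {}" for A
  proof -
    have "A \<subseteq> G" "A \<noteq> G" using A vT by auto
    then have "crossing G A" using assms(1) A(2) by (auto simp: connected_set_crossing)
    then obtain a b where ab: "a \<in> A" "b \<in> G" "b \<notin> A" "(a, b) \<in> arrows G \<or> (b, a) \<in> arrows G"
      by (auto simp: crossing_def)
    have aT: "a \<in> T" using ab A by auto
    show ?thesis
    proof (cases "b = (hos, his)")
      case True
      obtain u where "u \<in> U" "(a, u) \<in> arrows (T \<union> U) \<or> (u, a) \<in> arrows (T \<union> U)"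
        using ab(4) arrow_Tv[OF aT] arrow_vT[OF aT] unfolding True by metis
      then show ?thesis using crossingI_arrow[of a u] ab(1) A disjoint by blast
    next
      case False
      then have "(a, b) \<in> arrows (T \<union> U) \<or> (b, a) \<in> arrows (T \<union> U)" "b \<in> T \<union> U"
        using ab aT by (auto simp: arrows_def)
      then show ?thesis using crossingI_arrow[of a b] ab by blast
    qed
  qed
  have "crossing (T \<union> U) A" if A: "A \<subseteq> T \<union> U" "A \<noteq> {}" "A \<noteq> T \<union> U" for A
  proof -
    consider "A \<inter> U = {}" | "U \<subseteq> A" | "A \<inter> U \<noteq> {}" "A \<inter> U \<noteq> U" by blast
    then show ?thesis
    proof cases
      case 1
      then show ?thesis using away[of A] A by blast
    next
      case 2
      have "crossing (T \<union> U) (T \<union> U - A)" by (rule away) (use 2 A in auto)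
      then show ?thesis using crossing_compl[OF A(1)] by simp
    next
      case 3
      then have "crossing U (A \<inter> U)" using assms(2) by (auto simp: connected_set_crossing)
      then show ?thesis unfolding crossing_def arrows_def by blast
    qed
  qed
  moreover have "T \<union> U \<noteq> {}" using assms(2) by (auto simp: connected_set_def)
  ultimately show ?thesis by (simp add: connected_set_crossing)
qed

text \<open>
  Lexicographic combination of the rank in the outer graph and the rank in \<open>U\<close>.
\<close>

lemma ranked_insertion:
  assumes "ranked G" "ranked U" shows "ranked (T \<union> U)"
proof -
  obtain r where r: "\<And>x y. (x, y) \<in> arrows G \<Longrightarrow> (r x :: nat) < r y"
    using assms(1) unfolding ranked_def by blast
  obtain q where q: "\<And>x y. (x, y) \<in> arrows U \<Longrightarrow> (q x :: nat) < q y"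
    using assms(2) unfolding ranked_def by blast
  define N where "N = Suc (Max (q ` U))"
  have N: "q u < N" if "u \<in> U" for u
    using that sepU by (auto simp: N_def separated_def less_Suc_eq_le)
  define s where "s x = (if x \<in> U then N * r (hos, his) + q x else N * r x)" for x
  have lt: "N * a + i < N * b" if "a < b" "i < N" for a b i :: nat
  proof -
    have "N * a + i < N * Suc a" using that by simp
    also have "\<dots> \<le> N * b" using that by (intro mult_le_mono2) auto
    finally show ?thesis .
  qed
  have "s x < s y" if xy: "(x, y) \<in> arrows (T \<union> U)" for x y
  proof -
    have mem: "x \<in> T \<union> U" "y \<in> T \<union> U" using xy by (auto simp: arrows_def)
    consider "x \<in> U" "y \<in> U" | "x \<in> U" "y \<in> T" "y \<notin> U" | "x \<in> T" "x \<notin> U" "y \<in> U"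
      | "x \<in> T" "y \<in> T" "x \<notin> U" "y \<notin> U" using mem by blast
    then show ?thesis
    proof cases
      case 1
      then have "(x, y) \<in> arrows U" using arrows_restrict[OF xy] by blast
      then show ?thesis using q 1 by (simp add: s_def)
    next
      case 2
      then show ?thesis using lt[OF r[OF arrow_UT[OF _ _ xy]] N] by (simp add: s_def)
    next
      case 3
      have "N * r x < N * r (hos, his)"
        using lt[OF r[OF arrow_TU[OF _ _ xy]], of 0] 3 by (simp add: N_def)
      also have "\<dots> \<le> N * r (hos, his) + q y" by simp
      finally show ?thesis using 3 by (simp add: s_def)
    next
      case 4
      then have "(x, y) \<in> arrows G" using xy by (auto simp: arrows_def)
      then have "r x < r y" by (rule r)
      then show ?thesis using 4 by (simp add: s_def) (simp add: N_def)
    qed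
  qed
  then show ?thesis unfolding ranked_def by blast
qed

lemma labels_insertion:
  "out_labels (T \<union> U) = out_labels G \<union> inner U" "in_labels (T \<union> U) = in_labels G \<union> inner U"
  "inner U \<inter> out_labels G = {}" "inner U \<inter> in_labels G = {}"
  using labels_split[OF legsU] fresh by (auto simp: labels_Un labels_insert)

lemma inner_insertion: "inner (T \<union> U) = inner G \<union> inner U" "inner G \<inter> inner U = {}"
  using labels_insertion unfolding inner_def[of "T \<union> U"] inner_def[of G] by blast+

lemma legs_insertion: "legs (T \<union> U) os is \<longleftrightarrow> legs G os is"
proof -
  have "out_labels (T \<union> U) - in_labels (T \<union> U) = out_labels G - in_labels G"
    "in_labels (T \<union> U) - out_labels (T \<union> U) = in_labels G - out_labels G"
    using labels_insertion by blast+
  then show ?thesis unfolding legs_def by simp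
qed

lemma card_insertion:
  "card (T \<union> U) + 1 = card G + card U" "card (inner (T \<union> U)) = card (inner G) + card (inner U)"
proof -
  have "finite T" "finite U" using sepT sepU by (auto simp: separated_def)
  then show "card (T \<union> U) + 1 = card G + card U"
    using vT disjoint by (simp add: card_Un_disjoint)
  show "card (inner (T \<union> U)) = card (inner G) + card (inner U)"
    unfolding inner_insertion(1)
    by (rule card_Un_disjoint) (use finite_labels[OF sepT] finite_labels[OF sepU] inner_insertion(2) in auto)
qed

lemma good_insertion: "good G \<Longrightarrow> good U \<Longrightarrow> good (T \<union> U)"
  using separated_insertion connected_insertion ranked_insertion by (auto simp: good_def)

end

lemma sink_exists:
  assumes "ranked S" "finite S" "S \<noteq> {}"
  obtains v where "v \<in> S" "\<And>w. (v, w) \<notin> arrows S"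
proof -
  obtain r where r: "\<And>x y. (x, y) \<in> arrows S \<Longrightarrow> (r x :: nat) < r y"
    using assms(1) unfolding ranked_def by blast
  have "Max (r ` S) \<in> r ` S" using assms by simp
  then obtain v where v: "v \<in> S" "r v = Max (r ` S)" by auto
  have "(v, w) \<notin> arrows S" for w
  proof
    assume vw: "(v, w) \<in> arrows S"
    then have "w \<in> S" by (auto simp: arrows_def)
    then have "r w \<le> r v" using v assms(2) by simp
    then show False using r[OF vw] by simp
  qed
  then show ?thesis using that v by blast
qed

text \<open>
  A sink of \<open>U\<close> has an outgoing edge, which must be a leg.
\<close>

lemma out_legs_nonempty:
  assumes "good U" "legs U hos his" shows "hos \<noteq> []"
proof -
  obtain v where v: "v \<in> U" "\<And>w. (v, w) \<notin> arrows U"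
    using sink_exists[of U] assms(1) by (auto simp: good_def separated_def connected_set_def)
  obtain e where e: "e \<in> set (fst v)"
    using v(1) assms(1) by (cases "fst v") (auto simp: good_def separated_def)
  have "e \<notin> in_labels U" using v e by (auto simp: in_labels_def arrows_def)
  then have "e \<in> set hos" using v e assms(2) out_labelsI by (auto simp: legs_def)
  then show ?thesis by auto
qed

lemma contraction:
  assumes S: "good S" and U: "U \<subseteq> S" "connected_set U" "legs U hos his" and c: "collapsible S U"
  shows "insertion (S - U) U hos his" "good (insert (hos, his) (S - U))" "good U"
proof -
  let ?v = "(hos, his)" and ?T = "S - U"
  have sepS: "separated S" using S by (simp add: good_def)
  then have sepU: "separated U" and sepT': "separated ?T"
    using separated_subset[of S] U by auto
  show gU: "good U" using sepU U S ranked_subset by (auto simp: good_def)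
  have nonempty: "hos \<noteq> []" using out_legs_nonempty[OF gU U(3)] .
  have out_disj: "out_labels ?T \<inter> out_labels U = {}"
  proof -
    have False if e: "e \<in> out_labels ?T" "e \<in> out_labels U" for e
    proof -
      obtain t u where "t \<in> ?T" "e \<in> set (fst t)" "u \<in> U" "e \<in> set (fst u)"
        using e unfolding out_labels_def by blast
      then show False using label_unique(1)[OF sepS, of t u e] U(1) by blast
    qed
    then show ?thesis by blast
  qed
  have in_disj: "in_labels ?T \<inter> in_labels U = {}"
  proof -
    have False if e: "e \<in> in_labels ?T" "e \<in> in_labels U" for e
    proof -
      obtain t u where "t \<in> ?T" "e \<in> set (snd t)" "u \<in> U" "e \<in> set (snd u)"
        using e unfolding in_labels_def by blast
      then show False using label_unique(2)[OF sepS, of t u e] U(1) by blast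
    qed
    then show ?thesis by blast
  qed
  have vT: "?v \<notin> ?T"
  proof
    assume "?v \<in> ?T"
    moreover obtain e where "e \<in> set hos" using nonempty by (cases hos) auto
    ultimately show False using out_disj labels_split(1)[OF U(3)] out_labelsI[of ?v ?T e] by auto
  qed
  have "set hos \<inter> set (fst t) = {} \<and> set his \<inter> set (snd t) = {}" if "t \<in> ?T" for t
  proof -
    have "set (fst t) \<subseteq> out_labels ?T" "set (snd t) \<subseteq> in_labels ?T"
      by (auto intro: out_labelsI[OF that] in_labelsI[OF that])
    then show ?thesis using out_disj in_disj labels_split(1,2)[OF U(3)] by blast
  qed
  then have sepT: "separated (insert ?v ?T)"
    using sepT' nonempty U(3) by (intro separated_insertI) (auto simp: legs_def)
  have fresh: "inner U \<inter> (out_labels ?T \<union> in_labels ?T) = {}"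
    using out_disj in_disj unfolding inner_def by blast
  show ins: "insertion ?T U hos his"
    using sepT vT sepU U fresh by (unfold_locales) auto
  interpret insertion ?T U hos his by (rule ins)
  have TU: "?T \<union> U = S" using U by blast
  have away: "crossing G A" if A: "A \<subseteq> ?T" "A \<noteq> {}" for A
  proof -
    have "U \<noteq> {}" using U(2) by (simp add: connected_set_def)
    then have "A \<subseteq> S" "A \<noteq> S" using A U by auto
    then have "crossing S A" using S A(2) by (auto simp: connected_set_crossing good_def)
    then obtain a b where ab: "a \<in> A" "b \<in> S" "b \<notin> A" "(a, b) \<in> arrows S \<or> (b, a) \<in> arrows S"
      by (auto simp: crossing_def)
    have aT: "a \<in> ?T" using ab A by auto
    show ?thesis
    proof (cases "b \<in> U")
      case True
      then have "(a, ?v) \<in> arrows G \<or> (?v, a) \<in> arrows G"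
        using arrow_TU[OF aT, of b] arrow_UT[OF aT, of b] ab(4) TU by auto
      then show ?thesis using crossingI_arrow[of a ?v] ab(1) A vT by blast
    next
      case False
      then have "(a, b) \<in> arrows G \<or> (b, a) \<in> arrows G" "b \<in> G"
        using ab aT by (auto simp: arrows_def)
      then show ?thesis using crossingI_arrow[of a b] ab by blast
    qed
  qed
  have "crossing G A" if A: "A \<subseteq> G" "A \<noteq> {}" "A \<noteq> G" for A
  proof (cases "?v \<in> A")
    case False
    then show ?thesis using away A by blast
  next
    case True
    have "crossing G (G - A)" by (rule away) (use True A in auto)
    then show ?thesis using crossing_compl[OF A(1)] by simp
  qed
  then have conn: "connected_set G" by (simp add: connected_set_crossing)
  obtain r where r: "\<And>x y. x \<in> U \<Longrightarrow> y \<in> U \<Longrightarrow> (r x :: nat) = r y"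
    "\<And>x y. (x, y) \<in> arrows S \<Longrightarrow> x \<in> U \<and> y \<in> U \<or> r x < r y"
    using c unfolding collapsible_def by blast
  obtain u0 where u0: "u0 \<in> U" using U(2) by (auto simp: connected_set_def)
  define s where "s x = (if x = ?v then r u0 else r x)" for x
  have "s x < s y" if xy: "(x, y) \<in> arrows G" for x y
  proof -
    have mem: "x \<in> G" "y \<in> G" using xy by (auto simp: arrows_def)
    have loop: "(?v, ?v) \<notin> arrows G"
      using labels_split(7)[OF U(3)] by (auto simp: arrows_def)
    consider "x = ?v" "y \<in> ?T" | "x \<in> ?T" "y = ?v" | "x \<in> ?T" "y \<in> ?T"
      using mem loop xy by blast
    then show ?thesis
    proof cases
      case 1
      obtain u where u: "u \<in> U" "(u, y) \<in> arrows S" using arrow_vT[OF 1(2)] xy 1 TU by metis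
      then have "r u < r y" using r(2)[OF u(2)] 1 by blast
      moreover have "y \<noteq> ?v" using 1(2) vT by blast
      ultimately show ?thesis using r(1)[OF u(1) u0] 1(1) by (simp add: s_def)
    next
      case 2
      obtain u where u: "u \<in> U" "(x, u) \<in> arrows S" using arrow_Tv[OF 2(1)] xy 2 TU by metis
      then have "r x < r u" using r(2)[OF u(2)] 2 by blast
      moreover have "x \<noteq> ?v" using 2(1) vT by blast
      ultimately show ?thesis using r(1)[OF u(1) u0] 2(2) by (simp add: s_def)
    next
      case 3
      then have "(x, y) \<in> arrows S" using xy by (auto simp: arrows_def)
      then have "r x < r y" using r(2) 3 by blast
      moreover have "x \<noteq> ?v" "y \<noteq> ?v" using 3 vT by blast+
      ultimately show ?thesis by (simp add: s_def)
    qed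
  qed
  then have "ranked G" unfolding ranked_def by blast
  then show "good G" using sepT conn by (simp add: good_def)
qed

lemma inner_mono: "A \<subseteq> B \<Longrightarrow> inner A \<subseteq> inner B"
  unfolding inner_def out_labels_def in_labels_def by blast

text \<open>
  A growing set of vertices gains at least one inner edge with each new vertex.
\<close>

lemma connected_card_bound:
  assumes "separated S" "connected_set S"
  shows "card S \<le> card (inner S) + 1"
proof -
  have fin: "finite S" using assms(1) by (simp add: separated_def)
  have "n < card S \<Longrightarrow> \<exists>A\<subseteq>S. card A = Suc n \<and> n \<le> card (inner A)" for n
  proof (induction n)
    case 0
    obtain a where "a \<in> S" using assms(2) by (auto simp: connected_set_def)
    then show ?case by (intro exI[of _ "{a}"]) auto
  next
    case (Suc n)
    then obtain A where A: "A \<subseteq> S" "card A = Suc n" "n \<le> card (inner A)" by auto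
    then have "A \<noteq> {}" "A \<noteq> S" using Suc.prems by auto
    then obtain a b where ab: "a \<in> A" "b \<in> S - A" "(a, b) \<in> arrows S \<or> (b, a) \<in> arrows S"
      using assms(2) A(1) unfolding connected_set_def by blast
    have "\<exists>e. e \<in> inner (insert b A) - inner A"
      using ab(3)
    proof
      assume "(a, b) \<in> arrows S"
      then obtain e where e: "e \<in> set (fst a)" "e \<in> set (snd b)" by (auto elim: arrowsE)
      then have "e \<notin> in_labels A"
        using label_unique(2)[OF assms(1), of b] ab A by (auto simp: in_labels_def)
      then show ?thesis using e ab by (auto simp: inner_def labels_insert intro: out_labelsI)
    next
      assume "(b, a) \<in> arrows S"
      then obtain e where e: "e \<in> set (fst b)" "e \<in> set (snd a)" by (auto elim: arrowsE)
      then have "e \<notin> out_labels A"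
        using label_unique(1)[OF assms(1), of b] ab A by (auto simp: out_labels_def)
      then show ?thesis using e ab by (auto simp: inner_def labels_insert intro: in_labelsI)
    qed
    then have "inner A \<subset> inner (insert b A)" using inner_mono[of A "insert b A"] by blast
    moreover have "finite (inner (insert b A))"
      using finite_labels(3)[OF separated_subset[OF assms(1), of "insert b A"]] A ab by blast
    ultimately have "card (inner A) < card (inner (insert b A))" by (rule psubset_card_mono[rotated])
    moreover have "card (insert b A) = Suc (Suc n)"
      using A ab finite_subset[OF A(1) fin] by simp
    ultimately show ?case using A ab by (intro exI[of _ "insert b A"]) auto
  qed
  from this[of "card S - 1"] show ?thesis
  proof (cases "card S = 0")
    case False
    then obtain A where "A \<subseteq> S" "card A = card S" "card S - 1 \<le> card (inner A)"
      using \<open>card S - 1 < card S \<Longrightarrow> _\<close> by auto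
    then have "A = S" using fin card_subset_eq by blast
    then show ?thesis using \<open>card S - 1 \<le> card (inner A)\<close> by simp
  qed simp
qed

section \<open>Values of trivalent graphs\<close>

definition trivalent :: "vertex \<Rightarrow> bool" where
  "trivalent v \<longleftrightarrow> (\<exists>a b c. v = mul a b c \<or> v = cop a b c)"

lemma trivalent_mul_cop [simp]: "trivalent (mul a b c)" "trivalent (cop a b c)"
  by (auto simp: trivalent_def)

lemma trivalent_nonempty: "trivalent v \<Longrightarrow> fst v \<noteq> []"
  by (auto simp: trivalent_def)

lemma pair_good:
  assumes "fst u \<noteq> []" "fst v \<noteq> []" "distinct (fst u)" "distinct (fst v)" "distinct (snd u)" "distinct (snd v)"
    "set (fst u) \<inter> set (fst v) = {}" "set (snd u) \<inter> set (snd v) = {}"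
    "set (fst u) \<inter> set (snd v) \<noteq> {}" "set (fst v) \<inter> set (snd u) = {}"
    "set (fst u) \<inter> set (snd u) = {}" "set (fst v) \<inter> set (snd v) = {}"
  shows "good {u, v}"
proof -
  have uv: "u \<noteq> v" using assms(1,7) by auto
  have arr: "arrows {u, v} = {(u, v)}"
    using assms(9-12) by (auto simp: arrows_def)
  have "connected_set {u, v}"
    unfolding connected_set_def arr by auto
  moreover have "ranked {u, v}"
    unfolding ranked_def arr using uv by (auto intro!: exI[of _ "\<lambda>x. if x = u then 0 else 1"])
  moreover have "separated {u, v}"
    using assms(1-8) uv unfolding separated_def pairwise_def by (auto simp: Int_commute)
  ultimately show ?thesis by (simp add: good_def)
qed

locale bib_properad = is_properad P for P :: "('k::field_char_0, 'a::ab_group_add) properad" +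
  fixes m \<Delta> :: 'a
  assumes m_hom: "m \<in> hom P 1 2 (- 1)" and \<Delta>_hom: "\<Delta> \<in> hom P 2 1 0"
    and relations_hold: "bib_relations P m \<Delta>"
begin

definition generator :: "vertex \<Rightarrow> 'a" where
  "generator v = (if length (fst v) = 1 then m else \<Delta>)"

definition generator_degree :: "vertex \<Rightarrow> int" where
  "generator_degree v = (if length (fst v) = 1 then - 1 else 0)"

definition val :: "vertex list \<Rightarrow> nat list \<Rightarrow> nat list \<Rightarrow> 'a" where
  "val vs os is = compose P (Graph vs os is) (map generator vs)"

text \<open>
  By \<open>vanishesI\<close> below it is enough to check one order of the vertices and of the
  legs.
\<close>

definition vanishes :: "vertex set \<Rightarrow> bool" where
  "vanishes S \<longleftrightarrow> (\<forall>vs os is. distinct vs \<and> set vs = S \<and> legs S os is \<longrightarrow> val vs os is = 0)"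

text \<open>
  Signs never matter below: only whether a value is zero.
\<close>

definition proportional :: "'a \<Rightarrow> 'a \<Rightarrow> bool" (infix "\<approx>" 50) where
  "x \<approx> y \<longleftrightarrow> (\<exists>c. c \<noteq> 0 \<and> x = scal P c y)"

lemma scal_scal: "scal P c (scal P d x) = scal P (c * d) x"
  using module.scale_scale[OF module_scal] .

lemma scal_one: "scal P 1 x = x"
  using module.scale_one[OF module_scal] .

lemma scal_minus_one: "scal P (- 1) x = - x"
  using module.scale_minus_left[OF module_scal, of 1 x] by (simp add: scal_one)

lemma scal_0_right: "scal P c 0 = 0"
  using module.scale_zero_right[OF module_scal] .

lemma prop_refl: "x \<approx> x"
  unfolding proportional_def by (rule exI[of _ 1]) (simp add: scal_one)

lemma prop_minus: "x \<approx> - x"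
  unfolding proportional_def by (rule exI[of _ "- 1"]) (simp add: scal_minus_one)

lemma prop_sym: "x \<approx> y \<Longrightarrow> y \<approx> x"
proof -
  assume "x \<approx> y"
  then obtain c where c: "c \<noteq> 0" "x = scal P c y" by (auto simp: proportional_def)
  then have "y = scal P (inverse c) x" by (simp add: scal_scal scal_one)
  then show "y \<approx> x" unfolding proportional_def using c by (intro exI[of _ "inverse c"]) simp
qed

lemma prop_trans [trans]: "x \<approx> y \<Longrightarrow> y \<approx> z \<Longrightarrow> x \<approx> z"
proof -
  assume "x \<approx> y" "y \<approx> z"
  then obtain c d where "c \<noteq> 0" "x = scal P c y" "d \<noteq> 0" "y = scal P d z" by (auto simp: proportional_def)
  then show "x \<approx> z" unfolding proportional_def by (intro exI[of _ "c * d"]) (simp add: scal_scal)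
qed

lemma prop_zero: "x \<approx> y \<Longrightarrow> y = 0 \<Longrightarrow> x = 0"
  by (auto simp: proportional_def scal_0_right)

lemma generator_hom: "trivalent v \<Longrightarrow> generator v \<in> hom P (length (fst v)) (length (snd v)) (generator_degree v)"
  using m_hom \<Delta>_hom by (auto simp: trivalent_def generator_def generator_degree_def numeral_2_eq_2)

lemma generator_ops: "trivalent v \<Longrightarrow> generator v \<in> ops P (length (fst v)) (length (snd v))"
  using generator_hom hom_imp_ops by blast

lemma generator_list_ops:
  "\<forall>v\<in>set vs. trivalent v \<Longrightarrow>
     list_all2 (\<lambda>v p. p \<in> ops P (length (fst v)) (length (snd v))) vs (map generator vs)"
  by (simp add: list_all2_conv_all_nth generator_ops)

lemma decoration_generator: "\<forall>v\<in>set vs. trivalent v \<Longrightarrow> decoration P (Graph vs os is) (map generator vs)"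
  by (simp add: decoration_def generator_list_ops)

lemma cdag_trivalent_iff:
  assumes "\<forall>v\<in>set vs. trivalent v" "vs \<noteq> []"
  shows "cdag (Graph vs os is) \<longleftrightarrow> distinct vs \<and> good (set vs) \<and> legs (set vs) os is"
  using cdag_iff assms trivalent_nonempty by blast

lemma val_ops:
  assumes "cdag (Graph vs os is)" "\<forall>v\<in>set vs. trivalent v"
  shows "val vs os is \<in> ops P (length os) (length is)"
proof -
  have "val vs os is \<in> hom P (length (outs (Graph vs os is))) (length (ins (Graph vs os is)))
      (sum_list (map generator_degree vs))"
    unfolding val_def by (rule compose_hom[OF assms(1)]) (use assms(2) generator_hom in auto)
  then show ?thesis using hom_imp_ops by simp
qed

lemma val_swap:
  assumes "cdag (Graph (us @ v # w # ws) os is)" "\<forall>x\<in>set (us @ v # w # ws). trivalent x"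
  shows "val (us @ v # w # ws) os is \<approx> val (us @ w # v # ws) os is"
proof -
  have "val (us @ v # w # ws) os is
      = scal P (koszul_sign (generator_degree v) (generator_degree w)) (val (us @ w # v # ws) os is)"
    unfolding val_def map_append list.map
  proof (rule symmetry[OF assms(1)])
    show "decoration P (Graph (us @ v # w # ws) os is) (map generator us @ generator v # generator w # map generator ws)"
      using decoration_generator[OF assms(2), of os "is"] by simp
  qed (use assms(2) generator_hom in auto)
  moreover have "koszul_sign (generator_degree v) (generator_degree w) \<noteq> (0 :: 'k)"
    by (simp add: koszul_sign_def)
  ultimately show ?thesis unfolding proportional_def by blast
qed

lemma val_move:
  assumes "cdag (Graph (us @ v # vs @ ws) os is)" "\<forall>x\<in>set (us @ v # vs @ ws). trivalent x"
  shows "val (us @ v # vs @ ws) os is \<approx> val (us @ vs @ v # ws) os is"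
  using assms
proof (induction vs arbitrary: us)
  case Nil
  then show ?case by (simp add: prop_refl)
next
  case (Cons w vs)
  have "val (us @ v # w # vs @ ws) os is \<approx> val (us @ w # v # vs @ ws) os is"
    using Cons.prems by (intro val_swap) auto
  also have "val ((us @ [w]) @ v # vs @ ws) os is \<approx> val ((us @ [w]) @ vs @ v # ws) os is"
  proof (rule Cons.IH)
    have "cdag (Graph (us @ w # v # vs @ ws) os is) \<longleftrightarrow> cdag (Graph (us @ v # w # vs @ ws) os is)"
      using Cons.prems(2) by (subst (1 2) cdag_trivalent_iff) (auto simp: insert_commute)
    then show "cdag (Graph ((us @ [w]) @ v # vs @ ws) os is)" using Cons.prems(1) by simp
  qed (use Cons.prems in auto)
  then have "val (us @ w # v # vs @ ws) os is \<approx> val (us @ w # vs @ v # ws) os is" by simp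
  finally show ?case by simp
qed

lemma val_permute:
  assumes "mset vs = mset vs'" "cdag (Graph (us @ vs) os is)" "\<forall>x\<in>set (us @ vs). trivalent x"
  shows "val (us @ vs) os is \<approx> val (us @ vs') os is"
  using assms
proof (induction vs arbitrary: us vs')
  case Nil
  then have "vs' = []" by simp
  then show ?case by (simp add: prop_refl)
next
  case (Cons v vs)
  have "v \<in> set vs'" using Cons.prems(1) by (metis list.set_intros(1) set_mset_mset)
  then obtain a b where vs': "vs' = a @ v # b" by (meson split_list)
  have ms: "mset vs = mset (a @ b)" using Cons.prems(1) by (simp add: vs')
  have "val ((us @ [v]) @ vs) os is \<approx> val ((us @ [v]) @ (a @ b)) os is"
    using Cons.prems ms by (intro Cons.IH) auto
  then have "val (us @ v # vs) os is \<approx> val (us @ v # a @ b) os is" by simp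
  also have "\<dots> \<approx> val (us @ a @ v # b) os is"
  proof (rule val_move)
    have "set vs = set a \<union> set b" "distinct vs \<longleftrightarrow> distinct (a @ b)"
      using ms by (metis mset_eq_setD set_append, metis mset_eq_imp_distinct_iff)
    then have s: "set (us @ v # a @ b) = set (us @ v # vs)"
      "distinct (us @ v # a @ b) \<longleftrightarrow> distinct (us @ v # vs)" by auto
    show t: "\<forall>x\<in>set (us @ v # a @ b). trivalent x" using Cons.prems(3) s by simp
    show "cdag (Graph (us @ v # a @ b) os is)"
      using Cons.prems(2) cdag_trivalent_iff[OF t] cdag_trivalent_iff[OF Cons.prems(3)] s by simp
  qed
  finally show ?case by (simp add: vs')
qed

lemma val_insertion:
  assumes "insertion T U hos his" "good (insert (hos, his) T)" "good U"
    and T: "distinct vs" "set vs = T" "\<forall>v\<in>T. trivalent v"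
    and U: "distinct us" "set us = U" "\<forall>v\<in>U. trivalent v"
    and os: "legs (insert (hos, his) T) os is"
  shows "val (vs @ us) os is
      = compose P (Graph (vs @ [(hos, his)]) os is) (map generator vs @ [val us hos his])"
    and "cdag (Graph (vs @ [(hos, his)]) os is)"
    and "val us hos his \<in> ops P (length hos) (length his)"
    and "decoration P (Graph (vs @ [(hos, his)]) os is) (map generator vs @ [val us hos his])"
proof -
  interpret insertion T U hos his by fact
  have ne: "\<forall>v\<in>set (vs @ [(hos, his)]). fst v \<noteq> []"
    using T trivalent_nonempty out_legs_nonempty[OF assms(3) legsU] by auto
  show G: "cdag (Graph (vs @ [(hos, his)]) os is)"
    using assms vT by (subst cdag_iff[OF ne]) auto
  have "us \<noteq> []" using assms(3) U(2) by (auto simp: good_def connected_set_def)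
  then have H: "cdag (Graph us hos his)"
    using U legsU assms(3) by (subst cdag_trivalent_iff) auto
  have K: "cdag (Graph (vs @ us) os is)"
    using T U \<open>us \<noteq> []\<close> disjoint good_insertion[OF assms(2,3)] os legs_insertion
    by (subst cdag_trivalent_iff) auto
  show "val us hos his \<in> ops P (length hos) (length his)" using val_ops[OF H] U by simp
  then show "decoration P (Graph (vs @ [(hos, his)]) os is) (map generator vs @ [val us hos his])"
    using generator_list_ops[of vs] T by (simp add: decoration_def list_all2_appendI)
  show "val (vs @ us) os is
      = compose P (Graph (vs @ [(hos, his)]) os is) (map generator vs @ [val us hos his])"
    using compose_insert[of vs hos his "[]" os "is" us "map generator us" "map generator vs" "[]"]
      G H K T U generator_list_ops[of vs] decoration_generator[of us hos his]
    by (simp add: val_def cdag_def)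
qed

lemma legs_exist: "separated S \<Longrightarrow> \<exists>os is. legs S os is"
  using finite_distinct_list[of "out_labels S - in_labels S"] finite_labels[of S]
    finite_distinct_list[of "in_labels S - out_labels S"]
  unfolding legs_def by (meson finite_Diff)

lemma collapsible_whole: "collapsible S S"
  unfolding collapsible_def by (rule exI[of _ "\<lambda>_. 0"]) (auto simp: arrows_def)

text \<open>
  Reordering the legs is composition with a one-vertex graph, so it cannot turn zero into a
  nonzero value.
\<close>

lemma val_change_legs:
  assumes S: "good S" "\<forall>v\<in>S. trivalent v" and L: "legs S os is" "legs S os' is'"
    and us: "distinct us" "set us = S"
  shows "val us os is = compose P (Graph [(os', is')] os is) [val us os' is']"
    and "cdag (Graph [(os', is')] os is)"
    and "decoration P (Graph [(os', is')] os is) [val us os' is']"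
proof -
  have c: "S \<subseteq> S" "connected_set S" using S(1) by (auto simp: good_def)
  note con = contraction[OF S(1) c L(2) collapsible_whole]
  have con': "insertion {} S os' is'" "good (insert (os', is') {})" using con by auto
  interpret insertion "{}" S os' is' by fact
  have os: "legs (insert (os', is') {}) os is" using legs_insertion[of os "is"] L(1) by simp
  note v = val_insertion[OF con' S(1), of "[]" us, simplified, OF us S(2) os]
  show "val us os is = compose P (Graph [(os', is')] os is) [val us os' is']"
    "cdag (Graph [(os', is')] os is)" "decoration P (Graph [(os', is')] os is) [val us os' is']"
    using v by simp_all
qed

lemma compose_single_prop:
  assumes "cdag G" "decoration P G (ps @ [y])" "x \<approx> y"
  shows "compose P G (ps @ [x]) \<approx> compose P G (ps @ [y])"
proof -
  obtain c where "c \<noteq> 0" "x = scal P c y" using assms(3) by (auto simp: proportional_def)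
  then show ?thesis unfolding proportional_def using compose_scal[OF assms(1,2)] by blast
qed

lemma val_permute':
  assumes "good S" "\<forall>v\<in>S. trivalent v" "legs S os is"
    "distinct vs" "set vs = S" "distinct vs'" "set vs' = S"
  shows "val vs os is \<approx> val vs' os is"
proof -
  have "vs \<noteq> []" using assms by (auto simp: good_def connected_set_def)
  then have "cdag (Graph ([] @ vs) os is)" using assms by (subst cdag_trivalent_iff) auto
  moreover have "mset vs = mset vs'" using assms by (simp flip: set_eq_iff_mset_eq_distinct)
  ultimately show ?thesis using val_permute[of vs vs' "[]"] assms by simp
qed

lemma vanishesI:
  assumes S: "good S" "\<forall>v\<in>S. trivalent v" and "legs S os is" "distinct vs" "set vs = S"
    and "val vs os is = 0"
  shows "vanishes S"
  unfolding vanishes_def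
proof (intro allI impI)
  fix vs' os' is' assume *: "distinct vs' \<and> set vs' = S \<and> legs S os' is'"
  have "val vs' os is = 0"
    using val_permute'[OF S assms(3), of vs' vs] * assms by (auto intro: prop_zero)
  then show "val vs' os' is' = 0"
    using val_change_legs[OF S _ assms(3), of os' is' vs'] * compose_zero[of _ "[]" "[]"] by simp
qed

text \<open>
  The composite along the large graph is the composite along the contracted graph, with the
  value of \<open>U\<close> as one of its arguments.
\<close>

lemma vanishes_supergraph:
  assumes S: "good S" "\<forall>v\<in>S. trivalent v"
    and U: "U \<subseteq> S" "connected_set U" "collapsible S U" and v: "vanishes U"
  shows "vanishes S"
proof -
  have sep: "separated U" "separated S" using S(1) U(1) separated_subset by (auto simp: good_def)
  obtain hos his where L: "legs U hos his" using legs_exist[OF sep(1)] by blast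
  obtain os "is" where LS: "legs S os is" using legs_exist[OF sep(2)] by blast
  note con = contraction[OF S(1) U(1,2) L U(3)]
  interpret insertion "S - U" U hos his by (rule con)
  have SU: "S - U \<union> U = S" using U by blast
  have LG: "legs G os is" using legs_insertion LS unfolding SU by simp
  have "finite S" using sep by (simp add: separated_def)
  then obtain vs us where vs: "distinct vs" "set vs = S - U" and us: "distinct us" "set us = U"
    using finite_distinct_list finite_subset[OF U(1)] by (metis finite_Diff)
  have tr: "\<forall>v\<in>S - U. trivalent v" "\<forall>v\<in>U. trivalent v" using S(2) U(1) by auto
  note vi = val_insertion[OF con vs tr(1) us tr(2) LG]
  have "val us hos his = 0" using v us L by (simp add: vanishes_def)
  then have "val (vs @ us) os is = 0"
    using vi(1) compose_zero[OF vi(2), of "map generator vs" "[]"] vi(4) by simp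
  moreover have "distinct (vs @ us)" "set (vs @ us) = S" using vs us U by auto
  ultimately show ?thesis using vanishesI[OF S LS] by blast
qed

text \<open>
  By \<open>similar_legs\<close> below it does not matter which orders of the vertices and of
  the legs are chosen.
\<close>

definition similar :: "vertex set \<Rightarrow> vertex set \<Rightarrow> bool" where
  "similar U U' \<longleftrightarrow> good U \<and> good U' \<and> (\<forall>v\<in>U. trivalent v) \<and> (\<forall>v\<in>U'. trivalent v) \<and>
     (\<exists>us us' hos his. distinct us \<and> set us = U \<and> distinct us' \<and> set us' = U' \<and>
        legs U hos his \<and> legs U' hos his \<and> val us hos his \<approx> val us' hos his)"

lemma similar_sym: "similar U U' \<Longrightarrow> similar U' U"
  unfolding similar_def using prop_sym by blast

lemma similar_legs:
  assumes "similar U U'" "distinct us" "set us = U" "distinct us'" "set us' = U'" "legs U hos his"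
  shows "legs U' hos his" "val us hos his \<approx> val us' hos his"
proof -
  have g: "good U" "good U'" "\<forall>v\<in>U. trivalent v" "\<forall>v\<in>U'. trivalent v"
    using assms(1) by (auto simp: similar_def)
  obtain ws ws' os "is" where w: "distinct ws" "set ws = U" "distinct ws'" "set ws' = U'"
      "legs U os is" "legs U' os is" "val ws os is \<approx> val ws' os is"
    using assms(1) unfolding similar_def by blast
  show L': "legs U' hos his" using w(5,6) assms(6) by (auto simp: legs_def)
  note a = val_change_legs[OF g(1,3) assms(6) w(5) assms(2,3)]
  note b = val_change_legs[OF g(2,4) L' w(6) assms(4,5)]
  have "val us os is \<approx> val ws os is"
    using val_permute'[OF g(1,3) w(5)] assms w by blast
  also note w(7)
  also have "val ws' os is \<approx> val us' os is"
    using val_permute'[OF g(2,4) w(6)] assms w by blast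
  finally show "val us hos his \<approx> val us' hos his"
    unfolding a(1) b(1) using compose_single_prop[OF a(2), of "[]"] b(3) by simp
qed

lemma similar_trans: "similar U U' \<Longrightarrow> similar U' U'' \<Longrightarrow> similar U U''"
proof -
  assume a: "similar U U'" "similar U' U''"
  obtain us us' hos his where w: "distinct us" "set us = U" "distinct us'" "set us' = U'"
      "legs U hos his" "legs U' hos his" "val us hos his \<approx> val us' hos his"
    using a(1) unfolding similar_def by blast
  obtain us'' where us'': "distinct us''" "set us'' = U''" using a(2) unfolding similar_def by blast
  note l = similar_legs[OF a(2) w(3,4) us'' w(6)]
  have "val us hos his \<approx> val us'' hos his" using prop_trans[OF w(7) l(2)] .
  moreover have "good U" "good U''" "\<forall>v\<in>U. trivalent v" "\<forall>v\<in>U''. trivalent v"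
    using a unfolding similar_def by blast+
  ultimately show "similar U U''"
    unfolding similar_def using w(1,2,5) us'' l(1) by blast
qed

text \<open>
  Contract \<open>U\<close>, then insert \<open>U'\<close>. Both graphs have their value along
  one and the same contracted graph, with proportional arguments.
\<close>

lemma replacement:
  assumes S: "good S" "\<forall>v\<in>S. trivalent v"
    and U: "U \<subseteq> S" "collapsible S U" and sim: "similar U U'"
    and inner: "inner U' \<subseteq> inner U"
  shows "good (S - U \<union> U')" "vanishes (S - U \<union> U') \<Longrightarrow> vanishes S"
    "card (S - U \<union> U') + card U = card S + card U'"
    "inner (S - U \<union> U') \<union> inner U = inner S \<union> inner U'"
    "card (inner (S - U \<union> U')) + card (inner U) = card (inner S) + card (inner U')"
proof -
  have gU: "good U" "good U'" and trU: "\<forall>v\<in>U. trivalent v" "\<forall>v\<in>U'. trivalent v"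
    using sim by (auto simp: similar_def)
  have conn: "connected_set U" using gU by (simp add: good_def)
  have sep: "separated U" "separated S" using S(1) U(1) separated_subset by (auto simp: good_def)
  obtain hos his where L: "legs U hos his" using legs_exist[OF sep(1)] by blast
  obtain us us' where us: "distinct us" "set us = U" and us': "distinct us'" "set us' = U'"
    using sim by (auto simp: similar_def)
  note sl = similar_legs[OF sim us us' L]
  note con = contraction[OF S(1) U(1) conn L U(2)]
  interpret old: insertion "S - U" U hos his by (rule con)
  interpret new: insertion "S - U" U' hos his
    using old.sepT old.vT old.fresh gU(2) sl(1) inner
    by unfold_locales (auto simp: good_def)
  have SU: "S - U \<union> U = S" using U by blast
  show gn: "good (S - U \<union> U')" using new.good_insertion con(2) gU(2) .
  show "card (S - U \<union> U') + card U = card S + card U'"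
    using old.card_insertion(1) new.card_insertion(1) unfolding SU by simp
  show "inner (S - U \<union> U') \<union> inner U = inner S \<union> inner U'"
    using old.inner_insertion(1) new.inner_insertion(1) unfolding SU by blast
  show "card (inner (S - U \<union> U')) + card (inner U) = card (inner S) + card (inner U')"
    using old.card_insertion(2) new.card_insertion(2) unfolding SU by simp
  assume van: "vanishes (S - U \<union> U')"
  obtain os "is" where LS: "legs S os is" using legs_exist[OF sep(2)] by blast
  have LG: "legs old.G os is" using old.legs_insertion LS unfolding SU by simp
  have fin: "finite (S - U)" using sep by (simp add: separated_def)
  obtain vs where vs: "distinct vs" "set vs = S - U" using finite_distinct_list[OF fin] by auto
  have tr: "\<forall>v\<in>S - U. trivalent v" using S(2) by auto
  note vi = val_insertion[OF con vs tr us trU(1) LG]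
  note vi' = val_insertion[OF new.insertion_axioms con(2) gU(2) vs tr us' trU(2) LG]
  have "val (vs @ us') os is = 0"
    using van vs us' new.disjoint new.legs_insertion LG by (auto simp: vanishes_def)
  then have "val (vs @ us) os is = 0"
    using compose_single_prop[OF vi(2) vi'(4) sl(2)] unfolding vi(1) vi'(1) by (rule prop_zero[rotated])
  moreover have "distinct (vs @ us)" "set (vs @ us) = S" using vs us U by auto
  ultimately show "vanishes S" using vanishesI[OF S LS] by blast
qed

end

section \<open>The relations as flips of ribbon graphs\<close>

context bib_properad begin

lemma similarI:
  assumes "cdag (Graph us os is)" "cdag (Graph us' os is)" "us \<noteq> []" "us' \<noteq> []"
    and "\<forall>v\<in>set us. trivalent v" "\<forall>v\<in>set us'. trivalent v"
    and "val us os is \<approx> val us' os is"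
  shows "similar (set us) (set us')"
  using assms unfolding similar_def by (auto simp: cdag_trivalent_iff)

lemma val_relabel:
  assumes "cdag (Graph vs os is)" "vs \<noteq> []" "\<forall>v\<in>set vs. trivalent v"
    and "cdag (Graph (map (relabel \<sigma>) vs) (map \<sigma> os) (map \<sigma> is))"
  shows "val (map (relabel \<sigma>) vs) (map \<sigma> os) (map \<sigma> is) = val vs os is"
proof -
  have "map generator (map (relabel \<sigma>) vs) = map generator vs" by (simp add: generator_def)
  then show ?thesis
    unfolding val_def using compose_relabel[OF assms(1,2) decoration_generator[OF assms(3)]] assms(4)
    by (simp add: cdag_def del: map_map)
qed

text \<open>
  In some of the relations the two sides are given with different orders of the legs, hence the
  two different renamings.
\<close>

lemma similar_relabel:
  assumes "val us os is \<approx> val us' os' is'"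
    and "cdag (Graph us os is)" "cdag (Graph us' os' is')"
    and "\<forall>v\<in>set us. trivalent v" "\<forall>v\<in>set us'. trivalent v" "us \<noteq> []" "us' \<noteq> []"
    and "cdag (Graph (map (relabel \<sigma>) us) (map \<sigma> os) (map \<sigma> is))"
    and "cdag (Graph (map (relabel \<sigma>') us') (map \<sigma>' os') (map \<sigma>' is'))"
    and "map \<sigma> os = map \<sigma>' os'" "map \<sigma> is = map \<sigma>' is'"
  shows "similar (set (map (relabel \<sigma>) us)) (set (map (relabel \<sigma>') us'))"
proof (rule similarI)
  show "val (map (relabel \<sigma>) us) (map \<sigma> os) (map \<sigma> is) \<approx> val (map (relabel \<sigma>') us') (map \<sigma> os) (map \<sigma> is)"
    using assms(1) val_relabel[OF assms(2,6,4,8)] val_relabel[OF assms(3,7,5,9)]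
    by (simp add: assms(10,11))
qed (use assms in \<open>auto simp: trivalent_def\<close>)

lemma cdag_pair:
  assumes "trivalent u" "trivalent v"
    "distinct (fst u)" "distinct (fst v)" "distinct (snd u)" "distinct (snd v)"
    "set (fst v) \<inter> set (fst u) = {}" "set (snd v) \<inter> set (snd u) = {}"
    "set (fst v) \<inter> set (snd u) \<noteq> {}" "set (fst u) \<inter> set (snd v) = {}"
    "set (fst v) \<inter> set (snd v) = {}" "set (fst u) \<inter> set (snd u) = {}"
    "legs {u, v} os is"
  shows "cdag (Graph [u, v] os is)"
proof -
  have "good {v, u}" by (rule pair_good) (use assms trivalent_nonempty[OF assms(1)] trivalent_nonempty[OF assms(2)] in auto)
  moreover have "u \<noteq> v" using trivalent_nonempty[OF assms(1)] assms(7) by auto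
  ultimately show ?thesis
    using assms by (subst cdag_trivalent_iff) (auto simp: insert_commute)
qed

lemma prop_if_sum_zero: "x + y = 0 \<Longrightarrow> x \<approx> y"
  using prop_minus[of "- y"] by (simp add: eq_neg_iff_add_eq_0[symmetric] prop_sym)

lemma prop_if_diff_zero: "x - y = 0 \<Longrightarrow> x \<approx> y" "- x + y = 0 \<Longrightarrow> x \<approx> y"
  by (auto simp: prop_refl add_eq_0_iff2)

lemma bib_relations_val:
  "val [mul 0 4 3, mul 1 2 4] [3] [0, 1, 2] \<approx> val [mul 4 2 3, mul 0 1 4] [3] [0, 1, 2]"
  "val [cop 4 2 3, cop 0 1 4] [1, 2, 3] [0] \<approx> val [cop 4 1 2, cop 0 4 3] [1, 2, 3] [0]"
  "val [cop 4 2 3, mul 0 1 4] [2, 3] [0, 1] \<approx> val [mul 0 4 2, cop 1 4 3] [2, 3] [0, 1]"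
  "val [cop 4 2 3, mul 0 1 4] [2, 3] [0, 1] \<approx> val [mul 4 1 3, cop 0 2 4] [2, 3] [0, 1]"
  "val [mul 0 4 3, cop 1 2 4] [2, 3] [0, 1] \<approx> val [mul 0 4 3, cop 1 2 4] [3, 2] [1, 0]"
  "val [mul 0 4 3, cop 1 2 4] [2, 3] [0, 1] \<approx> val [mul 4 1 2, cop 0 4 3] [2, 3] [1, 0]"
  "val [mul 2 3 1, cop 0 2 3] [1] [0] = 0"
  "val [mul 3 2 1, cop 0 2 3] [1] [0] = 0"
  using relations_hold prop_if_sum_zero prop_if_diff_zero
  by (simp_all add: bib_relations_def val_def generator_def Let_def)

abbreviation five :: "nat \<Rightarrow> nat \<Rightarrow> nat \<Rightarrow> nat \<Rightarrow> nat \<Rightarrow> nat \<Rightarrow> nat" where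
  "five a b c d e i \<equiv> [a, b, c, d, e] ! i"

lemma cdag_two_vertices:
  assumes "distinct [a, b, c, d, e]"
  shows "cdag (Graph [mul a e d, mul b c e] [d] [a, b, c])"
    "cdag (Graph [mul e c d, mul a b e] [d] [a, b, c])"
    "cdag (Graph [cop e c d, cop a b e] [b, c, d] [a])"
    "cdag (Graph [cop e b c, cop a e d] [b, c, d] [a])"
    "cdag (Graph [cop e c d, mul a b e] [c, d] [a, b])"
    "cdag (Graph [mul a e c, cop b e d] [c, d] [a, b])"
    "cdag (Graph [mul e b d, cop a c e] [c, d] [a, b])"
    "cdag (Graph [mul a e d, cop b c e] [c, d] [a, b])"
    "cdag (Graph [mul a e d, cop b c e] [d, c] [b, a])"
    "cdag (Graph [mul e b c, cop a e d] [c, d] [b, a])"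
  by (rule cdag_pair; use assms in \<open>auto simp: legs_def out_labels_def in_labels_def\<close>)+

lemmas cdag_two_vertices_numeral = cdag_two_vertices[of 0 1 2 3 4, simplified]

text \<open>
  The relations for arbitrary names of the edges. In the last two, which compare
  \<open>B\<close> with \<open>\<tau> B \<tau>\<close> and with \<open>D \<tau>\<close>, the
  legs of the second graph are permuted by the renaming.
\<close>

lemma similar_two_vertices:
  assumes "distinct [a, b, c, d, e]"
  shows "similar {mul a e d, mul b c e} {mul e c d, mul a b e}"
    "similar {cop e c d, cop a b e} {cop e b c, cop a e d}"
    "similar {cop e c d, mul a b e} {mul a e c, cop b e d}"
    "similar {cop e c d, mul a b e} {mul e b d, cop a c e}"
    "similar {mul a e d, cop b c e} {mul b e c, cop a d e}"
    "similar {mul a e d, cop b c e} {mul e a c, cop b e d}"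
proof -
  have d: "distinct [b, a, d, c, e]" "distinct [b, a, c, d, e]" using assms by auto
  note c = cdag_two_vertices[OF assms] cdag_two_vertices[OF d(1)] cdag_two_vertices[OF d(2)]
    cdag_two_vertices_numeral
  note r = similar_relabel[where \<sigma> = "five a b c d e" and \<sigma>' = "five a b c d e"]
    similar_relabel[where \<sigma> = "five a b c d e" and \<sigma>' = "five b a d c e"]
    similar_relabel[where \<sigma> = "five a b c d e" and \<sigma>' = "five b a c d e"]
  show "similar {mul a e d, mul b c e} {mul e c d, mul a b e}"
    using r(1)[OF bib_relations_val(1)] c by simp
  show "similar {cop e c d, cop a b e} {cop e b c, cop a e d}"
    using r(1)[OF bib_relations_val(2)] c by simp
  show "similar {cop e c d, mul a b e} {mul a e c, cop b e d}"
    using r(1)[OF bib_relations_val(3)] c by simp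
  show "similar {cop e c d, mul a b e} {mul e b d, cop a c e}"
    using r(1)[OF bib_relations_val(4)] c by simp
  show "similar {mul a e d, cop b c e} {mul b e c, cop a d e}"
    using r(2)[OF bib_relations_val(5)] c by simp
  show "similar {mul a e d, cop b c e} {mul e a c, cop b e d}"
    using r(3)[OF bib_relations_val(6)] c by simp
qed

lemma vanishes_double_edge:
  assumes "distinct [a, b, c, d]"
  shows "vanishes {mul b c d, cop a b c}" "vanishes {mul c b d, cop a b c}"
proof -
  have c: "cdag (Graph [mul b c d, cop a b c] [d] [a])" "cdag (Graph [mul c b d, cop a b c] [d] [a])"
    if "distinct [a, b, c, d]" for a b c d
    by (rule cdag_pair; use that in \<open>auto simp: legs_def out_labels_def in_labels_def\<close>)+
  note c0 = c[of 0 2 3 1, simplified]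
  have "val [mul b c d, cop a b c] [d] [a] = 0" "val [mul c b d, cop a b c] [d] [a] = 0"
    using val_relabel[OF c0(1), of "\<lambda>i. [a, d, b, c] ! i"] val_relabel[OF c0(2), of "\<lambda>i. [a, d, b, c] ! i"]
      c[OF assms] bib_relations_val(7,8) by simp_all
  moreover have "good {mul b c d, cop a b c} \<and> legs {mul b c d, cop a b c} [d] [a]"
    "good {mul c b d, cop a b c} \<and> legs {mul c b d, cop a b c} [d] [a]"
    using c[OF assms] cdag_trivalent_iff[of "[mul b c d, cop a b c]" "[d]" "[a]"]
      cdag_trivalent_iff[of "[mul c b d, cop a b c]" "[d]" "[a]"] by simp_all
  ultimately show "vanishes {mul b c d, cop a b c}" "vanishes {mul c b d, cop a b c}"
    using vanishesI[of _ "[d]" "[a]" "[mul b c d, cop a b c]"]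
      vanishesI[of _ "[d]" "[a]" "[mul c b d, cop a b c]"] by auto
qed

end

text \<open>
  A half-edge is an edge together with its direction, \<open>True\<close> for an outgoing one.
\<close>

type_synonym half_edge = "nat \<times> bool"

text \<open>
  The trivalent vertex with a given cyclic order of half-edges. Which generator sits there is
  determined by the directions; three half-edges of the same direction are impossible, and for
  them the value is an arbitrary non-trivalent vertex.
\<close>

fun cyclic :: "half_edge \<Rightarrow> half_edge \<Rightarrow> half_edge \<Rightarrow> vertex" where
  "cyclic (a, False) (b, False) (c, True) = mul a b c"
| "cyclic (b, False) (c, True) (a, False) = mul a b c"
| "cyclic (c, True) (a, False) (b, False) = mul a b c"
| "cyclic (a, False) (c, True) (b, True) = cop a b c"
| "cyclic (c, True) (b, True) (a, False) = cop a b c"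
| "cyclic (b, True) (a, False) (c, True) = cop a b c"
| "cyclic _ _ _ = ([], [])"

definition mixed :: "bool \<Rightarrow> bool \<Rightarrow> bool \<Rightarrow> bool" where
  "mixed p q r \<longleftrightarrow> \<not> (p = q \<and> q = r)"

context bib_properad begin

lemma similar_swap:
  "similar {u, v} {u', v'} \<Longrightarrow> similar {v, u} {u', v'}"
  "similar {u, v} {u', v'} \<Longrightarrow> similar {u, v} {v', u'}"
  "similar {u, v} {u', v'} \<Longrightarrow> similar {v, u} {v', u'}"
  by (simp_all add: insert_commute)

text \<open>
  When inputs and outputs alternate around the four legs, both ways of pairing neighbours admit
  both directions of the middle edge. The relations connect all four graphs; this is the
  combination that they contain only indirectly.
\<close>

lemma similar_alternating:
  assumes "distinct [a, b, c, d, e]"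
  shows "similar {mul a e d, cop b c e} {mul e b d, cop a e c}"
  using similar_trans[OF similar_two_vertices(5)[OF assms] similar_two_vertices(6)[of b a d c e]] assms
  by auto

lemmas flips = similar_two_vertices(1-4,6) similar_alternating

lemmas all_flips = flips flips[THEN similar_sym]

text \<open>
  The unifying form of all relations with four legs: the legs in their cyclic order \<open>x, y,
  z, w\<close> are paired as \<open>xy|zw\<close> on one side and as \<open>yz|wx\<close> on the
  other. The directions leave 24 cases, and each is an instance of a relation or of the previous
  lemma.
\<close>

lemma flip:
  assumes "distinct [e, x, y, z, w]"
    and "mixed d dx dy" "mixed (\<not> d) dz dw" "mixed d' dy dz" "mixed (\<not> d') dw dx"
  shows "similar {cyclic (e, d) (x, dx) (y, dy), cyclic (e, \<not> d) (z, dz) (w, dw)}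
    {cyclic (e, d') (y, dy) (z, dz), cyclic (e, \<not> d') (w, dw) (x, dx)}"
  by (insert assms; cases d; cases d'; cases dx; cases dy; cases dz; cases dw;
      simp add: mixed_def;
      ((rule all_flips all_flips[THEN similar_swap(1)] all_flips[THEN similar_swap(2)]
         all_flips[THEN similar_swap(3)]); (auto; fail)))

end

section \<open>Half-edges, edge cuts and directed detours\<close>

definition half_edges :: "vertex \<Rightarrow> half_edge set" where
  "half_edges v = (\<lambda>e. (e, True)) ` set (fst v) \<union> (\<lambda>e. (e, False)) ` set (snd v)"

lemma half_edges_iff [simp]:
  "(e, True) \<in> half_edges v \<longleftrightarrow> e \<in> set (fst v)" "(e, False) \<in> half_edges v \<longleftrightarrow> e \<in> set (snd v)"
  by (auto simp: half_edges_def)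

definition mixed3 :: "half_edge \<Rightarrow> half_edge \<Rightarrow> half_edge \<Rightarrow> bool" where
  "mixed3 a b c \<longleftrightarrow> mixed (snd a) (snd b) (snd c)"

text \<open>
  The parameter \<open>\<sigma>\<close> reverses the cyclic order. Mirror images obey the same
  rules, and with this parameter two mirror-symmetric arguments become one.
\<close>

definition ribbon :: "bool \<Rightarrow> half_edge \<Rightarrow> half_edge \<Rightarrow> half_edge \<Rightarrow> vertex" where
  "ribbon \<sigma> a b c = (if \<sigma> then cyclic a b c else cyclic a c b)"

lemma cyclic_rotate: "cyclic a b c = cyclic b c a"
  by (cases a; cases b; cases c; cases "snd a"; cases "snd b"; cases "snd c"; simp)

lemma ribbon_rotate: "ribbon \<sigma> a b c = ribbon \<sigma> b c a"
  unfolding ribbon_def using cyclic_rotate by metis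

lemma mixed3_rotate: "mixed3 a b c \<longleftrightarrow> mixed3 b c a"
  by (auto simp: mixed3_def mixed_def)

lemma half_cyclic: "mixed3 a b c \<Longrightarrow> half_edges (cyclic a b c) = {a, b, c}"
  by (cases a; cases b; cases c; cases "snd a"; cases "snd b"; cases "snd c")
    (auto simp: half_edges_def mixed3_def mixed_def)

lemma half_ribbon: "mixed3 a b c \<Longrightarrow> half_edges (ribbon \<sigma> a b c) = {a, b, c}"
  using half_cyclic[of a b c] half_cyclic[of a c b] by (auto simp: ribbon_def mixed3_def mixed_def)

lemma trivalent_ribbon: "mixed3 a b c \<Longrightarrow> trivalent (ribbon \<sigma> a b c)"
  by (cases a; cases b; cases c; cases "snd a"; cases "snd b"; cases "snd c"; cases \<sigma>)
    (auto simp: ribbon_def mixed3_def mixed_def)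

lemma ribbon_exists:
  assumes "trivalent v" "distinct (fst v)" "distinct (snd v)" "set (fst v) \<inter> set (snd v) = {}"
    and "h \<in> half_edges v"
  obtains a b where "v = ribbon \<sigma> h a b" "mixed3 h a b" "distinct [fst h, fst a, fst b]"
proof -
  have "\<exists>a b. v = cyclic h a b \<and> mixed3 h a b \<and> distinct [fst h, fst a, fst b]"
  proof -
    obtain x y z where "v = mul x y z \<or> v = cop x y z" using assms(1) by (auto simp: trivalent_def)
    then show ?thesis
    proof
      assume v: "v = mul x y z"
      then have d: "distinct [x, y, z]" using assms by auto
      from v assms(5) consider "h = (x, False)" | "h = (y, False)" | "h = (z, True)"
        by (auto simp: half_edges_def)
      then show ?thesis
      proof cases
        case 1
        then show ?thesis using d v
          by (intro exI[of _ "(y, False)"] exI[of _ "(z, True)"]) (auto simp: mixed3_def mixed_def)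
      next
        case 2
        then show ?thesis using d v
          by (intro exI[of _ "(z, True)"] exI[of _ "(x, False)"]) (auto simp: mixed3_def mixed_def)
      next
        case 3
        then show ?thesis using d v
          by (intro exI[of _ "(x, False)"] exI[of _ "(y, False)"]) (auto simp: mixed3_def mixed_def)
      qed
    next
      assume v: "v = cop x y z"
      then have d: "distinct [x, y, z]" using assms by auto
      from v assms(5) consider "h = (x, False)" | "h = (z, True)" | "h = (y, True)"
        by (auto simp: half_edges_def)
      then show ?thesis
      proof cases
        case 1
        then show ?thesis using d v
          by (intro exI[of _ "(z, True)"] exI[of _ "(y, True)"]) (auto simp: mixed3_def mixed_def)
      next
        case 2
        then show ?thesis using d v
          by (intro exI[of _ "(y, True)"] exI[of _ "(x, False)"]) (auto simp: mixed3_def mixed_def)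
      next
        case 3
        then show ?thesis using d v
          by (intro exI[of _ "(x, False)"] exI[of _ "(z, True)"]) (auto simp: mixed3_def mixed_def)
      qed
    qed
  qed
  then obtain a b where ab: "v = cyclic h a b" "mixed3 h a b" "distinct [fst h, fst a, fst b]" by blast
  show thesis
  proof (cases \<sigma>)
    case True
    then show thesis using that[of a b] ab by (simp add: ribbon_def)
  next
    case False
    then show thesis using that[of b a] ab by (auto simp: ribbon_def mixed3_def mixed_def)
  qed
qed

lemma half_unique: "\<lbrakk>separated S; u \<in> S; v \<in> S; h \<in> half_edges u; h \<in> half_edges v\<rbrakk> \<Longrightarrow> u = v"
  using label_unique[of S u v "fst h"] by (auto simp: half_edges_def)

lemma inner_half_iff:
  "e \<in> inner S \<longleftrightarrow> (\<exists>u\<in>S. (e, True) \<in> half_edges u) \<and> (\<exists>v\<in>S. (e, False) \<in> half_edges v)"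
  by (auto simp: inner_def out_labels_def in_labels_def)

lemma inner_end: "e \<in> inner S \<Longrightarrow> \<exists>v\<in>S. (e, d) \<in> half_edges v"
  by (cases d) (auto simp: inner_half_iff)

lemma innerI: "\<lbrakk>u \<in> S; v \<in> S; (e, d) \<in> half_edges u; (e, \<not> d) \<in> half_edges v\<rbrakk> \<Longrightarrow> e \<in> inner S"
  by (cases d) (auto simp: inner_half_iff)

lemma good_no_loop: "good S \<Longrightarrow> v \<in> S \<Longrightarrow> set (fst v) \<inter> set (snd v) = {}"
  unfolding good_def ranked_def arrows_def by blast

lemma good_acyclic: "good S \<Longrightarrow> (x, x) \<notin> (arrows S)\<^sup>+"
  using rank_trancl[of "arrows S"] unfolding good_def ranked_def by blast

lemma arrows_mem: "(x, y) \<in> arrows S \<Longrightarrow> x \<in> S \<and> y \<in> S"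
  by (auto simp: arrows_def)

lemma collapsibleI:
  fixes r :: "vertex \<Rightarrow> nat"
  assumes "\<And>x y. x \<in> U \<Longrightarrow> y \<in> U \<Longrightarrow> r x = r y"
    and "\<And>x y. (x, y) \<in> arrows S \<Longrightarrow> \<not> (x \<in> U \<and> y \<in> U) \<Longrightarrow> r x < r y"
  shows "collapsible S U"
  using assms unfolding collapsible_def by blast

lemma collapsible_if_lower:
  assumes "ranked S" "\<And>a b. a \<in> A \<Longrightarrow> b \<in> S - A \<Longrightarrow> (b, a) \<notin> arrows S"
  shows "collapsible S A"
proof -
  obtain r where r: "\<And>x y. (x, y) \<in> arrows S \<Longrightarrow> (r x :: nat) < r y"
    using assms(1) unfolding ranked_def by blast
  show ?thesis
  proof (rule collapsibleI[where r = "\<lambda>x. if x \<in> A then 0 else Suc (r x)"])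
    fix x y assume "(x, y) \<in> arrows S" "\<not> (x \<in> A \<and> y \<in> A)"
    then show "(if x \<in> A then 0 else Suc (r x)) < (if y \<in> A then 0 else Suc (r y))"
      using assms(2)[of y x] r[of x y] arrows_mem[of x y S] by auto
  qed auto
qed

lemma collapsible_if_upper:
  assumes "ranked S" "finite S" "\<And>a b. a \<in> A \<Longrightarrow> b \<in> S - A \<Longrightarrow> (a, b) \<notin> arrows S"
  shows "collapsible S A"
proof -
  obtain r where r: "\<And>x y. (x, y) \<in> arrows S \<Longrightarrow> (r x :: nat) < r y"
    using assms(1) unfolding ranked_def by blast
  define N where "N = Suc (Max (r ` S))"
  have N: "r x < N" if "x \<in> S" for x
    using that assms(2) by (simp add: N_def less_Suc_eq_le)
  show ?thesis
  proof (rule collapsibleI[where r = "\<lambda>x. if x \<in> A then N else r x"])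
    fix x y assume "(x, y) \<in> arrows S" "\<not> (x \<in> A \<and> y \<in> A)"
    then show "(if x \<in> A then N else r x) < (if y \<in> A then N else r y)"
      using assms(3)[of x y] r[of x y] N[of x] arrows_mem[of x y S] by auto
  qed auto
qed

text \<open>
  Without such a detour from \<open>u\<close> to \<open>v\<close>, a linear extension of the
  order can place \<open>u\<close> and \<open>v\<close> next to each other: first everything
  that does not lie above them, then the two, then the rest.
\<close>

lemma path_if_not_collapsible:
  assumes S: "good S" and uv: "(u, v) \<in> arrows S" and nc: "\<not> collapsible S {u, v}"
  obtains y where "y \<noteq> u" "y \<noteq> v" "(u, y) \<in> (arrows S)\<^sup>+" "(y, v) \<in> arrows S"
proof (rule ccontr)
  assume "\<not> thesis"
  then have none: "\<not> (\<exists>y. y \<noteq> u \<and> y \<noteq> v \<and> (u, y) \<in> (arrows S)\<^sup>+ \<and> (y, v) \<in> arrows S)"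
    using that by blast
  let ?R = "arrows S"
  obtain r where r: "\<And>x y. (x, y) \<in> ?R \<Longrightarrow> (r x :: nat) < r y"
    using S unfolding good_def ranked_def by blast
  define N where "N = Suc (Max (r ` S))"
  have fin: "finite S" using S by (simp add: good_def separated_def)
  have N: "r x < N" if "x \<in> S" for x
    using that fin by (simp add: N_def less_Suc_eq_le)
  \<comment> \<open>the strict descendants of the two vertices\<close>
  define above where "above x \<longleftrightarrow> (u, x) \<in> ?R\<^sup>+ \<or> (v, x) \<in> ?R\<^sup>+" for x
  define q where "q x = (if x = u \<or> x = v then N else if above x then Suc (N + r x) else r x)" for x
  have "q x < q y" if xy: "(x, y) \<in> ?R" and out: "\<not> (x \<in> {u, v} \<and> y \<in> {u, v})" for x y
  proof -
    have mem: "x \<in> S" "y \<in> S" using xy by (auto simp: arrows_def)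
    consider "x \<in> {u, v}" "y \<notin> {u, v}" | "x \<notin> {u, v}" "y \<in> {u, v}" | "x \<notin> {u, v}" "y \<notin> {u, v}"
      using out by blast
    then show ?thesis
    proof cases
      case 1
      then have "above y" using xy by (auto simp: above_def)
      then show ?thesis using 1 by (auto simp: q_def)
    next
      case 2
      have "\<not> above x"
      proof
        assume "above x"
        then consider "(u, x) \<in> ?R\<^sup>+" | "(v, x) \<in> ?R\<^sup>+" by (auto simp: above_def)
        then show False
        proof cases
          case 1
          show False
          proof (cases "y = u")
            case True
            then show False using good_acyclic[OF S] 1 xy by (metis trancl_into_trancl)
          next
            case False
            then show False using none 1 2 xy by blast
          qed
        next
          case v: 2
          then have "(v, y) \<in> ?R\<^sup>+" using xy by (rule trancl_into_trancl)
          then have "(v, v) \<in> ?R\<^sup>+" using 2 uv by (metis insertE singletonD trancl_into_trancl)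
          then show False using good_acyclic[OF S] by blast
        qed
      qed
      then show ?thesis using 2 N[OF mem(1)] by (auto simp: q_def)
    next
      case 3
      have "above y" if "above x" using that xy unfolding above_def by (meson trancl_into_trancl)
      then show ?thesis using 3 r[OF xy] by (auto simp: q_def)
    qed
  qed
  then have "collapsible S {u, v}"
    by (intro collapsibleI[where r = q]) (auto simp: q_def)
  with nc show False by blast
qed

definition labels :: "vertex \<Rightarrow> nat set" where
  "labels v = set (fst v) \<union> set (snd v)"

lemma labels_half: "e \<in> labels v \<longleftrightarrow> (\<exists>d. (e, d) \<in> half_edges v)"
proof -
  have "(\<exists>d. (e, d) \<in> half_edges v) \<longleftrightarrow> (e, True) \<in> half_edges v \<or> (e, False) \<in> half_edges v" by (metis (full_types))
  then show ?thesis by (simp add: labels_def)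
qed

definition edge_cut :: "vertex set \<Rightarrow> vertex set \<Rightarrow> nat set" where
  "edge_cut S A = {e. \<exists>a\<in>A. \<exists>b\<in>S - A. \<exists>d. (e, d) \<in> half_edges a \<and> (e, \<not> d) \<in> half_edges b}"

lemma arrow_half: "(u, v) \<in> arrows S \<longleftrightarrow> u \<in> S \<and> v \<in> S \<and> (\<exists>e. (e, True) \<in> half_edges u \<and> (e, False) \<in> half_edges v)"
  by (auto simp: arrows_def)

lemma cutI: "\<lbrakk>a \<in> A; b \<in> S - A; (e, d) \<in> half_edges a; (e, \<not> d) \<in> half_edges b\<rbrakk> \<Longrightarrow> e \<in> edge_cut S A"
  unfolding edge_cut_def by blast

lemma cut_compl: assumes "A \<subseteq> S" shows "edge_cut S (S - A) = edge_cut S A"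
proof -
  have "edge_cut S (S - B) \<subseteq> edge_cut S B" if "B \<subseteq> S" for B
  proof
    fix e assume "e \<in> edge_cut S (S - B)"
    then obtain a b d where "a \<in> S - B" "b \<in> B" "(e, d) \<in> half_edges a" "(e, \<not> d) \<in> half_edges b"
      unfolding edge_cut_def by blast
    then show "e \<in> edge_cut S B" using cutI[of b B a S e "\<not> d"] by simp
  qed
  from this[OF assms] this[of "S - A"] assms show ?thesis by (simp add: double_diff)
qed

lemma cut_label: "e \<in> edge_cut S A \<Longrightarrow> \<exists>a\<in>A. e \<in> labels a"
  by (auto simp: edge_cut_def labels_half)

lemma inner_cut:
  assumes "A \<subseteq> S"
  shows "inner S = inner A \<union> inner (S - A) \<union> edge_cut S A"
proof (intro subset_antisym subsetI)
  fix e assume "e \<in> inner S"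
  then obtain u v where uv: "u \<in> S" "v \<in> S" "(e, True) \<in> half_edges u" "(e, False) \<in> half_edges v"
    unfolding inner_half_iff by blast
  consider "u \<in> A" "v \<in> A" | "u \<notin> A" "v \<notin> A" | "u \<in> A" "v \<notin> A" | "u \<notin> A" "v \<in> A" by blast
  then show "e \<in> inner A \<union> inner (S - A) \<union> edge_cut S A"
  proof cases
    case 1
    then show ?thesis using uv unfolding Un_iff inner_half_iff by blast
  next
    case 2
    then show ?thesis using uv unfolding Un_iff inner_half_iff by blast
  next
    case 3
    then have "e \<in> edge_cut S A" using uv cutI[of u A v S e True] by simp
    then show ?thesis by blast
  next
    case 4
    then have "e \<in> edge_cut S A" using uv cutI[of v A u S e False] by simp
    then show ?thesis by blast
  qed
next
  fix e assume "e \<in> inner A \<union> inner (S - A) \<union> edge_cut S A"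
  then show "e \<in> inner S"
    using inner_mono[OF assms] inner_mono[of "S - A" S] assms innerI[of _ S _ e] unfolding edge_cut_def by blast
qed

lemma card_inner_cut:
  assumes "separated S" "A \<subseteq> S"
  shows "card (inner S) \<le> card (inner A) + card (inner (S - A)) + card (edge_cut S A)"
  unfolding inner_cut[OF assms(2)]
  using card_Un_le[of "inner A \<union> inner (S - A)" "edge_cut S A"] card_Un_le[of "inner A" "inner (S - A)"]
  by linarith

lemma finite_cut: "separated S \<Longrightarrow> A \<subseteq> S \<Longrightarrow> finite (edge_cut S A)"
  using finite_labels(3)[of S] inner_cut[of A S] by (metis finite_Un)

lemma cut_side_unique:
  assumes "separated S" "A \<subseteq> S" "e \<in> edge_cut S A" "a \<in> A" "a' \<in> A" "e \<in> labels a" "e \<in> labels a'"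
  shows "a = a'"
proof -
  obtain a0 b d where c: "a0 \<in> A" "b \<in> S - A" "(e, d) \<in> half_edges a0" "(e, \<not> d) \<in> half_edges b"
    using assms(3) by (auto simp: edge_cut_def)
  have "x = a0" if x: "x \<in> A" "e \<in> labels x" for x
  proof -
    obtain d' where d': "(e, d') \<in> half_edges x" using x(2) by (auto simp: labels_half)
    show ?thesis
    proof (cases "d' = d")
      case True
      then show ?thesis using half_unique[OF assms(1), of x a0] d' c x assms(2) by blast
    next
      case False
      then have "d' = (\<not> d)" by blast
      then have "x = b" using half_unique[OF assms(1), of x b] d' c x assms(2) by blast
      then show ?thesis using c x by blast
    qed
  qed
  then show ?thesis using assms by metis
qed

text \<open>
  Across a cut with at most one edge all arrows point in the same direction, so either side can
  be contracted. It is connected because the whole graph is and the only exit can serve only one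
  of two parts.
\<close>

lemma bridge_side:
  assumes S: "good S" and A: "A \<subseteq> S" "A \<noteq> {}" and one: "card (edge_cut S A) \<le> 1"
  shows "connected_set A" "collapsible S A"
proof -
  have sep: "separated S" and con: "connected_set S" and ran: "ranked S" and fin: "finite S"
    using S by (auto simp: good_def separated_def)
  have uniq: "e = e'" if "e \<in> edge_cut S A" "e' \<in> edge_cut S A" for e e'
    using one that finite_cut[OF sep A(1)] by (metis card_le_Suc0_iff_eq One_nat_def)
  have "crossing A B" if B: "B \<subseteq> A" "B \<noteq> {}" "B \<noteq> A" for B
  proof (rule ccontr)
    assume nc: "\<not> crossing A B"
    have escape: "\<exists>e c. c \<in> C \<and> e \<in> edge_cut S A \<and> e \<in> labels c"
      if C: "C \<subseteq> A" "C \<noteq> {}" "C \<noteq> S" "\<not> crossing A C" for C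
    proof -
      have "crossing S C" using con C A by (auto simp: connected_set_crossing)
      then obtain c b where cb: "c \<in> C" "b \<in> S - C" "(c, b) \<in> arrows S \<or> (b, c) \<in> arrows S"
        by (auto simp: crossing_def)
      have "b \<notin> A"
      proof
        assume "b \<in> A"
        then have "(c, b) \<in> arrows A \<or> (b, c) \<in> arrows A" using cb C arrows_restrict by blast
        then show False using C(4) cb \<open>b \<in> A\<close> crossingI_arrow[of c b A C] by blast
      qed
      then have "b \<in> S - A" using cb by blast
      moreover obtain e d where "(e, d) \<in> half_edges c" "(e, \<not> d) \<in> half_edges b"
        using cb(3) unfolding arrow_half by (metis (full_types))
      ultimately show ?thesis using cb(1) C(1) unfolding edge_cut_def labels_half by blast
    qed
    obtain e b where e: "b \<in> B" "e \<in> edge_cut S A" "e \<in> labels b"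
      using escape[OF B(1,2) _ nc] B A by blast
    have "\<not> crossing A (A - B)" using nc crossing_compl[OF B(1)] by simp
    then obtain e' b' where e': "b' \<in> A - B" "e' \<in> edge_cut S A" "e' \<in> labels b'"
      using escape[of "A - B"] B A by blast
    have "b = b'" using cut_side_unique[OF sep A(1) e(2)] e e' uniq[OF e(2) e'(2)] B(1) by blast
    then show False using e e' by blast
  qed
  then show "connected_set A" using A(2) by (simp add: connected_set_crossing)
  show "collapsible S A"
  proof (cases "\<exists>a\<in>A. \<exists>b\<in>S - A. (b, a) \<in> arrows S")
    case False
    then show ?thesis using collapsible_if_lower[OF ran, of A] by blast
  next
    case True
    then obtain a b e where ba: "a \<in> A" "b \<in> S - A" "(e, True) \<in> half_edges b" "(e, False) \<in> half_edges a"
      unfolding arrow_half by blast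
    then have e: "e \<in> edge_cut S A" using cutI[of a A b S e False] by simp
    show ?thesis
    proof (rule collapsible_if_upper[OF ran fin])
      fix a' b' assume ab: "a' \<in> A" "b' \<in> S - A"
      show "(a', b') \<notin> arrows S"
      proof
        assume "(a', b') \<in> arrows S"
        then obtain e' where e': "(e', True) \<in> half_edges a'" "(e', False) \<in> half_edges b'" unfolding arrow_half by blast
        then have "e' \<in> edge_cut S A" using ab cutI[of a' A b' S e' True] by simp
        then have "e' = e" using uniq e by blast
        then have "a' = b" using half_unique[OF sep, of a' b] e' ba ab A(1) by blast
        then show False using ab ba by blast
      qed
    qed
  qed
qed

section \<open>A smallest counterexample is a cycle\<close>

lemma inner_ribbon_pair:
  assumes "mixed3 (e, d) x y" "mixed3 (e, \<not> d) z w" "distinct [e, fst x, fst y, fst z, fst w]"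
  shows "inner {ribbon \<sigma> (e, d) x y, ribbon \<sigma> (e, \<not> d) z w} = {e}"
proof -
  have "(f \<in> inner {ribbon \<sigma> (e, d) x y, ribbon \<sigma> (e, \<not> d) z w}) = (f = e)" for f
    unfolding inner_half_iff bex_simps insert_iff
    using assms by (cases x; cases y; cases z; cases w) (auto simp: half_ribbon)
  then show ?thesis by blast
qed

lemma mixed_swap: "mixed p r q \<longleftrightarrow> mixed p q r"
  by (auto simp: mixed_def)

context bib_properad begin

text \<open>
  For the reversed orientation the same flip is used with the legs read backwards.
\<close>

lemma flip_ribbon:
  assumes "distinct [e, fst x, fst y, fst z, fst w]"
    and "mixed3 (e, d) x y" "mixed3 (e, \<not> d) z w" "mixed3 (e, d') y z" "mixed3 (e, \<not> d') w x"
  shows "similar {ribbon \<sigma> (e, d) x y, ribbon \<sigma> (e, \<not> d) z w} {ribbon \<sigma> (e, d') y z, ribbon \<sigma> (e, \<not> d') w x}"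
proof (cases \<sigma>)
  case True
  have "similar {cyclic (e, d) (fst x, snd x) (fst y, snd y), cyclic (e, \<not> d) (fst z, snd z) (fst w, snd w)}
     {cyclic (e, d') (fst y, snd y) (fst z, snd z), cyclic (e, \<not> d') (fst w, snd w) (fst x, snd x)}"
    by (rule flip) (use assms in \<open>simp_all add: mixed3_def\<close>)
  then show ?thesis using True by (simp add: ribbon_def)
next
  case False
  have dist: "distinct [e, fst y, fst x, fst w, fst z]" using assms(1) by auto
  have mx: "mixed d (snd y) (snd x)" "mixed (\<not> d) (snd w) (snd z)"
    "mixed (\<not> d') (snd x) (snd w)" "mixed (\<not> \<not> d') (snd z) (snd y)"
    using assms(2-5) mixed_swap by (simp_all add: mixed3_def)
  have "similar {cyclic (e, d) (fst y, snd y) (fst x, snd x), cyclic (e, \<not> d) (fst w, snd w) (fst z, snd z)}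
     {cyclic (e, \<not> d') (fst x, snd x) (fst w, snd w), cyclic (e, \<not> \<not> d') (fst z, snd z) (fst y, snd y)}"
    by (rule flip) (use dist mx in simp_all)
  then show ?thesis using False by (simp add: ribbon_def insert_commute[of "cyclic (e, d') z y"])
qed

text \<open>
  By the formula for the genus, \<open>card S \<le> card (inner S)\<close> says that the genus
  of a connected graph is positive.
\<close>

definition counterexample :: "vertex set \<Rightarrow> bool" where
  "counterexample S \<longleftrightarrow> good S \<and> (\<forall>v\<in>S. trivalent v) \<and> card S \<le> card (inner S) \<and> \<not> vanishes S"

end

locale smallest_counterexample = bib_properad P m \<Delta>
  for P :: "('k::field_char_0, 'a::ab_group_add) properad" and m \<Delta> +
  fixes n :: nat
  assumes minimal: "counterexample S \<Longrightarrow> n \<le> card S"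
begin

text \<open>
  Counterexamples of least possible size; flips lead from one to another.
\<close>

definition critical :: "vertex set \<Rightarrow> bool" where
  "critical S \<longleftrightarrow> counterexample S \<and> card S = n"

lemma criticalD:
  assumes "critical S"
  shows "good S" "separated S" "connected_set S" "ranked S" "finite S" "S \<noteq> {}"
    "v \<in> S \<Longrightarrow> trivalent v" "card S \<le> card (inner S)" "\<not> vanishes S" "card S = n" "finite (inner S)"
  using assms finite_labels(3)[of S]
  by (auto simp: critical_def counterexample_def good_def separated_def connected_set_def)

lemma critical_subset:
  assumes "critical S" "A \<subseteq> S" "A \<noteq> S" "connected_set A" "collapsible S A"
  shows "card (inner A) < card A"
proof (rule ccontr)
  assume c: "\<not> card (inner A) < card A"
  have "card A < n"
    using criticalD(5,10)[OF assms(1)] assms(2,3) by (metis psubsetI psubset_card_mono)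
  moreover have "good A"
    using criticalD(2,4)[OF assms(1)] assms separated_subset ranked_subset by (auto simp: good_def)
  ultimately have "vanishes A"
    using minimal[of A] c criticalD(7)[OF assms(1)] assms(2) unfolding counterexample_def by force
  then show False
    using vanishes_supergraph[of S A] criticalD(1,7,9)[OF assms(1)] assms by blast
qed

text \<open>
  If a cut has at most one edge, then one of its two sides has positive genus as well, and it
  can be contracted.
\<close>

lemma critical_edge_cut:
  assumes "critical S" "A \<subseteq> S" "A \<noteq> {}" "A \<noteq> S"
  shows "card (edge_cut S A) \<ge> 2"
proof (rule ccontr)
  assume "\<not> card (edge_cut S A) \<ge> 2"
  then have one: "card (edge_cut S A) \<le> 1" "card (edge_cut S (S - A)) \<le> 1"
    using cut_compl[OF assms(2)] by auto
  have "card (inner A) < card A"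
    using critical_subset[OF assms(1,2,4)] bridge_side[OF criticalD(1)[OF assms(1)] assms(2,3) one(1)] by blast
  moreover have "card (inner (S - A)) < card (S - A)"
    using critical_subset[OF assms(1), of "S - A"] bridge_side[OF criticalD(1)[OF assms(1)], of "S - A"] one(2) assms
    by blast
  moreover have "card (inner S) \<le> card (inner A) + card (inner (S - A)) + 1"
    using card_inner_cut[OF criticalD(2)[OF assms(1)] assms(2)] one(1) by linarith
  moreover have "card S = card A + card (S - A)"
    using criticalD(5)[OF assms(1)] assms(2) by (metis card_Diff_subset card_mono finite_subset le_add_diff_inverse)
  ultimately show False using criticalD(8)[OF assms(1)] by linarith
qed

lemma critical_two_inner_labels:
  assumes "critical S" "v \<in> S"
  shows "2 \<le> card (labels v \<inter> inner S)"
proof -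
  have nl: "set (fst v) \<inter> set (snd v) = {}" using good_no_loop criticalD(1) assms by blast
  have "{v} \<noteq> S"
  proof
    assume "{v} = S"
    then have "inner S = {}" using nl by (auto simp: inner_def out_labels_def in_labels_def)
    then have "card S \<le> 0" using criticalD(8)[OF assms(1)] by simp
    then show False using \<open>{v} = S\<close> by auto
  qed
  then have "2 \<le> card (edge_cut S {v})" using critical_edge_cut[OF assms(1)] assms(2) by blast
  also have "edge_cut S {v} \<subseteq> labels v \<inter> inner S"
    using inner_cut[of "{v}" S] assms(2) cut_label[of _ S "{v}"] by auto
  then have "card (edge_cut S {v}) \<le> card (labels v \<inter> inner S)"
    by (rule card_mono[rotated]) (use criticalD(11)[OF assms(1)] in auto)
  finally show ?thesis .
qed

lemma card_labels:
  assumes "critical S" "v \<in> S"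
  shows "card (labels v) = 3" "finite (labels v)"
proof -
  have nl: "set (fst v) \<inter> set (snd v) = {}" using good_no_loop criticalD(1) assms by blast
  have "card (labels v) = length (fst v) + length (snd v)"
    unfolding labels_def card_Un_disjoint[OF finite_set finite_set nl]
    using criticalD(2)[OF assms(1)] assms(2) by (simp add: separated_def distinct_card)
  then show "card (labels v) = 3" using criticalD(7)[OF assms] by (auto simp: trivalent_def)
  show "finite (labels v)" by (simp add: labels_def)
qed

text \<open>
  Remove a sink. By the previous lemmas it has exactly two inner edges, and the rest is
  connected: each part of it would be joined to the sink by at least two edges. Since the rest
  is smaller and can be contracted, it has genus zero.
\<close>

lemma critical_edge_bound:
  assumes S: "critical S" shows "card (inner S) \<le> card S"
proof -
  note D = criticalD[OF S]
  obtain v where v: "v \<in> S" "\<And>w. (v, w) \<notin> arrows S" using sink_exists[OF D(4,5,6)] by blast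
  have ext: "set (fst v) \<inter> inner S = {}"
    using v by (auto simp: inner_def in_labels_def arrows_def)
  have lab: "labels v \<inter> inner S \<subseteq> set (snd v)" using ext by (auto simp: labels_def)
  have two: "card (labels v \<inter> inner S) \<le> 2"
  proof -
    have "card (labels v \<inter> inner S) \<le> card (set (snd v))" using lab by (intro card_mono) auto
    also have "\<dots> \<le> length (snd v)" by (rule card_length)
    also have "\<dots> \<le> 2" using D(7)[OF v(1)] by (auto simp: trivalent_def)
    finally show ?thesis .
  qed
  let ?A = "S - {v}"
  have ne: "{v} \<noteq> S"
  proof
    assume e: "{v} = S"
    then have "inner S \<subseteq> labels v" by (auto simp: inner_def labels_def out_labels_def)
    then have "inner S = {}" using ext e by (auto simp: inner_def out_labels_def)
    then show False using D(6,8,5) by auto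
  qed
  have col: "collapsible S ?A"
    by (rule collapsible_if_lower[OF D(4)]) (use v in auto)
  have con: "connected_set ?A"
    unfolding connected_set_crossing
  proof (intro conjI allI impI)
    show "?A \<noteq> {}" using ne v by auto
    fix B assume B: "B \<subseteq> ?A \<and> B \<noteq> {} \<and> B \<noteq> ?A"
    show "crossing ?A B"
    proof (rule ccontr)
      assume nc: "\<not> crossing ?A B"
      let ?C = "?A - B"
      \<comment> \<open>without arrows between the two parts, every edge leaving one of them ends at the sink\<close>
      have at_v: "e \<in> labels v \<and> e \<in> inner S \<and> (\<exists>c\<in>C. e \<in> labels c)"
        if C: "C \<subseteq> ?A" "\<not> crossing ?A C" "e \<in> edge_cut S C" for e C
      proof -
        obtain a b d where ab: "a \<in> C" "b \<in> S - C" "(e, d) \<in> half_edges a" "(e, \<not> d) \<in> half_edges b"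
          using C(3) unfolding edge_cut_def by blast
        have "b = v"
        proof (rule ccontr)
          assume "b \<noteq> v"
          then have "b \<in> ?A" "b \<notin> C" "a \<in> ?A" using ab C(1) by auto
          moreover from this have "(a, b) \<in> arrows ?A \<or> (b, a) \<in> arrows ?A"
            using ab(3,4) unfolding arrow_half by (cases d) auto
          ultimately show False using C(2) ab(1) crossingI_arrow by blast
        qed
        moreover have "e \<in> inner S" using innerI[OF _ _ ab(3,4)] ab C(1) by blast
        ultimately show ?thesis using ab unfolding labels_half by blast
      qed
      have ncC: "\<not> crossing ?A ?C" using nc crossing_compl[of B ?A] B by blast
      have "B \<subseteq> S" "B \<noteq> {}" "B \<noteq> S" using B v(1) by auto
      then have "2 \<le> card (edge_cut S B)" by (rule critical_edge_cut[OF S])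
      moreover have "?C \<subseteq> S" "?C \<noteq> {}" "?C \<noteq> S" using B v(1) by auto
      then have "2 \<le> card (edge_cut S ?C)" by (rule critical_edge_cut[OF S])
      moreover have "edge_cut S B \<inter> edge_cut S ?C = {}"
      proof -
        have False if e: "e \<in> edge_cut S B" "e \<in> edge_cut S ?C" for e
        proof -
          obtain b where b: "b \<in> B" "e \<in> labels b" using cut_label[OF e(1)] by blast
          obtain c where c: "c \<in> ?C" "e \<in> labels c" using cut_label[OF e(2)] by blast
          note bc = b c
          have "B \<subseteq> ?A" using B by blast
          from at_v[OF this nc e(1)] have ev: "e \<in> labels v" by blast
          obtain d1 d2 d3 where d: "(e, d1) \<in> half_edges b" "(e, d2) \<in> half_edges c" "(e, d3) \<in> half_edges v"
            using bc ev unfolding labels_half by blast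
          have mem: "b \<in> S" "c \<in> S" "b \<noteq> v" "c \<noteq> v" "b \<noteq> c" using bc B by auto
          have "d1 \<noteq> d2" using half_unique[OF D(2) mem(1,2) d(1)] d(2) mem(5) by blast
          moreover have "d1 \<noteq> d3" using half_unique[OF D(2) mem(1) v(1) d(1)] d(3) mem(3) by blast
          moreover have "d2 \<noteq> d3" using half_unique[OF D(2) mem(2) v(1) d(2)] d(3) mem(4) by blast
          ultimately show False by blast
        qed
        then show ?thesis by blast
      qed
      moreover have sub: "edge_cut S B \<union> edge_cut S ?C \<subseteq> labels v \<inter> inner S"
      proof -
        have "B \<subseteq> ?A" "?C \<subseteq> ?A" using B by blast+
        then show ?thesis using at_v[OF _ nc] at_v[OF _ ncC] by blast
      qed
      moreover have "finite (labels v \<inter> inner S)" using D(11) by blast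
      ultimately have "card (edge_cut S B \<union> edge_cut S ?C) \<le> card (labels v \<inter> inner S)"
          "card (edge_cut S B \<union> edge_cut S ?C) = card (edge_cut S B) + card (edge_cut S ?C)"
          "2 \<le> card (edge_cut S B)" "2 \<le> card (edge_cut S ?C)"
        using card_mono[OF _ sub] card_Un_disjoint[of "edge_cut S B" "edge_cut S ?C"] finite_subset[OF sub]
        by auto
      then show False using two by linarith
    qed
  qed
  have "card (inner ?A) < card ?A" using critical_subset[OF S _ _ con col] v by blast
  moreover have "card (inner S) \<le> card (inner ?A) + 2"
  proof -
    have "inner S \<subseteq> inner ?A \<union> (labels v \<inter> inner S)"
      unfolding inner_def out_labels_def in_labels_def labels_def by blast
    then have "card (inner S) \<le> card (inner ?A \<union> (labels v \<inter> inner S))"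
      by (rule card_mono[rotated]) (use D(11) inner_mono[of ?A S] finite_subset in auto)
    then show ?thesis using card_Un_le[of "inner ?A" "labels v \<inter> inner S"] two by linarith
  qed
  moreover have "card S = card ?A + 1" using v D(5) by (metis Suc_eq_plus1 card_Suc_Diff1)
  ultimately show ?thesis by linarith
qed

lemma sum_inner_labels:
  assumes "good S"
  shows "(\<Sum>v\<in>S. card (labels v \<inter> inner S)) = 2 * card (inner S)"
proof -
  have sep: "separated S" and fin: "finite S" using assms by (auto simp: good_def separated_def)
  have split: "card (labels v \<inter> inner S) = card (set (fst v) \<inter> inner S) + card (set (snd v) \<inter> inner S)"
    if "v \<in> S" for v
  proof -
    have "labels v \<inter> inner S = (set (fst v) \<inter> inner S) \<union> (set (snd v) \<inter> inner S)"
      by (auto simp: labels_def)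
    then show ?thesis using good_no_loop[OF assms that] by (simp add: card_Un_disjoint Int_commute inf_left_commute inf_assoc disjoint_iff)
  qed
  have "(\<Sum>v\<in>S. card (set (fst v) \<inter> inner S)) = card (\<Union>v\<in>S. set (fst v) \<inter> inner S)"
    using fin label_unique(1)[OF sep] by (subst card_UN_disjoint) (auto simp: disjoint_iff)
  also have "(\<Union>v\<in>S. set (fst v) \<inter> inner S) = inner S" by (auto simp: inner_def out_labels_def)
  finally have 1: "(\<Sum>v\<in>S. card (set (fst v) \<inter> inner S)) = card (inner S)" .
  have "(\<Sum>v\<in>S. card (set (snd v) \<inter> inner S)) = card (\<Union>v\<in>S. set (snd v) \<inter> inner S)"
    using fin label_unique(2)[OF sep] by (subst card_UN_disjoint) (auto simp: disjoint_iff)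
  also have "(\<Union>v\<in>S. set (snd v) \<inter> inner S) = inner S" by (auto simp: inner_def in_labels_def)
  finally have 2: "(\<Sum>v\<in>S. card (set (snd v) \<inter> inner S)) = card (inner S)" .
  show ?thesis using split 1 2 by (simp add: sum.distrib)
qed

text \<open>
  There are exactly as many inner edges as vertices, so the average number of inner labels at a
  vertex is two, which is also the least possible number.
\<close>

lemma critical_exactly_two_inner:
  assumes "critical S" "v \<in> S"
  shows "card (labels v \<inter> inner S) = 2"
proof (rule ccontr)
  assume "card (labels v \<inter> inner S) \<noteq> 2"
  then have "2 < card (labels v \<inter> inner S)" using critical_two_inner_labels[OF assms] by simp
  then have "(\<Sum>v\<in>S. 2) < (\<Sum>v\<in>S. card (labels v \<inter> inner S))"
    using critical_two_inner_labels[OF assms(1)] criticalD(5)[OF assms(1)] assms(2)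
    by (intro sum_strict_mono_ex1) auto
  then show False
    using sum_inner_labels[OF criticalD(1)[OF assms(1)]] critical_edge_bound[OF assms(1)] by simp
qed

end

section \<open>Flips in a smallest counterexample\<close>

lemma ex_mixed:
  assumes "mixed3 (e, d) x y" "mixed3 (e, \<not> d) z w"
  obtains d' where "mixed3 (e, d') y z" "mixed3 (e, \<not> d') w x"
proof -
  have "(mixed3 (e, True) y z \<and> mixed3 (e, False) w x) \<or> (mixed3 (e, False) y z \<and> mixed3 (e, True) w x)"
    using assms by (auto simp: mixed3_def mixed_def)
  then show thesis using that[of True] that[of False] by auto
qed

lemma good_half_opposite: "\<lbrakk>good S; v \<in> S; (e, d) \<in> half_edges v; (e, d') \<in> half_edges v\<rbrakk> \<Longrightarrow> d = d'"
  using good_no_loop[of S v] by (cases d; cases d') auto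

text \<open>
  The detour that prevents the contraction of the edge \<open>e\<close> leaves \<open>u\<close>
  along another edge \<open>e1\<close> of the same direction and continues beyond the far end
  \<open>y\<close> of \<open>e1\<close> along an edge \<open>g\<close>. For \<open>d =
  False\<close> the detour is read backwards.
\<close>

lemma second_half_edge:
  assumes "good S" "u \<in> S" "v \<in> S" "(e, d) \<in> half_edges u" "(e, \<not> d) \<in> half_edges v" "\<not> collapsible S {u, v}"
  obtains e1 y g where "e1 \<noteq> e" "(e1, d) \<in> half_edges u" "y \<in> S" "(e1, \<not> d) \<in> half_edges y" "g \<in> inner S" "(g, d) \<in> half_edges y"
proof -
  note S = assms(1)
  have sep: "separated S" using S by (simp add: good_def)
  show thesis
  proof (cases d)
    case True
    have uv: "(u, v) \<in> arrows S" unfolding arrow_half using assms True by auto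
    obtain y where y: "y \<noteq> u" "y \<noteq> v" "(u, y) \<in> (arrows S)\<^sup>+" "(y, v) \<in> arrows S"
      using path_if_not_collapsible[OF S uv assms(6)] .
    obtain y0 where y0: "(u, y0) \<in> arrows S" "(y0, y) \<in> (arrows S)\<^sup>*" using tranclD[OF y(3)] by blast
    have "(y0, v) \<in> (arrows S)\<^sup>+" using y0(2) y(4) by (rule rtrancl_into_trancl1)
    then obtain y1 where y1: "(y0, y1) \<in> arrows S" using tranclD by metis
    obtain e1 where e1: "(e1, True) \<in> half_edges u" "(e1, False) \<in> half_edges y0" "y0 \<in> S"
      using y0(1) unfolding arrow_half by blast
    obtain g where g: "(g, True) \<in> half_edges y0" "(g, False) \<in> half_edges y1" "y1 \<in> S"
      using y1 unfolding arrow_half by blast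
    have "e1 \<noteq> e"
    proof
      assume "e1 = e"
      then have "y0 = v" using half_unique[OF sep e1(3) assms(3) e1(2)] assms(5) True by simp
      then show False using \<open>(y0, v) \<in> (arrows S)\<^sup>+\<close> good_acyclic[OF S] by blast
    qed
    then show thesis using that[of e1 y0 g] e1 g innerI[of y0 S y1 g True] True by simp
  next
    case False
    have vu: "(v, u) \<in> arrows S" unfolding arrow_half using assms False by auto
    have "\<not> collapsible S {v, u}" using assms(6) by (simp add: insert_commute)
    then obtain y where y: "y \<noteq> v" "y \<noteq> u" "(v, y) \<in> (arrows S)\<^sup>+" "(y, u) \<in> arrows S"
      using path_if_not_collapsible[OF S vu] by blast
    obtain y1 where y1: "(y1, y) \<in> arrows S" using tranclD2[OF y(3)] by blast
    obtain e1 where e1: "(e1, True) \<in> half_edges y" "(e1, False) \<in> half_edges u" "y \<in> S"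
      using y(4) unfolding arrow_half by blast
    obtain g where g: "(g, True) \<in> half_edges y1" "(g, False) \<in> half_edges y" "y1 \<in> S"
      using y1 unfolding arrow_half by blast
    have "e1 \<noteq> e"
      using half_unique[OF sep e1(3) assms(3) e1(1)] assms(5) False y(1) by auto
    then show thesis using that[of e1 y g] e1 g innerI[of y1 S y g True] False by simp
  qed
qed

context smallest_counterexample
begin

lemma critical_unique: "\<lbrakk>critical S; u \<in> S; v \<in> S; h \<in> half_edges u; h \<in> half_edges v\<rbrakk> \<Longrightarrow> u = v"
  using half_unique[OF criticalD(2)] .

lemma critical_opposite: "\<lbrakk>critical S; v \<in> S; (e, d) \<in> half_edges v; (e, d') \<in> half_edges v\<rbrakk> \<Longrightarrow> d = d'"
  using good_half_opposite[OF criticalD(1)] .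

lemma critical_third:
  assumes S: "critical S" "v \<in> S" and l: "x \<in> labels v" "y \<in> labels v" "z \<in> labels v" "distinct [x, y, z]"
  shows "x \<in> inner S \<Longrightarrow> y \<in> inner S \<Longrightarrow> z \<notin> inner S"
    and "x \<notin> inner S \<Longrightarrow> y \<in> inner S"
proof -
  have fin: "finite (labels v)" using card_labels(2)[OF S] .
  have "labels v = {x, y, z}"
    using l card_labels[OF S] by (intro card_subset_eq[symmetric]) auto
  then show "x \<in> inner S \<Longrightarrow> y \<in> inner S \<Longrightarrow> z \<notin> inner S" "x \<notin> inner S \<Longrightarrow> y \<in> inner S"
    using critical_exactly_two_inner[OF S] l(4) by (auto simp: Int_insert_left split: if_splits)
qed

lemma critical_inner_two:
  assumes S: "critical S" "v \<in> S" and "(x, d1) \<in> half_edges v" "(y, d2) \<in> half_edges v" "(z, d3) \<in> half_edges v"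
    and "x \<noteq> y" "x \<in> inner S" "y \<in> inner S" "z \<in> inner S"
  shows "z = x \<or> z = y"
  using critical_third(1)[OF S, of x y z] assms(3-9) by (auto simp: labels_half)

lemma critical_ribbon:
  assumes S: "critical S" "v \<in> S" and h: "h \<in> half_edges v"
  obtains a b where "v = ribbon \<sigma> h a b" "mixed3 h a b"
proof -
  have "distinct (fst v)" "distinct (snd v)"
    using criticalD(2)[OF S(1)] S(2) by (auto simp: separated_def)
  then show thesis
    using ribbon_exists[OF criticalD(7)[OF S] _ _ good_no_loop[OF criticalD(1)[OF S(1)] S(2)] h] that by metis
qed

lemma ribbon_facts:
  assumes S: "critical S" "ribbon \<sigma> a b c \<in> S" and mx: "mixed3 a b c"
  shows "labels (ribbon \<sigma> a b c) = {fst a, fst b, fst c}" "distinct [fst a, fst b, fst c]"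
    "half_edges (ribbon \<sigma> a b c) = {a, b, c}"
    "fst b \<notin> inner S \<Longrightarrow> fst c \<in> inner S" "fst c \<notin> inner S \<Longrightarrow> fst b \<in> inner S"
    "fst a \<in> inner S \<Longrightarrow> fst b \<in> inner S \<Longrightarrow> fst c \<notin> inner S"
    "fst a \<in> inner S \<Longrightarrow> fst c \<in> inner S \<Longrightarrow> fst b \<notin> inner S"
proof -
  show h: "half_edges (ribbon \<sigma> a b c) = {a, b, c}" using half_ribbon[OF mx] .
  show l: "labels (ribbon \<sigma> a b c) = {fst a, fst b, fst c}"
  proof (rule set_eqI)
    fix e
    have "e \<in> labels (ribbon \<sigma> a b c) \<longleftrightarrow> (\<exists>d. (e, d) \<in> {a, b, c})" unfolding labels_half h ..
    also have "\<dots> \<longleftrightarrow> e \<in> {fst a, fst b, fst c}" by (cases a; cases b; cases c) auto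
    finally show "e \<in> labels (ribbon \<sigma> a b c) \<longleftrightarrow> e \<in> {fst a, fst b, fst c}" .
  qed
  have "card (set [fst a, fst b, fst c]) = length [fst a, fst b, fst c]"
    using card_labels(1)[OF S] l by simp
  then show d: "distinct [fst a, fst b, fst c]" by (rule card_distinct)
  have p: "distinct [fst b, fst c, fst a]" "distinct [fst c, fst b, fst a]" "distinct [fst a, fst c, fst b]"
    using d by auto
  have mem: "fst a \<in> labels (ribbon \<sigma> a b c)" "fst b \<in> labels (ribbon \<sigma> a b c)" "fst c \<in> labels (ribbon \<sigma> a b c)"
    using l by auto
  show "fst b \<notin> inner S \<Longrightarrow> fst c \<in> inner S" by (rule critical_third(2)[OF S mem(2,3,1) p(1)])
  show "fst c \<notin> inner S \<Longrightarrow> fst b \<in> inner S" by (rule critical_third(2)[OF S mem(3,2,1) p(2)])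
  show "fst a \<in> inner S \<Longrightarrow> fst b \<in> inner S \<Longrightarrow> fst c \<notin> inner S"
    by (rule critical_third(1)[OF S mem d])
  show "fst a \<in> inner S \<Longrightarrow> fst c \<in> inner S \<Longrightarrow> fst b \<notin> inner S"
    by (rule critical_third(1)[OF S mem(1,3,2) p(3)])
qed

text \<open>
  The two vertices form one of the two graphs that vanish by the relations, and they can be
  contracted since the coproduct has no further output from which a detour could start.
\<close>

lemma no_double_arrow:
  assumes S: "critical S" "u \<in> S" "v \<in> S"
    and e: "e \<in> set (fst u)" "e \<in> set (snd v)" "e' \<in> set (fst u)" "e' \<in> set (snd v)" "e \<noteq> e'"
  shows False
proof -
  note D = criticalD[OF S(1)]
  have nl: "set (fst u) \<inter> set (snd u) = {}" "set (fst v) \<inter> set (snd v) = {}"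
    using good_no_loop[OF D(1)] S by auto
  have uv: "(u, v) \<in> arrows S" using arrowsI S e by blast
  obtain z where u: "u = cop z e e' \<or> u = cop z e' e"
    using D(7)[OF S(2)] e(1,3,5) by (auto simp: trivalent_def)
  obtain w where v: "v = mul e e' w \<or> v = mul e' e w"
    using D(7)[OF S(3)] e(2,4,5) by (auto simp: trivalent_def)
  have "w \<noteq> z"
  proof
    assume "w = z"
    then have "(v, u) \<in> arrows S" using u v S by (intro arrowsI[of _ _ _ z]) auto
    then show False using uv good_acyclic[OF D(1), of u] by (meson trancl.simps)
  qed
  then have d: "distinct [z, e, e', w]" "distinct [z, e', e, w]" using nl u v e(5) by auto
  have van: "vanishes {u, v}"
    using u v vanishes_double_edge[OF d(1)] vanishes_double_edge[OF d(2)] by (auto simp: insert_commute)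
  have "good {u, v}"
    by (rule pair_good) (use u v d in auto)
  then have con: "connected_set {u, v}" by (simp add: good_def)
  have "collapsible S {u, v}"
  proof (rule ccontr)
    assume "\<not> collapsible S {u, v}"
    then obtain y where y: "y \<noteq> u" "y \<noteq> v" "(u, y) \<in> (arrows S)\<^sup>+" "(y, v) \<in> arrows S"
      using path_if_not_collapsible[OF D(1) uv] by blast
    obtain y0 where y0: "(u, y0) \<in> arrows S" "(y0, y) \<in> (arrows S)\<^sup>*" using tranclD[OF y(3)] by blast
    then obtain f where f: "f \<in> set (fst u)" "f \<in> set (snd y0)" "y0 \<in> S" by (auto elim: arrowsE)
    then have "f \<in> set (snd v)" using u v by auto
    then have "y0 = v" using label_unique(2)[OF D(2) f(3) S(3) f(2)] by blast
    then have "(v, v) \<in> (arrows S)\<^sup>+" using y0(2) y(4) by (metis rtrancl_into_trancl1)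
    then show False using good_acyclic[OF D(1)] by blast
  qed
  then show False using vanishes_supergraph[of S "{u, v}"] D(1,7,9) con van S by blast
qed

lemma shared_label_unique:
  assumes S: "critical S" "u \<in> S" "v \<in> S" "u \<noteq> v"
    and e: "e \<in> labels u" "e \<in> labels v" "e' \<in> labels u" "e' \<in> labels v"
  shows "e = e'"
proof (rule ccontr)
  assume ne: "e \<noteq> e'"
  have ends: "(f \<in> set (fst u) \<and> f \<in> set (snd v)) \<or> (f \<in> set (fst v) \<and> f \<in> set (snd u))"
    if "f \<in> labels u" "f \<in> labels v" for f
    using that label_unique[OF criticalD(2)[OF S(1)] S(2,3), of f] S(4) unfolding labels_def by blast
  have cyc: False if "a \<in> set (fst u)" "a \<in> set (snd v)" "b \<in> set (fst v)" "b \<in> set (snd u)" for a b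
  proof -
    have "(u, v) \<in> arrows S" "(v, u) \<in> arrows S" using that S arrowsI by blast+
    then show False using good_acyclic[OF criticalD(1)[OF S(1)], of u] by (meson trancl.simps)
  qed
  show False
    using ends[OF e(1,2)] ends[OF e(3,4)] cyc no_double_arrow[OF S(1-3) _ _ _ _ ne]
      no_double_arrow[OF S(1,3,2) _ _ _ _ ne] by blast
qed

text \<open>
  The old name \<open>e\<close> is given to the new edge, so that the set of inner edges does
  not change.
\<close>

lemma critical_flip:
  assumes S: "critical S" and u: "ribbon \<sigma> (e, d) x y \<in> S" "mixed3 (e, d) x y"
    and v: "ribbon \<sigma> (e, \<not> d) z w \<in> S" "mixed3 (e, \<not> d) z w"
    and col: "collapsible S {ribbon \<sigma> (e, d) x y, ribbon \<sigma> (e, \<not> d) z w}"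
    and new: "mixed3 (e, d') y z" "mixed3 (e, \<not> d') w x"
  defines "S' \<equiv> S - {ribbon \<sigma> (e, d) x y, ribbon \<sigma> (e, \<not> d) z w} \<union> {ribbon \<sigma> (e, d') y z, ribbon \<sigma> (e, \<not> d') w x}"
  shows "critical S'" "inner S' = inner S" "distinct [e, fst x, fst y, fst z, fst w]" "e \<in> inner S"
proof -
  let ?u = "ribbon \<sigma> (e, d) x y" and ?v = "ribbon \<sigma> (e, \<not> d) z w"
  note D = criticalD[OF S]
  note fu = ribbon_facts[OF S u] and fv = ribbon_facts[OF S v]
  have "?u \<noteq> ?v"
  proof
    assume "?u = ?v"
    then have "(e, d) \<in> half_edges ?u" "(e, \<not> d) \<in> half_edges ?u" using fu(3) fv(3) by auto
    then show False using critical_opposite[OF S u(1), of e d "\<not> d"] by blast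
  qed
  then have "a = e" if "a \<in> {fst x, fst y}" "a \<in> {fst z, fst w}" for a
    using shared_label_unique[OF S u(1) v(1), of a e] fu(1) fv(1) that by auto
  then show dist: "distinct [e, fst x, fst y, fst z, fst w]" using fu(2) fv(2) by auto
  show e: "e \<in> inner S" using innerI[OF u(1) v(1)] fu(3) fv(3) by auto
  have dist': "distinct [e, fst y, fst z, fst w, fst x]" using dist by auto
  have sim: "similar {?u, ?v} {ribbon \<sigma> (e, d') y z, ribbon \<sigma> (e, \<not> d') w x}"
    by (rule flip_ribbon) (use dist u v new in auto)
  have in1: "inner {?u, ?v} = {e}" by (rule inner_ribbon_pair) (use u v dist in auto)
  have in2: "inner {ribbon \<sigma> (e, d') y z, ribbon \<sigma> (e, \<not> d') w x} = {e}"
    by (rule inner_ribbon_pair) (use new dist' in auto)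
  have sub: "{?u, ?v} \<subseteq> S" using u v by auto
  have tr: "\<forall>v\<in>S. trivalent v" using D(7) by blast
  note r = replacement[OF D(1) tr sub col sim, unfolded in1 in2, folded S'_def]
  have "e \<in> inner S'" using inner_mono[of "{ribbon \<sigma> (e, d') y z, ribbon \<sigma> (e, \<not> d') w x}" S'] in2
    by (auto simp: S'_def)
  then show inS: "inner S' = inner S" using r(4) e by auto
  have "ribbon \<sigma> (e, d') y z \<noteq> ribbon \<sigma> (e, \<not> d') w x"
  proof
    assume "ribbon \<sigma> (e, d') y z = ribbon \<sigma> (e, \<not> d') w x"
    then have "(e, \<not> d') \<in> {(e, d'), y, z}"
      using half_ribbon[OF new(1), of \<sigma>] half_ribbon[OF new(2), of \<sigma>] by (metis insertI1)
    then show False using dist by auto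
  qed
  then have "card S' = card S" using r(3) \<open>?u \<noteq> ?v\<close> by simp
  moreover have "\<forall>v\<in>S'. trivalent v"
    using tr trivalent_ribbon[OF new(1)] trivalent_ribbon[OF new(2)] by (auto simp: S'_def)
  ultimately show "critical S'"
    using r(1,2) D(8,9,10) inS by (auto simp: critical_def counterexample_def)
qed

text \<open>
  A vertex \<open>u\<close> that is passed by a directed path within the cycle is neither a
  source nor a sink, but a detour around \<open>e\<close> would require one of these.
\<close>

lemma collapsible_through:
  assumes S: "critical S" "u \<in> S" "v \<in> S" and e: "(e, d) \<in> half_edges u" "(e, \<not> d) \<in> half_edges v"
    and x: "(x, \<not> d) \<in> half_edges u" "x \<in> inner S"
  shows "collapsible S {u, v}"
proof (rule ccontr)
  assume "\<not> collapsible S {u, v}"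
  then obtain e1 y where e1: "e1 \<noteq> e" "(e1, d) \<in> half_edges u" "y \<in> S" "(e1, \<not> d) \<in> half_edges y"
    using second_half_edge[OF criticalD(1)[OF S(1)] S(2,3) e] by metis
  have "e \<in> inner S" "e1 \<in> inner S" using innerI e e1 S by blast+
  then have "x = e \<or> x = e1" using critical_inner_two[OF S(1,2) e(1) e1(2) x(1)] e1(1) x(2) by blast
  then show False using critical_opposite[OF S(1,2) x(1)] e(1) e1(2) by blast
qed

text \<open>
  The legs \<open>t\<close> and \<open>t'\<close> are adjacent in the cyclic order of the four
  legs, so the flip puts them on one vertex. This vertex has at most one inner edge.
\<close>

lemma same_side_contradiction:
  assumes S: "critical S" and u: "ribbon \<sigma> (e, d) h t \<in> S" "mixed3 (e, d) h t"
    and v: "ribbon \<sigma> (e, \<not> d) t' h' \<in> S" "mixed3 (e, \<not> d) t' h'"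
    and col: "collapsible S {ribbon \<sigma> (e, d) h t, ribbon \<sigma> (e, \<not> d) t' h'}"
    and ext: "fst t \<notin> inner S" "fst t' \<notin> inner S"
  shows False
proof -
  obtain d' where new: "mixed3 (e, d') t t'" "mixed3 (e, \<not> d') h' h" using ex_mixed[OF u(2) v(2)] .
  note S' = critical_flip[OF S u v col new]
  have "ribbon \<sigma> (e, d') t t' \<in> S - {ribbon \<sigma> (e, d) h t, ribbon \<sigma> (e, \<not> d) t' h'}
      \<union> {ribbon \<sigma> (e, d') t t', ribbon \<sigma> (e, \<not> d') h' h}" by blast
  from ribbon_facts(4)[OF S'(1) this new(1)] show False using ext unfolding S'(2) by blast
qed

end

section \<open>There is no counterexample\<close>

context smallest_counterexample
begin

abbreviation opposite :: "half_edge \<Rightarrow> half_edge" where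
  "opposite h \<equiv> (fst h, \<not> snd h)"

text \<open>
  Assume that all neighbouring edges can be contracted. Then the legs alternate between the two
  sides along \<open>e\<close> and its neighbours. After the flip of \<open>e\<close> the two
  neighbouring edges have both legs on one side. A directed detour around one of them runs
  through the other end of \<open>e\<close>, so the other neighbour can still be contracted.
\<close>

lemma not_collapsible_neighbour:
  assumes S: "critical S" "u \<in> S" "v \<in> S" and e: "(e, d) \<in> half_edges u" "(e, \<not> d) \<in> half_edges v"
    and col: "collapsible S {u, v}"
  obtains w g d1 p where "w \<in> {u, v}" "g \<noteq> e" "(g, d1) \<in> half_edges w" "p \<in> S" "(g, \<not> d1) \<in> half_edges p"
    "\<not> collapsible S {w, p}"
proof (rule ccontr)
  note found = that
  assume "\<not> thesis"
  then have nb: "collapsible S {w, p}"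
    if "w \<in> {u, v}" "g \<noteq> e" "(g, d1) \<in> half_edges w" "p \<in> S" "(g, \<not> d1) \<in> half_edges p" for w g d1 p
    using found[OF that] by blast
  have e_in: "e \<in> inner S" using innerI[OF S(2,3) e] .
  \<comment> \<open>the orientation is chosen such that the leg at \<open>u\<close> comes right after \<open>e\<close>\<close>
  obtain \<sigma> x y where u: "u = ribbon \<sigma> (e, d) x y" "mixed3 (e, d) x y" "fst x \<notin> inner S"
  proof -
    obtain x y where xy: "u = ribbon True (e, d) x y" "mixed3 (e, d) x y" using critical_ribbon[OF S(1,2) e(1)] .
    show thesis
    proof (cases "fst x \<in> inner S")
      case False
      then show thesis using that xy by blast
    next
      case True
      then have "fst y \<notin> inner S"
        using ribbon_facts(6)[OF S(1) _ xy(2), of True] S(2) xy(1) e_in by simp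
      moreover have "u = ribbon False (e, d) y x" "mixed3 (e, d) y x"
        using xy mixed_swap by (auto simp: ribbon_def mixed3_def)
      ultimately show thesis using that by blast
    qed
  qed
  have u_in: "ribbon \<sigma> (e, d) x y \<in> S" using S(2) u(1) by simp
  note fu = ribbon_facts[OF S(1) u_in u(2)]
  have y_in: "fst y \<in> inner S" using fu(4) u(3) by blast
  obtain z w where v: "v = ribbon \<sigma> (e, \<not> d) z w" "mixed3 (e, \<not> d) z w" using critical_ribbon[OF S(1,3) e(2)] .
  have v_in: "ribbon \<sigma> (e, \<not> d) z w \<in> S" using S(3) v(1) by simp
  note fv = ribbon_facts[OF S(1) v_in v(2)]
  have col': "collapsible S {ribbon \<sigma> (e, d) x y, ribbon \<sigma> (e, \<not> d) z w}" using col u v by simp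
  have w_in: "fst w \<in> inner S"
  proof (rule ccontr)
    assume "fst w \<notin> inner S"
    then show False
      using same_side_contradiction[OF S(1) v_in v(2), of x y] u_in u(2,3) col' by (simp add: insert_commute)
  qed
  then have z_ext: "fst z \<notin> inner S" using fv(7) e_in by simp
  obtain d' where new: "mixed3 (e, d') y z" "mixed3 (e, \<not> d') w x" using ex_mixed[OF u(2) v(2)] .
  define S' where "S' = S - {ribbon \<sigma> (e, d) x y, ribbon \<sigma> (e, \<not> d) z w}
      \<union> {ribbon \<sigma> (e, d') y z, ribbon \<sigma> (e, \<not> d') w x}"
  note flip = critical_flip[OF S(1) u_in u(2) v_in v(2) col' new, folded S'_def]
  have y_ne: "fst y \<noteq> e" and w_ne: "fst w \<noteq> e" using flip(3) by auto
  obtain p where p: "p \<in> S" "opposite y \<in> half_edges p" using inner_end[OF y_in] by blast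
  obtain \<alpha> \<beta> where p_rib: "p = ribbon \<sigma> (opposite y) \<alpha> \<beta>" "mixed3 (opposite y) \<alpha> \<beta>"
    using critical_ribbon[OF S(1) p] .
  have p_in: "ribbon \<sigma> (opposite y) \<alpha> \<beta> \<in> S" using p(1) p_rib(1) by simp
  have y_half: "(fst y, snd y) \<in> half_edges u" using fu(3) u(1) by simp
  have \<beta>_ext: "fst \<beta> \<notin> inner S"
  proof (rule ccontr)
    assume "\<not> fst \<beta> \<notin> inner S"
    then have \<alpha>_ext: "fst \<alpha> \<notin> inner S" using ribbon_facts(7)[OF S(1) p_in p_rib(2)] y_in by auto
    have "collapsible S {u, p}" using nb[of u "fst y" "snd y" p] y_ne y_half p by simp
    moreover have "u = ribbon \<sigma> (fst y, snd y) (e, d) x" "mixed3 (fst y, snd y) (e, d) x"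
      using u ribbon_rotate[of \<sigma> "(fst y, snd y)" "(e, d)" x] mixed3_rotate[of "(fst y, snd y)" "(e, d)" x] by auto
    ultimately show False
      using same_side_contradiction[OF S(1), of \<sigma> "fst y" "snd y" "(e, d)" x \<alpha> \<beta>] p_rib p(1) S(2) u(3) \<alpha>_ext
      by metis
  qed
  obtain q where q: "q \<in> S" "opposite w \<in> half_edges q" using inner_end[OF w_in] by blast
  obtain \<gamma> \<delta> where q_rib: "q = ribbon \<sigma> (opposite w) \<gamma> \<delta>" "mixed3 (opposite w) \<gamma> \<delta>"
    using critical_ribbon[OF S(1) q] .
  have q_in: "ribbon \<sigma> (opposite w) \<gamma> \<delta> \<in> S" using q(1) q_rib(1) by simp
  have w_half: "(fst w, snd w) \<in> half_edges v" using fv(3) v(1) by simp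
  have \<delta>_ext: "fst \<delta> \<notin> inner S"
  proof (rule ccontr)
    assume "\<not> fst \<delta> \<notin> inner S"
    then have \<gamma>_ext: "fst \<gamma> \<notin> inner S" using ribbon_facts(7)[OF S(1) q_in q_rib(2)] w_in by auto
    have "collapsible S {v, q}" using nb[of v "fst w" "snd w" q] w_ne w_half q by simp
    moreover have "v = ribbon \<sigma> (fst w, snd w) (e, \<not> d) z" "mixed3 (fst w, snd w) (e, \<not> d) z"
      using v ribbon_rotate[of \<sigma> "(fst w, snd w)" "(e, \<not> d)" z] mixed3_rotate[of "(fst w, snd w)" "(e, \<not> d)" z] by auto
    ultimately show False
      using same_side_contradiction[OF S(1), of \<sigma> "fst w" "snd w" "(e, \<not> d)" z \<gamma> \<delta>] q_rib q(1) S(3) z_ext \<gamma>_ext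
      by metis
  qed
  \<comment> \<open>the neighbours of \<open>u\<close> and \<open>v\<close> are untouched by the flip\<close>
  have far: "r \<in> S'" if "r \<in> S" "opposite h \<in> half_edges r" "h \<in> {y, w}" for r h
  proof -
    have "opposite h \<notin> half_edges u" "opposite h \<notin> half_edges v"
      using that(3) flip(3) fu(3) fv(3) u(1) v(1) by (cases h; auto)+
    then have "r \<noteq> u" "r \<noteq> v" using that(2) by auto
    then show ?thesis using that(1) u(1) v(1) by (auto simp: S'_def)
  qed
  have p': "p \<in> S'" and q': "q \<in> S'" using far[OF p] far[OF q] by auto
  let ?u = "ribbon \<sigma> (e, d') y z" and ?v = "ribbon \<sigma> (e, \<not> d') w x"
  have u': "?u \<in> S'" and v': "?v \<in> S'" by (auto simp: S'_def)
  note fu' = ribbon_facts[OF flip(1) u' new(1)] and fv' = ribbon_facts[OF flip(1) v' new(2)]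
  have not_up: "\<not> collapsible S' {?u, p}"
  proof
    assume c: "collapsible S' {?u, p}"
    have "?u = ribbon \<sigma> (fst y, \<not> \<not> snd y) z (e, d')" "mixed3 (fst y, \<not> \<not> snd y) z (e, d')"
      using new(1) ribbon_rotate[of \<sigma> "(e, d')" y z] mixed3_rotate[of "(e, d')" y z] by auto
    then show False
      using same_side_contradiction[OF flip(1), of \<sigma> "fst y" "\<not> snd y" \<alpha> \<beta> z "(e, d')"] p' p_rib u' c
        \<beta>_ext z_ext flip(2) by (simp add: insert_commute)
  qed
  have not_vq: "\<not> collapsible S' {?v, q}"
  proof
    assume c: "collapsible S' {?v, q}"
    have "?v = ribbon \<sigma> (fst w, \<not> \<not> snd w) x (e, \<not> d')" "mixed3 (fst w, \<not> \<not> snd w) x (e, \<not> d')"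
      using new(2) ribbon_rotate[of \<sigma> "(e, \<not> d')" w x] mixed3_rotate[of "(e, \<not> d')" w x] by auto
    then show False
      using same_side_contradiction[OF flip(1), of \<sigma> "fst w" "\<not> snd w" \<gamma> \<delta> x "(e, \<not> d')"] q' q_rib v' c
        \<delta>_ext u(3) flip(2) by (simp add: insert_commute)
  qed
  have "(fst y, snd y) \<in> half_edges ?u" using fu'(3) by simp
  then obtain e1 y0 g where e1: "e1 \<noteq> fst y" "(e1, snd y) \<in> half_edges ?u" "y0 \<in> S'" "(e1, \<not> snd y) \<in> half_edges y0"
      "g \<in> inner S'" "(g, snd y) \<in> half_edges y0"
    using second_half_edge[OF criticalD(1)[OF flip(1)] u' p' _ p(2) not_up] by metis
  \<comment> \<open>the detour around the edge \<open>y\<close> starts along \<open>e\<close>, so it passes through the vertex \<open>?v\<close>\<close>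
  have "e1 \<in> inner S'" using innerI[OF u' e1(3,2,4)] .
  then have "fst z \<noteq> e1" using z_ext flip(2) by auto
  moreover have "(e1, snd y) \<in> {(e, d'), y, z}" using e1(2) unfolding fu'(3) .
  ultimately have "(e1, snd y) = (e, d')" using e1(1) by (metis fst_conv insertE singletonD)
  then have yd: "e1 = e" "d' = snd y" by auto
  have "(e, \<not> d') \<in> half_edges ?v" using fv'(3) by simp
  then have y0: "y0 = ?v" using critical_unique[OF flip(1) e1(3) v' e1(4)] yd by simp
  have "(g, d') \<in> half_edges ?v" using e1(6) unfolding y0 yd(2) .
  then have "(g, d') \<in> {(e, \<not> d'), w, x}" unfolding fv'(3) .
  moreover have "fst x \<noteq> g" using e1(5) u(3) flip(2) by auto
  ultimately have "w = (g, d')" by (metis fst_conv snd_conv insertE singletonD)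
  then have "collapsible S' {?v, q}"
    using collapsible_through[OF flip(1) v' q', of "fst w" d' e] fv'(3) q(2) flip(2,4) by simp
  then show False using not_vq by blast
qed

text \<open>
  The previous lemma forces a triangle of a source \<open>s\<close>, a sink \<open>t\<close> and
  a third vertex \<open>x\<close> between them. Two of its edges can be contracted, and their
  legs lie on opposite sides, which determines the cyclic orders at all three vertices. It
  remains to flip the edge at \<open>x\<close> for which the new edge can be directed such that
  the next edge meets a vertex that is neither a source nor a sink.
\<close>

lemma no_critical: "\<not> critical S"
proof
  assume S: "critical S"
  note D = criticalD[OF S]
  obtain e s t where est: "s \<in> S" "t \<in> S" "(e, True) \<in> half_edges s" "(e, False) \<in> half_edges t"
    "\<not> collapsible S {s, t}"
  proof -
    have "0 < card S" using D(5,6) by (simp add: card_gt_0_iff)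
    then have "inner S \<noteq> {}" using D(8) by auto
    then obtain e u v where uv: "u \<in> S" "v \<in> S" "(e, True) \<in> half_edges u" "(e, False) \<in> half_edges v"
      unfolding inner_half_iff by (metis all_not_in_conv inner_half_iff)
    show thesis
    proof (cases "collapsible S {u, v}")
      case False
      then show thesis using that uv by blast
    next
      case True
      have e_v: "(e, \<not> True) \<in> half_edges v" using uv(4) by simp
      obtain w g d1 p where w: "w \<in> {u, v}" "(g, d1) \<in> half_edges w" "p \<in> S" "(g, \<not> d1) \<in> half_edges p"
          "\<not> collapsible S {w, p}"
        using not_collapsible_neighbour[OF S uv(1,2,3) e_v True] by metis
      have "w \<in> S" using w(1) uv by auto
      then show thesis
        using that[of w p g] that[of p w g] w by (cases d1) (auto simp: insert_commute)
    qed
  qed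
  have e_in: "e \<in> inner S" using innerI[OF est(1,2), of e True] est by simp
  have "(e, \<not> True) \<in> half_edges t" using est(4) by simp
  then obtain c x g where c0: "c \<noteq> e" "(c, True) \<in> half_edges s" "x \<in> S" "(c, \<not> True) \<in> half_edges x"
      and g: "g \<in> inner S" "(g, True) \<in> half_edges x"
    using second_half_edge[OF D(1) est(1,2,3) _ est(5)] by metis
  have "(c, False) \<in> half_edges x" using c0(4) by simp
  note c = c0(1-3) this
  have c_in: "c \<in> inner S" using innerI[OF est(1) c(3), of c True] c by simp
  have cg: "c \<noteq> g" using critical_opposite[OF S c(3,4)] g(2) by blast
  have col_c: "collapsible S {x, s}"
    using collapsible_through[OF S c(3) est(1), of c False g] c g by simp
  obtain x2 where x2: "x2 \<in> S" "(g, False) \<in> half_edges x2" using inner_end[OF g(1)] by blast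
  have col_g: "collapsible S {x, x2}"
    using collapsible_through[OF S c(3) x2(1), of g True c] c g x2 c_in by simp
  have x_s: "x \<noteq> s" using critical_opposite[OF S c(3,4)] c(2) by blast
  have x_x2: "x \<noteq> x2" using critical_opposite[OF S c(3) g(2)] x2(2) by blast
  \<comment> \<open>some neighbour of the edge from \<open>x\<close> to \<open>x2\<close> cannot be contracted, and it must be the other edge at \<open>x2\<close>; the detour around it has to come from \<open>s\<close> via \<open>x\<close>\<close>
  have x2_t: "x2 = t"
  proof -
    have g_x2: "(g, \<not> True) \<in> half_edges x2" using x2(2) by simp
    obtain w h d1 p where w: "w \<in> {x, x2}" "h \<noteq> g" "(h, d1) \<in> half_edges w" "p \<in> S" "(h, \<not> d1) \<in> half_edges p"
        "\<not> collapsible S {w, p}"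
      using not_collapsible_neighbour[OF S c(3) x2(1) g(2) g_x2 col_g] .
    have wS: "w \<in> S" using w(1) c x2 by auto
    have h_in: "h \<in> inner S" using innerI[OF wS w(4,3,5)] .
    have "w \<noteq> x"
    proof
      assume wx: "w = x"
      have "h = c \<or> h = g"
        using critical_inner_two[OF S c(3,4) g(2), of h d1] w(3) wx cg c_in g(1) h_in by blast
      then have "h = c" using w(2) by blast
      moreover from this have "d1 = False" using critical_opposite[OF S c(3,4)] w(3) wx by blast
      ultimately have "p = s" using critical_unique[OF S w(4) est(1) w(5)] c(2) by simp
      then show False using w(6) wx col_c by blast
    qed
    then have wx2: "w = x2" using w(1) by blast
    have d1: "d1 = False"
    proof (rule ccontr)
      assume "d1 \<noteq> False"
      then have "collapsible S {w, p}"
        using collapsible_through[OF S wS w(4,3,5), of g] x2(2) wx2 g(1) by simp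
      then show False using w(6) by blast
    qed
    have px2: "(p, x2) \<in> arrows S" unfolding arrow_half using w x2 wx2 d1 by auto
    have "\<not> collapsible S {p, x2}" using w(6) wx2 by (simp add: insert_commute)
    then obtain y where y: "y \<noteq> p" "y \<noteq> x2" "(p, y) \<in> (arrows S)\<^sup>+" "(y, x2) \<in> arrows S"
      using path_if_not_collapsible[OF D(1) px2] by blast
    obtain f where f: "(f, True) \<in> half_edges y" "(f, False) \<in> half_edges x2" "y \<in> S"
      using y(4) unfolding arrow_half by blast
    have f_in: "f \<in> inner S" using innerI[OF f(3) x2(1), of f True] f by simp
    have "f \<noteq> h"
      using critical_unique[OF S f(3) w(4) f(1)] w(5) d1 y(1) by auto
    moreover have "f = g \<or> f = h"
      using critical_inner_two[OF S x2(1) x2(2) _ f(2), of h d1] w(2,3) wx2 g(1) h_in f_in by blast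
    ultimately have "y = x" using critical_unique[OF S f(3) c(3) f(1)] g(2) by simp
    then have "(p, x) \<in> (arrows S)\<^sup>+" using y(3) by simp
    then obtain z where z: "(p, z) \<in> (arrows S)\<^sup>*" "(z, x) \<in> arrows S" using tranclD2 by metis
    obtain k where k: "(k, True) \<in> half_edges z" "(k, False) \<in> half_edges x" "z \<in> S"
      using z(2) unfolding arrow_half by blast
    have k_in: "k \<in> inner S" using innerI[OF k(3) c(3), of k True] k by simp
    have "k = c \<or> k = g"
      using critical_inner_two[OF S c(3,4) g(2) k(2) cg c_in g(1) k_in] .
    moreover have "k \<noteq> g" using critical_opposite[OF S c(3) g(2)] k(2) by blast
    ultimately have "z = s" using critical_unique[OF S k(3) est(1) k(1)] c(2) by simp
    have "p = s"
    proof (rule ccontr)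
      assume "p \<noteq> s"
      then have "(p, s) \<in> (arrows S)\<^sup>+" using z(1) \<open>z = s\<close> by (metis rtranclD)
      then obtain z' where "(z', s) \<in> arrows S" using tranclD2 by metis
      then obtain k' where k': "(k', True) \<in> half_edges z'" "(k', False) \<in> half_edges s" "z' \<in> S"
        unfolding arrow_half by blast
      have "k' \<in> inner S" using innerI[OF k'(3) est(1), of k' True] k' by simp
      then have "k' = e \<or> k' = c"
        using critical_inner_two[OF S est(1,3) c(2) k'(2)] c(1) e_in c_in by blast
      then show False using critical_opposite[OF S est(1) k'(2)] est(3) c(2) by blast
    qed
    then have hs: "(h, True) \<in> half_edges s" using w(5) d1 by simp
    have "h = e \<or> h = c"
      using critical_inner_two[OF S est(1,3) c(2) hs] c(1) e_in c_in h_in by blast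
    moreover have "h \<noteq> c"
      using critical_unique[OF S x2(1) c(3), of "(c, False)"] w(3) wx2 d1 c(4) x_x2 by auto
    ultimately show "x2 = t" using critical_unique[OF S x2(1) est(2), of "(e, False)"] w(3) wx2 d1 est(4) by simp
  qed
  have gt: "(g, False) \<in> half_edges t" using x2 x2_t by simp
  have x_t: "x \<noteq> t" using x_x2 x2_t by simp
  have s_t: "s \<noteq> t" using critical_opposite[OF S est(1,3)] est(4) by blast
  have eg: "e \<noteq> g" using critical_unique[OF S est(1) c(3) est(3)] g(2) x_s by auto
  obtain \<sigma> z where s: "s = ribbon \<sigma> (c, True) (e, True) z" "mixed3 (c, True) (e, True) z"
  proof -
    obtain a b where ab: "s = ribbon True (c, True) a b" "mixed3 (c, True) a b" using critical_ribbon[OF S est(1) c(2)] .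
    have "(e, True) \<in> {(c, True), a, b}" using half_ribbon[OF ab(2)] ab(1) est(3) by blast
    then consider "a = (e, True)" | "b = (e, True)" using c(1) by auto
    then show thesis
    proof cases
      case 1
      then show thesis using that ab by blast
    next
      case 2
      have "s = ribbon False (c, True) b a" "mixed3 (c, True) b a"
        using ab mixed_swap by (auto simp: ribbon_def mixed3_def)
      then show thesis using that 2 by blast
    qed
  qed
  have s_in: "ribbon \<sigma> (c, True) (e, True) z \<in> S" using s(1) est(1) by simp
  have z_ext: "fst z \<notin> inner S" using ribbon_facts(6)[OF S s_in s(2)] c_in e_in by simp
  have z_dir: "snd z = False" using s(2) by (auto simp: mixed3_def mixed_def)
  obtain a0 a where x0: "x = ribbon \<sigma> (c, False) a0 a" "mixed3 (c, False) a0 a" using critical_ribbon[OF S c(3,4)] .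
  have x0_in: "ribbon \<sigma> (c, False) a0 a \<in> S" using x0(1) c(3) by simp
  note fx0 = ribbon_facts[OF S x0_in x0(2)]
  \<comment> \<open>otherwise the legs at \<open>s\<close> and \<open>x\<close> would lie on the same side\<close>
  have a0: "a0 = (g, True)"
  proof -
    have "fst a0 \<in> inner S"
    proof (rule ccontr)
      assume "fst a0 \<notin> inner S"
      then show False
        using same_side_contradiction[OF S s_in s(2), of a0 a] x0_in x0(2) z_ext col_c x0(1) s(1)
        by (simp add: insert_commute)
    qed
    then have "fst a \<notin> inner S" using fx0(6) c_in by simp
    moreover have "(g, True) \<in> {(c, False), a0, a}" using fx0(3) g(2) x0(1) by simp
    ultimately show ?thesis using g(1) by auto
  qed
  then have a_ext: "fst a \<notin> inner S" using fx0(6) c_in g(1) by simp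
  have x: "x = ribbon \<sigma> (c, False) (g, True) a" "mixed3 (c, False) (g, True) a" using x0 a0 by auto
  have x': "x = ribbon \<sigma> (g, True) a (c, False)" "mixed3 (g, True) a (c, False)"
    using x ribbon_rotate[of \<sigma> "(c, False)" "(g, True)" a] mixed3_rotate[of "(c, False)" "(g, True)" a] by auto
  have x_in: "ribbon \<sigma> (c, False) (g, True) a \<in> S" "ribbon \<sigma> (g, True) a (c, False) \<in> S" using x(1) x'(1) c(3) by auto
  obtain b b0 where t0: "t = ribbon \<sigma> (g, False) b b0" "mixed3 (g, False) b b0" using critical_ribbon[OF S est(2) gt] .
  have t0_in: "ribbon \<sigma> (g, False) b b0 \<in> S" using t0(1) est(2) by simp
  note ft0 = ribbon_facts[OF S t0_in t0(2)]
  \<comment> \<open>otherwise the legs at \<open>x\<close> and \<open>t\<close> would lie on the same side\<close>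
  have b0: "b0 = (e, False)"
  proof -
    have "fst b0 \<in> inner S"
    proof (rule ccontr)
      assume "fst b0 \<notin> inner S"
      then show False
        using same_side_contradiction[OF S t0_in t0(2), of a "(c, False)"] x_in(2) x'(2) a_ext col_g x'(1) t0(1) x2_t
        by (simp add: insert_commute)
    qed
    then have "fst b \<notin> inner S" using ft0(7) g(1) by simp
    moreover have "(e, False) \<in> {(g, False), b, b0}" using ft0(3) est(4) t0(1) by simp
    ultimately show ?thesis using e_in eg by auto
  qed
  then have b_ext: "fst b \<notin> inner S" using ft0(7) e_in g(1) by simp
  have t: "t = ribbon \<sigma> (g, False) b (e, False)" "mixed3 (g, False) b (e, False)" using t0 b0 by auto
  have t_in: "ribbon \<sigma> (g, False) b (e, False) \<in> S" using t(1) est(2) by simp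
  have b_dir: "snd b = True" using t(2) by (auto simp: mixed3_def mixed_def)
  show False
  proof (cases "snd a")
    case False
    \<comment> \<open>here \<open>x\<close> is a product; the new edge is directed such that the leg of \<open>s\<close> moves to a vertex between the source and \<open>t\<close>\<close>
    have new: "mixed3 (c, False) z (g, True)" "mixed3 (c, \<not> False) a (e, True)"
      using z_dir False by (auto simp: mixed3_def mixed_def)
    have vx: "ribbon \<sigma> (c, \<not> True) (g, True) a \<in> S" "mixed3 (c, \<not> True) (g, True) a"
      using x_in x(2) by auto
    have col: "collapsible S {ribbon \<sigma> (c, True) (e, True) z, ribbon \<sigma> (c, \<not> True) (g, True) a}"
      using col_c x(1) s(1) by (simp add: insert_commute)
    define S' where "S' = S - {ribbon \<sigma> (c, True) (e, True) z, ribbon \<sigma> (c, \<not> True) (g, True) a}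
        \<union> {ribbon \<sigma> (c, False) z (g, True), ribbon \<sigma> (c, \<not> False) a (e, True)}"
    note flip = critical_flip[OF S s_in s(2) vx col new, folded S'_def]
    let ?u = "ribbon \<sigma> (c, False) z (g, True)"
    have u': "?u \<in> S'" by (auto simp: S'_def)
    have t': "t \<in> S'" using est(2) s_t x_t s(1) x(1) by (auto simp: S'_def)
    have hu: "half_edges ?u = {(c, False), z, (g, True)}" using half_ribbon[OF new(1)] .
    have "collapsible S' {?u, t}"
      using collapsible_through[OF flip(1) u' t', of g True c] hu gt c_in flip(2) by simp
    moreover have "?u = ribbon \<sigma> (g, True) (c, False) z" "mixed3 (g, True) (c, False) z"
      using new(1) ribbon_rotate[of \<sigma> "(g, True)" "(c, False)" z] mixed3_rotate[of "(g, True)" "(c, False)" z] by auto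
    ultimately show False
      using same_side_contradiction[OF flip(1), of \<sigma> g True "(c, False)" z b "(e, False)"]
        u' t' t z_ext b_ext flip(2) by simp
  next
    case True
    \<comment> \<open>here \<open>x\<close> is a coproduct; the leg of \<open>t\<close> moves to a vertex between \<open>s\<close> and the sink\<close>
    have new: "mixed3 (g, True) (c, False) b" "mixed3 (g, \<not> True) (e, False) a"
      using b_dir True by (auto simp: mixed3_def mixed_def)
    have vt: "ribbon \<sigma> (g, \<not> True) b (e, False) \<in> S" "mixed3 (g, \<not> True) b (e, False)"
      using t_in t(2) by auto
    have col: "collapsible S {ribbon \<sigma> (g, True) a (c, False), ribbon \<sigma> (g, \<not> True) b (e, False)}"
      using col_g x'(1) t(1) x2_t by simp
    define S' where "S' = S - {ribbon \<sigma> (g, True) a (c, False), ribbon \<sigma> (g, \<not> True) b (e, False)}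
        \<union> {ribbon \<sigma> (g, True) (c, False) b, ribbon \<sigma> (g, \<not> True) (e, False) a}"
    note flip = critical_flip[OF S x_in(2) x'(2) vt col new, folded S'_def]
    let ?u = "ribbon \<sigma> (g, True) (c, False) b"
    have u': "?u \<in> S'" by (auto simp: S'_def)
    have s': "s \<in> S'" using est(1) s_t x_s t(1) x'(1) by (auto simp: S'_def)
    have hu: "half_edges ?u = {(g, True), (c, False), b}" using half_ribbon[OF new(1)] .
    have "collapsible S' {?u, s}"
      using collapsible_through[OF flip(1) u' s', of c False g] hu c(2) g(1) flip(2) by simp
    moreover have "?u = ribbon \<sigma> (c, False) b (g, True)" "mixed3 (c, False) b (g, True)"
      using new(1) ribbon_rotate[of \<sigma> "(g, True)" "(c, False)" b] mixed3_rotate[of "(g, True)" "(c, False)" b] by auto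
    ultimately show False
      using same_side_contradiction[OF flip(1), of \<sigma> c True "(e, True)" z b "(g, True)"]
        u' s' s z_ext b_ext flip(2) by (simp add: insert_commute)
  qed
qed

end

context bib_properad begin

lemma positive_genus_vanishes:
  assumes "good S" "\<forall>v\<in>S. trivalent v" "card S \<le> card (inner S)"
  shows "vanishes S"
proof (rule ccontr)
  assume "\<not> vanishes S"
  then have "counterexample S" using assms by (simp add: counterexample_def)
  define n where "n = (LEAST k. \<exists>S. counterexample S \<and> card S = k)"
  have "\<exists>S. counterexample S \<and> card S = n"
    unfolding n_def by (rule LeastI_ex) (use \<open>counterexample S\<close> in blast)
  then obtain T where T: "counterexample T" "card T = n" by blast
  interpret smallest_counterexample P m \<Delta> n
  proof unfold_locales
    show "n \<le> card S" if "counterexample S" for S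
      unfolding n_def by (rule Least_le) (use that in blast)
  qed
  show False using no_critical T by (auto simp: critical_def)
qed

end

section \<open>Arbitrary decorations\<close>

lemma distinct_singleton: "distinct xs \<Longrightarrow> set xs = {a} \<Longrightarrow> xs = [a]"
  by (cases xs; cases "tl xs"; auto)

lemma labels_relabel:
  "out_labels (relabel f ` S) = f ` out_labels S" "in_labels (relabel f ` S) = f ` in_labels S"
  by (auto simp: out_labels_def in_labels_def)

lemma image_arrows_good:
  assumes inj: "inj_on f S" and S: "ranked S" "connected_set S"
    and arr: "\<And>u v. u \<in> S \<Longrightarrow> v \<in> S \<Longrightarrow> (f u, f v) \<in> arrows (f ` S) \<longleftrightarrow> (u, v) \<in> arrows S"
  shows "ranked (f ` S)" "connected_set (f ` S)"
proof -
  obtain r where r: "\<And>x y. (x, y) \<in> arrows S \<Longrightarrow> (r x :: nat) < r y"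
    using S(1) unfolding ranked_def by blast
  have "r (inv_into S f x) < r (inv_into S f y)" if xy: "(x, y) \<in> arrows (f ` S)" for x y
  proof -
    obtain u v where "u \<in> S" "v \<in> S" "x = f u" "y = f v" using arrows_mem[OF xy] by blast
    then show ?thesis using xy arr r inv_into_f_f[OF inj] by simp
  qed
  then show "ranked (f ` S)"
    unfolding ranked_def by (intro exI[of _ "\<lambda>x. r (inv_into S f x)"]) blast
  have "crossing (f ` S) A" if A: "A \<subseteq> f ` S" "A \<noteq> {}" "A \<noteq> f ` S" for A
  proof -
    let ?B = "{s \<in> S. f s \<in> A}"
    have "?B \<subseteq> S" "?B \<noteq> {}" "?B \<noteq> S" using A by auto
    then have "crossing S ?B" using S(2) by (simp add: connected_set_crossing)
    then obtain u v where "u \<in> ?B" "v \<in> S - ?B" "(u, v) \<in> arrows S \<or> (v, u) \<in> arrows S"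
      unfolding crossing_def by blast
    then show ?thesis using crossingI_arrow[of "f u" "f v" "f ` S" A] arr by auto
  qed
  moreover have "f ` S \<noteq> {}" using S(2) by (auto simp: connected_set_def)
  ultimately show "connected_set (f ` S)" by (simp add: connected_set_crossing)
qed

lemma relabel_inj_on:
  assumes sep: "separated S" and inj: "inj_on f (out_labels S)"
  shows "inj_on (relabel f) S"
proof (rule inj_onI)
  fix u v assume uv: "u \<in> S" "v \<in> S" "relabel f u = relabel f v"
  obtain e where e: "e \<in> set (fst u)" using sep uv(1) by (cases "fst u") (auto simp: separated_def)
  have "f e \<in> f ` set (fst v)"
    using e uv(3) by (metis fst_map_prod imageI list.set_map)
  then obtain e' where e': "e' \<in> set (fst v)" "f e = f e'" by auto
  then have "e = e'" using inj e uv out_labelsI inj_onD by metis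
  then show "u = v" using label_unique(1)[OF sep uv(1,2)] e e' by blast
qed

lemma relabel_separated:
  assumes sep: "separated S" and inj: "inj_on f (out_labels S)" "inj_on f (in_labels S)"
  shows "separated (relabel f ` S)"
proof -
  have o: "set (fst u) \<subseteq> out_labels S" and i: "set (snd u) \<subseteq> in_labels S" if "u \<in> S" for u
    using that by (auto intro: out_labelsI in_labelsI)
  have disj: "set (fst (relabel f u)) \<inter> set (fst (relabel f v)) = {}
      \<and> set (snd (relabel f u)) \<inter> set (snd (relabel f v)) = {}"
    if "u \<in> S" "v \<in> S" "relabel f u \<noteq> relabel f v" for u v
  proof -
    have "u \<noteq> v" using that by blast
    then have "set (fst u) \<inter> set (fst v) = {}" "set (snd u) \<inter> set (snd v) = {}"
      using sep that by (auto simp: separated_def pairwise_def)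
    then have "f ` set (fst u) \<inter> f ` set (fst v) = {}" "f ` set (snd u) \<inter> f ` set (snd v) = {}"
      using inj_on_image_Int[OF inj(1) o[OF that(1)] o[OF that(2)]]
        inj_on_image_Int[OF inj(2) i[OF that(1)] i[OF that(2)]] by auto
    then show ?thesis by simp
  qed
  have each: "fst (relabel f u) \<noteq> [] \<and> distinct (fst (relabel f u)) \<and> distinct (snd (relabel f u))"
    if "u \<in> S" for u
    using that sep inj_on_subset[OF inj(1) o[OF that]] inj_on_subset[OF inj(2) i[OF that]]
    by (simp add: separated_def distinct_map)
  show ?thesis
    unfolding separated_def pairwise_def using disj each sep by (auto simp: separated_def)
qed

lemma relabel_good:
  assumes S: "good S" and inj: "inj_on f (out_labels S \<union> in_labels S)" and L: "legs S os is"
  shows "good (relabel f ` S)" "legs (relabel f ` S) (map f os) (map f is)"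
    "inner (relabel f ` S) = f ` inner S" "inj_on (relabel f) S"
proof -
  have sep: "separated S" using S by (simp add: good_def)
  have injo: "inj_on f (out_labels S)" and inji: "inj_on f (in_labels S)"
    using inj by (auto intro: inj_on_subset)
  show injr: "inj_on (relabel f) S" using relabel_inj_on[OF sep injo] .
  have arr: "(relabel f u, relabel f v) \<in> arrows (relabel f ` S) \<longleftrightarrow> (u, v) \<in> arrows S"
    if "u \<in> S" "v \<in> S" for u v
  proof -
    have "f ` set (fst u) \<inter> f ` set (snd v) = f ` (set (fst u) \<inter> set (snd v))"
      by (rule inj_on_image_Int[OF inj, symmetric]) (use that in \<open>auto intro: out_labelsI in_labelsI\<close>)
    then show ?thesis using that by (auto simp: arrows_def)
  qed
  show "good (relabel f ` S)"
    using image_arrows_good[OF injr _ _ arr] relabel_separated[OF sep injo inji] S by (simp add: good_def)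
  show "inner (relabel f ` S) = f ` inner S"
    unfolding inner_def labels_relabel using inj_on_image_Int[OF inj, of "out_labels S" "in_labels S"] by blast
  have "f ` (out_labels S - in_labels S) = f ` out_labels S - f ` in_labels S"
    "f ` (in_labels S - out_labels S) = f ` in_labels S - f ` out_labels S"
    using inj_on_image_set_diff[OF inj] by auto
  moreover have "inj_on f (set os)" "inj_on f (set is)"
    using L inj unfolding legs_def by (auto intro: inj_on_subset)
  ultimately show "legs (relabel f ` S) (map f os) (map f is)"
    using L unfolding legs_def labels_relabel by (simp add: distinct_map)
qed

lemma inj_on_union: "\<lbrakk>inj_on f A; inj_on f B; f ` A \<inter> f ` B = {}\<rbrakk> \<Longrightarrow> inj_on f (A \<union> B)"
  unfolding inj_on_Un by blast

text \<open>
  The legs get prescribed names; the inner edges are shifted beyond all names in use.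
\<close>

lemma fresh_relabelling:
  assumes U: "separated U" "legs U os is" and len: "length os = length hos" "length is = length his"
    and d: "distinct hos" "distinct his" "set hos \<inter> set his = {}" and fin: "finite (X :: nat set)"
  obtains f where "inj_on f (out_labels U \<union> in_labels U)" "map f os = hos" "map f is = his"
    "f ` inner U \<inter> X = {}"
proof -
  define N where "N = Suc (Max (insert 0 (X \<union> set hos \<union> set his)))"
  have N: "x < N" if "x \<in> X \<union> set hos \<union> set his" for x
    using that fin by (simp add: N_def less_Suc_eq_le)
  define f where "f x = (case map_of (zip os hos) x of Some y \<Rightarrow> y | None \<Rightarrow>
     (case map_of (zip is his) x of Some y \<Rightarrow> y | None \<Rightarrow> N + x))" for x
  note sp = labels_split[OF U(2)]
  have du: "distinct os" "distinct is" using U(2) by (auto simp: legs_def)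
  have disj: "set os \<inter> set is = {}" using U(2) by (auto simp: legs_def)
  have os: "map f os = hos"
    using len du by (intro nth_equalityI) (simp_all add: f_def map_of_zip_nth)
  have "map_of (zip os hos) x = None" if "x \<notin> set os" for x
    using that len by (simp add: map_of_zip_is_None)
  moreover have "map_of (zip is his) x = None" if "x \<notin> set is" for x
    using that len by (simp add: map_of_zip_is_None)
  ultimately have fi: "f x = N + x" if "x \<notin> set os" "x \<notin> set is" for x
    using that by (simp add: f_def)
  have "is": "map f is = his"
  proof (rule nth_equalityI)
    fix i assume "i < length (map f is)"
    then have i: "i < length is" by simp
    then have "is ! i \<notin> set os" using disj nth_mem by blast
    then have "map_of (zip os hos) (is ! i) = None"
      using len by (simp add: map_of_zip_is_None)
    moreover have "map_of (zip is his) (is ! i) = Some (his ! i)"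
      by (rule map_of_zip_nth) (use i len du in simp_all)
    ultimately show "map f is ! i = his ! i" using i by (simp add: f_def del: map_of_eq_None_iff)
  qed (use len in simp)
  have in_eq: "f x = N + x" if "x \<in> inner U" for x
    by (rule fi) (use that sp(5,6) in blast)+
  have io: "inj_on f (set os)" "inj_on f (set is)" using os "is" d distinct_map by metis+
  have ii: "inj_on f (inner U)" using in_eq by (auto intro!: inj_onI)
  have im: "f ` set os = set hos" "f ` set is = set his" using os "is" by (metis list.set_map)+
  have low: "f ` inner U \<inter> (X \<union> set hos \<union> set his) = {}" using in_eq N by fastforce
  have "inj_on f (set os \<union> set is \<union> inner U)"
    using io ii im low d(3) by (intro inj_on_union) (auto simp: image_Un)
  moreover have "out_labels U \<union> in_labels U = set os \<union> set is \<union> inner U" using sp by blast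
  ultimately show thesis using that os "is" low by auto
qed

text \<open>
  The removal of a vertex with one input and one output, which will carry the identity: its
  output \<open>b\<close> is merged with its input \<open>c\<close>.
\<close>

locale strand_removal =
  fixes T :: "vertex set" and b c :: nat
  assumes good_ins: "good (insert ([b], [c]) T)" and vT: "([b], [c]) \<notin> T" and ne: "T \<noteq> {}"
begin

abbreviation "S \<equiv> insert ([b], [c]) T"
abbreviation "\<sigma> \<equiv> id(b := c)"
abbreviation "T' \<equiv> relabel \<sigma> ` T"

lemma sepS: "separated S" and sepT: "separated T"
  using good_ins separated_subset[of S T] by (auto simp: good_def)

lemma bc: "b \<noteq> c" using good_no_loop[OF good_ins, of "([b], [c])"] by auto

lemma b_out: "b \<notin> out_labels T"
  using label_unique(1)[OF sepS, of "([b], [c])" _ b] vT by (fastforce simp: out_labels_def)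

lemma c_in: "c \<notin> in_labels T"
  using label_unique(2)[OF sepS, of "([b], [c])" _ c] vT by (fastforce simp: in_labels_def)

lemma inj_out: "inj_on \<sigma> (out_labels T)" and inj_in: "inj_on \<sigma> (in_labels T)"
  using b_out c_in by (auto simp: inj_on_def)

lemma sepT': "separated T'" using relabel_separated[OF sepT inj_out inj_in] .

lemma injT: "inj_on (relabel \<sigma>) T" using relabel_inj_on[OF sepT inj_out] .

lemma outT': "out_labels T' = out_labels T"
  unfolding labels_relabel using b_out by force

lemma inT': "in_labels T' = (in_labels T - {b}) \<union> (if b \<in> in_labels T then {c} else {})"
  unfolding labels_relabel by auto

lemma arrow_T': 
  assumes "s \<in> T" "t \<in> T"
  shows "(relabel \<sigma> s, relabel \<sigma> t) \<in> arrows T' \<longleftrightarrow>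
    (s, t) \<in> arrows S \<or> (s, ([b], [c])) \<in> arrows S \<and> (([b], [c]), t) \<in> arrows S"
proof -
  have fs: "b \<notin> set (fst s)" "c \<notin> set (snd t)"
    using b_out c_in assms out_labelsI in_labelsI by blast+
  have "map \<sigma> (fst s) = fst s" using fs(1) by (simp add: map_idI)
  then have "(relabel \<sigma> s, relabel \<sigma> t) \<in> arrows T' \<longleftrightarrow> set (fst s) \<inter> \<sigma> ` set (snd t) \<noteq> {}"
    using assms by (simp add: arrows_def)
  also have "\<dots> \<longleftrightarrow> set (fst s) \<inter> set (snd t) \<noteq> {} \<or> c \<in> set (fst s) \<and> b \<in> set (snd t)"
    using fs by auto
  also have "\<dots> \<longleftrightarrow> (s, t) \<in> arrows S \<or> (s, ([b], [c])) \<in> arrows S \<and> (([b], [c]), t) \<in> arrows S"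
    using assms by (simp add: arrows_def)
  finally show ?thesis .
qed

lemma good_T': "good T'"
proof -
  let ?v = "([b], [c])"
  obtain r where r: "\<And>x y. (x, y) \<in> arrows S \<Longrightarrow> (r x :: nat) < r y"
    using good_ins unfolding good_def ranked_def by blast
  let ?g = "inv_into T (relabel \<sigma>)"
  have "r (?g x) < r (?g y)" if xy: "(x, y) \<in> arrows T'" for x y
  proof -
    have "x \<in> T'" "y \<in> T'" using arrows_mem[OF xy] by simp_all
    then obtain s t where st: "s \<in> T" "t \<in> T" "x = relabel \<sigma> s" "y = relabel \<sigma> t"
      by (elim imageE)
    have "(s, t) \<in> arrows S \<or> (s, ?v) \<in> arrows S \<and> (?v, t) \<in> arrows S"
      using xy unfolding st(3,4) arrow_T'[OF st(1,2)] .
    then have "r s < r t"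
    proof
      assume "(s, ?v) \<in> arrows S \<and> (?v, t) \<in> arrows S"
      then have "r s < r ?v" "r ?v < r t" by (auto intro: r)
      then show ?thesis by (rule less_trans)
    qed (rule r)
    then show ?thesis unfolding st inv_into_f_f[OF injT st(1)] inv_into_f_f[OF injT st(2)] .
  qed
  then have "ranked T'" unfolding ranked_def by (intro exI[of _ "\<lambda>x. r (?g x)"]) blast
  moreover have "connected_set T'"
    unfolding connected_set_crossing
  proof (intro conjI allI impI)
    show "T' \<noteq> {}" using ne by simp
    fix A assume A: "A \<subseteq> T' \<and> A \<noteq> {} \<and> A \<noteq> T'"
    let ?B = "{s \<in> T. relabel \<sigma> s \<in> A}"
    have con: "connected_set S" using good_ins by (simp add: good_def)
    show "crossing T' A"
    proof (rule ccontr)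
      assume nc: "\<not> crossing T' A"
      have none: "\<not> ((relabel \<sigma> s, relabel \<sigma> t) \<in> arrows T' \<or> (relabel \<sigma> t, relabel \<sigma> s) \<in> arrows T')"
        if "s \<in> ?B" "t \<in> T - ?B" for s t
        using nc crossingI_arrow[of "relabel \<sigma> s" "relabel \<sigma> t" T' A] that by blast
      have noneS: "(s, t) \<notin> arrows S \<and> (t, s) \<notin> arrows S" if "s \<in> ?B" "t \<in> T - ?B" for s t
        using none[OF that] arrow_T' that by blast
      obtain y where "y \<in> T'" "y \<notin> A" using A by blast
      then obtain t0 where t0: "t0 \<in> T - ?B" by (elim imageE) blast
      obtain x where "x \<in> T'" "x \<in> A" using A by blast
      then obtain s0 where s0: "s0 \<in> ?B" by (elim imageE) blast
      have "?B \<subseteq> S" "?B \<noteq> {}" "?B \<noteq> S" using s0 vT by blast+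
      then have "crossing S ?B" using con by (simp add: connected_set_crossing)
      then obtain s where s: "s \<in> ?B" "(s, ?v) \<in> arrows S \<or> (?v, s) \<in> arrows S"
        unfolding crossing_def using noneS by blast
      have "t0 \<in> S" "t0 \<notin> insert ?v ?B" using t0 vT by auto
      then have "insert ?v ?B \<subseteq> S" "insert ?v ?B \<noteq> {}" "insert ?v ?B \<noteq> S" by auto
      then have "crossing S (insert ?v ?B)" using con by (simp add: connected_set_crossing)
      then obtain t where t: "t \<in> T - ?B" "(t, ?v) \<in> arrows S \<or> (?v, t) \<in> arrows S"
        unfolding crossing_def using noneS by blast
      have "s \<noteq> t" using s t by blast
      then have "\<not> ((s, ?v) \<in> arrows S \<and> (t, ?v) \<in> arrows S)" "\<not> ((?v, s) \<in> arrows S \<and> (?v, t) \<in> arrows S)"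
        using label_unique[OF sepS, of s t] by (auto simp: arrows_def)
      then have "(relabel \<sigma> s, relabel \<sigma> t) \<in> arrows T' \<or> (relabel \<sigma> t, relabel \<sigma> s) \<in> arrows T'"
        using s t arrow_T' by blast
      then show False using none[OF s(1) t(1)] by blast
    qed
  qed
  ultimately show ?thesis using sepT' by (simp add: good_def)
qed

lemma attached: "b \<in> in_labels T \<or> c \<in> out_labels T"
proof -
  have "crossing S {([b], [c])}"
    using good_ins ne vT unfolding good_def connected_set_crossing by blast
  then show ?thesis
    unfolding crossing_def arrows_def by (auto simp: out_labels_def in_labels_def)
qed

lemma legs_T': assumes "legs S os is" shows "legs T' (map \<sigma> os) (map \<sigma> is)"
proof -
  have os: "set os = (insert b (out_labels T)) - (insert c (in_labels T))"
    and i: "set is = (insert c (in_labels T)) - (insert b (out_labels T))"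
    using assms by (auto simp: legs_def labels_insert)
  have "distinct (map \<sigma> os)" "distinct (map \<sigma> is)"
    using assms os i by (auto simp: distinct_map legs_def inj_on_def)
  moreover have "set (map \<sigma> os) = out_labels T' - in_labels T'"
    unfolding outT' inT' set_map os using attached b_out c_in bc by (cases "b \<in> in_labels T") (auto simp: image_iff)
  moreover have "set (map \<sigma> is) = in_labels T' - out_labels T'"
    unfolding outT' inT' set_map i using attached b_out c_in bc by (cases "b \<in> in_labels T") (auto simp: image_iff)
  ultimately show ?thesis by (simp add: legs_def)
qed

lemma card_inner_T': "card (inner S) \<le> card (inner T') + 1"
proof -
  have fin: "finite (inner T')" using finite_labels(3)[OF sepT'] .
  show ?thesis
  proof (cases "b \<in> in_labels T")
    case True
    have "inner S \<subseteq> insert b (inner T')"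
      unfolding inner_def outT' inT' using True b_out c_in bc by (auto simp: labels_insert)
    then have "card (inner S) \<le> card (insert b (inner T'))" by (rule card_mono[rotated]) (use fin in simp)
    then show ?thesis using fin by (simp add: card_insert_if split: if_splits)
  next
    case False
    have "inner S \<subseteq> insert c (inner T')"
      unfolding inner_def outT' inT' using False b_out c_in bc by (auto simp: labels_insert)
    then have "card (inner S) \<le> card (insert c (inner T'))" by (rule card_mono[rotated]) (use fin in simp)
    then show ?thesis using fin by (simp add: card_insert_if split: if_splits)
  qed
qed

end

context bib_properad begin

text \<open>
  The case without vertices is included; it contributes the identity.
\<close>

definition trivalent_values :: "nat \<Rightarrow> nat \<Rightarrow> 'a set" where
  "trivalent_values k l = {val us os is | us os is. cdag (Graph us os is) \<and> (\<forall>v\<in>set us. trivalent v)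
     \<and> length os = k \<and> length is = l}"

abbreviation composites :: "nat \<Rightarrow> nat \<Rightarrow> 'a set" where
  "composites k l \<equiv> module.span (scal P) (trivalent_values k l)"

lemma composites_ops: "composites k l \<subseteq> ops P k l"
proof -
  have "trivalent_values k l \<subseteq> ops P k l" unfolding trivalent_values_def using val_ops by auto
  then show ?thesis
    unfolding ops_def using module.span_minimal[OF module_scal] module.subspace_span[OF module_scal] by blast
qed

text \<open>
  The statement of the theorem for one decorated graph, together with the statement that its
  value is again a combination of values of trivalent graphs. The two are proved by the same
  induction.
\<close>

definition expandable :: "vertex list \<Rightarrow> nat list \<Rightarrow> nat list \<Rightarrow> 'a list \<Rightarrow> bool" where
  "expandable vs os is ps \<longleftrightarrow> compose P (Graph vs os is) ps \<in> composites (length os) (length is) \<and>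
     (vs \<noteq> [] \<and> card (set vs) \<le> card (inner (set vs)) \<longrightarrow> compose P (Graph vs os is) ps = 0)"

lemma composites_zero: "0 \<in> composites k l" and composites_add: "x \<in> composites k l \<Longrightarrow> y \<in> composites k l \<Longrightarrow> x + y \<in> composites k l"
  and composites_scal: "x \<in> composites k l \<Longrightarrow> scal P c x \<in> composites k l" and composites_base: "x \<in> trivalent_values k l \<Longrightarrow> x \<in> composites k l"
  by (rule module.span_zero module.span_add module.span_scale module.span_base; use module_scal in simp)+

text \<open>
  The number of vertices drops by one and the number of inner edges by at most one, so positive
  genus persists.
\<close>

lemma expand_strand:
  assumes G: "cdag (Graph (bs @ ([b], [c]) # vs) os is)" and tr: "\<forall>v\<in>set bs. trivalent v"
    and ne: "\<forall>v\<in>set vs. fst v \<noteq> []" and ps: "list_all2 (\<lambda>v p. p \<in> composites (length (fst v)) (length (snd v))) vs ps"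
    and H: "cdag (Graph [] [a] [a])"
    and IH: "\<And>bs vs os is. \<lbrakk>cdag (Graph (bs @ vs) os is); \<forall>v\<in>set bs. trivalent v; \<forall>v\<in>set vs. fst v \<noteq> [];
       list_all2 (\<lambda>v p. p \<in> composites (length (fst v)) (length (snd v))) vs ps\<rbrakk>
       \<Longrightarrow> expandable (bs @ vs) os is (map generator bs @ ps)"
  shows "expandable (bs @ ([b], [c]) # vs) os is (map generator bs @ val [] [a] [a] # ps)"
proof -
  let ?v = "([b], [c])" and ?\<sigma> = "id(b := c)"
  have neG: "\<forall>v\<in>set (bs @ ?v # vs). fst v \<noteq> []" using tr ne trivalent_nonempty by auto
  have g: "distinct (bs @ ?v # vs)" "good (set (bs @ ?v # vs))" "legs (set (bs @ ?v # vs)) os is"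
    using G cdag_iff[OF neG] by auto
  have ps_ops: "list_all2 (\<lambda>v p. p \<in> ops P (length (fst v)) (length (snd v))) vs ps"
    using ps by (rule list_all2_mono) (use composites_ops in auto)
  have sub: "compose P (Graph (bs @ ?v # vs) os is) (map generator bs @ val [] [a] [a] # ps)
      = compose P K (map generator bs @ ps)"
    if "K = Graph (map (relabel ?\<sigma>) bs @ map (relabel ?\<sigma>) vs) (map ?\<sigma> os) (map ?\<sigma> is)" "wf_graph K" for K
    using compose_subst_one[OF G H _ generator_list_ops[OF tr] ps_ops, of "[]" "\<lambda>_. c" ?\<sigma> K] that
    by (simp add: val_def decoration_def)
  show ?thesis
  proof (cases "bs @ vs = []")
    case True
    have "b \<noteq> c" using good_no_loop[OF g(2), of ?v] True by auto
    have "out_labels {?v} = {b}" "in_labels {?v} = {c}"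
      by (simp_all add: out_labels_def in_labels_def)
    moreover have "legs {?v} os is" using g(3) True by simp
    ultimately have "set os = {b}" "set is = {c}" "distinct os" "distinct is"
      using \<open>b \<noteq> c\<close> by (simp_all add: legs_def)
    then have oi: "os = [b]" "is = [c]"
      by (simp_all add: distinct_singleton)
    have K: "cdag (Graph [] [c] [c])"
      by (simp add: cdag_def wf_graph_def edge_sources_def edge_targets_def connected_graph_def adj_def acyclic_def)
    have "compose P (Graph (bs @ ?v # vs) os is) (map generator bs @ val [] [a] [a] # ps) = val [] [c] [c]"
      using sub[of "Graph [] [c] [c]"] True oi K ps_ops by (simp add: val_def cdag_def)
    also have "val [] [c] [c] \<in> trivalent_values 1 1" unfolding trivalent_values_def using K by force
    finally have "compose P (Graph (bs @ ?v # vs) os is) (map generator bs @ val [] [a] [a] # ps) \<in> composites 1 1"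
      by (rule composites_base)
    moreover have "inner {?v} = {}" using \<open>b \<noteq> c\<close> by (auto simp: inner_def out_labels_def in_labels_def)
    ultimately show ?thesis using True oi by (simp add: expandable_def)
  next
    case False
    interpret strand_removal "set (bs @ vs)" b c
      by unfold_locales (use g False in auto)
    have d: "distinct (map (relabel ?\<sigma>) (bs @ vs))"
      unfolding distinct_map using g(1) injT by simp
    have "fst v \<noteq> []" if "v \<in> set (bs @ vs)" for v using neG that by simp
    then have neK: "\<forall>v\<in>set (map (relabel ?\<sigma>) (bs @ vs)). fst v \<noteq> []"
      by (simp add: ball_Un)
    have SG: "insert ?v (set (bs @ vs)) = set (bs @ ?v # vs)" by auto
    have K: "cdag (Graph (map (relabel ?\<sigma>) (bs @ vs)) (map ?\<sigma> os) (map ?\<sigma> is))"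
    proof -
      have "map (relabel ?\<sigma>) (bs @ vs) \<noteq> []" using False by simp
      moreover have "legs (relabel ?\<sigma> ` set (bs @ vs)) (map ?\<sigma> os) (map ?\<sigma> is)"
        by (rule legs_T') (use g(3) in \<open>simp only: SG\<close>)
      ultimately show ?thesis
        unfolding cdag_iff[OF neK \<open>map (relabel ?\<sigma>) (bs @ vs) \<noteq> []\<close>] set_map[of "relabel ?\<sigma>"]
        using d good_T' by blast
    qed
    have generator: "map generator (map (relabel ?\<sigma>) bs) = map generator bs" by (simp add: generator_def)
    have exp: "expandable (map (relabel ?\<sigma>) bs @ map (relabel ?\<sigma>) vs) (map ?\<sigma> os) (map ?\<sigma> is)
        (map generator (map (relabel ?\<sigma>) bs) @ ps)"
    proof (rule IH)
      show "list_all2 (\<lambda>v p. p \<in> composites (length (fst v)) (length (snd v))) (map (relabel ?\<sigma>) vs) ps"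
        using ps by (simp add: list_all2_conv_all_nth)
      show "\<forall>v\<in>set (map (relabel ?\<sigma>) bs). trivalent v" using tr by (auto simp: trivalent_def)
      show "\<forall>v\<in>set (map (relabel ?\<sigma>) vs). fst v \<noteq> []"
        using neK unfolding map_append set_append by blast
    qed (use K in simp)
    have card: "card (set (bs @ ?v # vs)) = card (set (map (relabel ?\<sigma>) (bs @ vs))) + 1"
      using distinct_card[OF g(1)] distinct_card[OF d] by simp
    have "card (inner (set (bs @ ?v # vs))) \<le> card (inner (set (map (relabel ?\<sigma>) (bs @ vs)))) + 1"
      using card_inner_T' unfolding SG set_map[of "relabel ?\<sigma>" "bs @ vs"] .
    with card have "card (set (map (relabel ?\<sigma>) (bs @ vs))) \<le> card (inner (set (map (relabel ?\<sigma>) (bs @ vs))))"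
      if "card (set (bs @ ?v # vs)) \<le> card (inner (set (bs @ ?v # vs)))" using that by linarith
    then show ?thesis
      using exp sub[OF refl] K False unfolding expandable_def generator by (simp add: cdag_def del: fun_upd_apply)
  qed
qed

text \<open>
  Since the inserted graph is connected, the genus does not decrease.
\<close>

lemma expand_graph:
  assumes G: "cdag (Graph (bs @ (hos, his) # vs) os is)" and tr: "\<forall>v\<in>set bs. trivalent v"
    and ne: "\<forall>v\<in>set vs. fst v \<noteq> []" "hos \<noteq> []"
    and ps: "list_all2 (\<lambda>v p. p \<in> composites (length (fst v)) (length (snd v))) vs ps"
    and H: "cdag (Graph us ks js)" "\<forall>v\<in>set us. trivalent v" "us \<noteq> []"
      "length ks = length hos" "length js = length his"
    and IH: "\<And>bs vs os is. \<lbrakk>cdag (Graph (bs @ vs) os is); \<forall>v\<in>set bs. trivalent v; \<forall>v\<in>set vs. fst v \<noteq> [];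
       list_all2 (\<lambda>v p. p \<in> composites (length (fst v)) (length (snd v))) vs ps\<rbrakk>
       \<Longrightarrow> expandable (bs @ vs) os is (map generator bs @ ps)"
  shows "expandable (bs @ (hos, his) # vs) os is (map generator bs @ val us ks js # ps)"
proof -
  let ?v = "(hos, his)"
  have neG: "\<forall>v\<in>set (bs @ ?v # vs). fst v \<noteq> []" using tr ne trivalent_nonempty by auto
  have g: "distinct (bs @ ?v # vs)" "good (set (bs @ ?v # vs))" "legs (set (bs @ ?v # vs)) os is"
    using G cdag_iff[OF neG] by auto
  have sepG: "separated (set (bs @ ?v # vs))" using g by (simp add: good_def)
  have h: "distinct us" "good (set us)" "legs (set us) ks js"
    using H(1) cdag_trivalent_iff[OF H(2,3)] by auto
  have dv: "distinct hos" "distinct his" "set hos \<inter> set his = {}"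
    using sepG good_no_loop[OF g(2), of ?v] by (auto simp: separated_def)
  let ?T = "set (bs @ vs)"
  have fin: "finite (out_labels ?T \<union> in_labels ?T)"
    using finite_labels[OF separated_subset[OF sepG, of ?T]] by auto
  obtain f where f: "inj_on f (out_labels (set us) \<union> in_labels (set us))" "map f ks = hos" "map f js = his"
      "f ` inner (set us) \<inter> (out_labels ?T \<union> in_labels ?T) = {}"
    using fresh_relabelling[OF _ h(3) H(4,5) dv fin] h(2) by (auto simp: good_def)
  note rg = relabel_good[OF h(2) f(1) h(3), unfolded f(2,3)]
  let ?us = "map (relabel f) us"
  have trU: "\<forall>v\<in>set ?us. trivalent v" using H(2) by (auto simp: trivalent_def)
  have dU: "distinct ?us" using h(1) rg(4) by (simp add: distinct_map)
  have H': "cdag (Graph ?us hos his)"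
    using cdag_trivalent_iff[OF trU] rg dU H(3) by simp
  have val: "val us ks js = val ?us hos his"
    using val_relabel[OF H(1,3,2), of f] H' unfolding f(2,3) by simp
  have G': "insert ?v ?T = set (bs @ ?v # vs)" by auto
  interpret insertion ?T "set ?us" hos his
    by unfold_locales (use sepG g rg f(4) G' in \<open>auto simp: good_def\<close>)
  have TU: "?T \<union> set ?us = set (bs @ ?us @ vs)" by auto
  have "\<forall>v\<in>set ?us. fst v \<noteq> []" using trU trivalent_nonempty by blast
  then have neK: "\<forall>v\<in>set (bs @ ?us @ vs). fst v \<noteq> []" using neG by (simp add: ball_Un del: set_map)
  have gK: "good (set (bs @ ?us @ vs))" "legs (set (bs @ ?us @ vs)) os is"
    using good_insertion legs_insertion[of os "is"] g rg(1) unfolding G' TU[symmetric] by auto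
  have dK: "distinct (bs @ ?us @ vs)" using g(1) dU disjoint by (auto simp del: set_map)
  have K: "cdag (Graph (bs @ ?us @ vs) os is)"
    using gK dK H(3) by (subst cdag_iff[OF neK]) auto
  have ps_ops: "list_all2 (\<lambda>v p. p \<in> ops P (length (fst v)) (length (snd v))) vs ps"
    using ps by (rule list_all2_mono) (use composites_ops in auto)
  have eq: "compose P (Graph (bs @ ?us @ vs) os is) (map generator bs @ map generator ?us @ ps)
      = compose P (Graph (bs @ ?v # vs) os is) (map generator bs @ val us ks js # ps)"
    using compose_insert[OF G H' decoration_generator[OF trU] generator_list_ops[OF tr] ps_ops] K
    unfolding val unfolding val_def by (simp add: cdag_def)
  have exp: "expandable ((bs @ ?us) @ vs) os is (map generator (bs @ ?us) @ ps)"
    by (rule IH) (use K tr trU ne ps in auto)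
  have "card (set (bs @ ?us @ vs)) \<le> card (inner (set (bs @ ?us @ vs)))"
    if "card (set (bs @ ?v # vs)) \<le> card (inner (set (bs @ ?v # vs)))"
  proof -
    have "card (set ?us) \<le> card (inner (set ?us)) + 1"
      using connected_card_bound[of "set ?us"] rg(1) by (simp add: good_def)
    then show ?thesis using card_insertion that unfolding G' TU by linarith
  qed
  then show ?thesis using exp eq H(3) by (simp add: expandable_def)
qed

text \<open>
  The vertices that do not yet carry a generator are expanded one after another, using linearity
  in their decorations. When none is left, the graph is trivalent.
\<close>

lemma expand:
  assumes "cdag (Graph (bs @ vs) os is)" "\<forall>v\<in>set bs. trivalent v" "\<forall>v\<in>set vs. fst v \<noteq> []"
    and "list_all2 (\<lambda>v p. p \<in> composites (length (fst v)) (length (snd v))) vs ps"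
  shows "expandable (bs @ vs) os is (map generator bs @ ps)"
  using assms
proof (induction ps arbitrary: bs vs os "is")
  case Nil
  then have vs: "vs = []" by simp
  have "val bs os is \<in> trivalent_values (length os) (length is)"
    unfolding trivalent_values_def using Nil.prems by (auto simp: vs)
  moreover have "val bs os is = 0" if "bs \<noteq> []" "card (set bs) \<le> card (inner (set bs))"
    using positive_genus_vanishes[of "set bs"] cdag_trivalent_iff[of bs os "is"] Nil.prems that
    by (auto simp: vs vanishes_def)
  ultimately show ?case using composites_base by (simp add: expandable_def vs val_def)
next
  case (Cons p ps)
  then obtain v vs' where vs: "vs = v # vs'" "p \<in> composites (length (fst v)) (length (snd v))"
    "list_all2 (\<lambda>v p. p \<in> composites (length (fst v)) (length (snd v))) vs' ps"
    by (auto simp: list_all2_Cons2)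
  note G = Cons.prems(1)[unfolded vs(1)]
  have ps_ops: "list_all2 (\<lambda>v p. p \<in> ops P (length (fst v)) (length (snd v))) vs' ps"
    using vs(3) by (rule list_all2_mono) (use composites_ops in auto)
  have generator: "decoration P (Graph (bs @ v # vs') os is) (map generator bs @ x # ps)"
    if "x \<in> ops P (length (fst v)) (length (snd v))" for x
    using that ps_ops generator_list_ops[OF Cons.prems(2)] by (simp add: decoration_def list_all2_appendI)
  let ?Q = "\<lambda>x. x \<in> ops P (length (fst v)) (length (snd v)) \<and>
     expandable (bs @ v # vs') os is (map generator bs @ x # ps)"
  have "?Q p"
    using vs(2)
  proof (induction rule: module.span_induct_alt[OF module_scal, consumes 1, case_names zero step])
    case zero
    then show ?case
      using zero_in_ops compose_zero[OF G generator[OF zero_in_ops]] composites_zero by (simp add: expandable_def)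
  next
    case (step c x y)
    have xo: "x \<in> ops P (length (fst v)) (length (snd v))"
      using step(1) composites_base composites_ops by blast
    have cx: "scal P c x \<in> ops P (length (fst v)) (length (snd v))"
      using xo unfolding ops_def by (rule module.span_scale[OF module_scal])
    have lin: "compose P (Graph (bs @ v # vs') os is) (map generator bs @ (scal P c x + y) # ps)
        = scal P c (compose P (Graph (bs @ v # vs') os is) (map generator bs @ x # ps))
          + compose P (Graph (bs @ v # vs') os is) (map generator bs @ y # ps)"
      using compose_add[OF G generator[OF cx] generator] compose_scal[OF G generator[OF xo]] step(2) by simp
    have "expandable (bs @ v # vs') os is (map generator bs @ x # ps)"
    proof -
      obtain us ks js where x: "x = val us ks js" "cdag (Graph us ks js)" "\<forall>v\<in>set us. trivalent v"
          "length ks = length (fst v)" "length js = length (snd v)"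
        using step(1) unfolding trivalent_values_def by auto
      obtain hos his where v: "v = (hos, his)" by (cases v)
      show ?thesis
      proof (cases "us = []")
        case False
        then show ?thesis
          using expand_graph[of bs hos his vs' os "is" ps us ks js] G Cons.prems(2,3) vs x v Cons.IH by simp
      next
        case True
        then have kj0: "length js = 1" "set ks = set js" "distinct ks"
          using x(2) by (auto simp: cdag_def wf_graph_def connected_graph_def edge_sources_def
              edge_targets_def)
        obtain a where js: "js = [a]" using kj0(1) by (auto simp: length_Suc_conv)
        have ks: "ks = [a]" by (rule distinct_singleton) (use kj0 js in simp_all)
        note kj = ks js
        obtain b c where "v = ([b], [c])"
          using x(4,5) v unfolding kj by (cases hos; cases his) auto
        then show ?thesis
          using expand_strand[of bs b c vs' os "is" ps a] G Cons.prems(2,3) vs x True kj Cons.IH by simp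
      qed
    qed
    then have "expandable (bs @ v # vs') os is (map generator bs @ (scal P c x + y) # ps)"
      using step(2) unfolding expandable_def lin by (auto intro: composites_add composites_scal simp: scal_0_right)
    moreover have "scal P c x + y \<in> ops P (length (fst v)) (length (snd v))"
      using cx step(2) unfolding ops_def by (auto intro: module.span_add[OF module_scal])
    ultimately show ?case by blast
  qed
  then show ?case by (simp add: vs(1))
qed

lemma no_output_zero: "x \<in> ops P 0 l \<Longrightarrow> x = 0"
proof -
  assume "x \<in> ops P 0 l"
  moreover have "ops P 0 l = module.span (scal P) {0}" by (simp add: ops_def no_outputs)
  ultimately show "x = 0"
    using module.span_minimal[OF module_scal, of "{0}" "{0}"] module.subspace_single_0[OF module_scal] by auto
qed

lemma compose_no_output:
  assumes "cdag G" "decoration P G ps" "v \<in> set (verts G)" "fst v = []"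
  shows "compose P G ps = 0"
proof -
  obtain i where i: "i < length (verts G)" "verts G ! i = v" using assms(3) by (auto simp: in_set_conv_nth)
  have len: "length ps = length (verts G)"
    using assms(2) by (simp add: decoration_def list_all2_lengthD)
  have "ps ! i \<in> ops P 0 (length (snd v))"
    using assms(2,4) i by (auto simp: decoration_def list_all2_conv_all_nth)
  then have "ps = take i ps @ 0 # drop (Suc i) ps"
    using no_output_zero i len by (metis id_take_nth_drop)
  then show ?thesis using compose_zero[OF assms(1), of "take i ps" "drop (Suc i) ps"] assms(2) by simp
qed

lemma compose_composites:
  assumes G: "cdag G" and ps: "list_all2 (\<lambda>v p. p \<in> composites (length (fst v)) (length (snd v))) (verts G) ps"
  shows "compose P G ps \<in> composites (length (outs G)) (length (ins G))"
    and "genus G > 0 \<Longrightarrow> compose P G ps = 0"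
proof -
  obtain vs os "is" where G': "G = Graph vs os is" by (cases G)
  have generator: "decoration P G ps"
    unfolding decoration_def using ps by (rule list_all2_mono) (use composites_ops in auto)
  have "compose P G ps \<in> composites (length (outs G)) (length (ins G)) \<and> (genus G > 0 \<longrightarrow> compose P G ps = 0)"
  proof (cases "\<exists>v\<in>set vs. fst v = []")
    case True
    then show ?thesis using compose_no_output[OF G generator] composites_zero by (auto simp: G')
  next
    case False
    then have e: "expandable vs os is ps"
      using expand[of "[]" vs os "is" ps] G ps by (auto simp: G')
    moreover have "vs \<noteq> [] \<and> card (set vs) \<le> card (inner (set vs))" if "genus G > 0"
    proof (cases "vs = []")
      case True
      then show ?thesis using that genus_pos_iff[OF G] by (simp add: G')
    next
      case ne: False
      have "distinct vs" using cdag_iff[of vs os "is"] G False ne by (auto simp: G')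
      then show ?thesis using that genus_pos_iff[OF G] by (simp add: G' distinct_card)
    qed
    ultimately show ?thesis by (auto simp: expandable_def G')
  qed
  then show "compose P G ps \<in> composites (length (outs G)) (length (ins G))" "genus G > 0 \<Longrightarrow> compose P G ps = 0"
    by auto
qed

lemma generated_composites: "generated P m \<Delta> k l x \<Longrightarrow> x \<in> composites k l"
proof (induction rule: generated.induct)
  case 1
  have "val [mul 1 2 0] [0] [1, 2] = m"
    using unit[OF hom_imp_ops[OF m_hom]] by (simp add: val_def generator_def corolla_def numeral_2_eq_2 upt_rec)
  moreover have "cdag (Graph [mul 1 2 0] [0] [1, 2])"
    using cdag_corolla[of 1 2] by (simp add: corolla_def numeral_2_eq_2 upt_rec)
  ultimately have "m \<in> trivalent_values 1 2" unfolding trivalent_values_def by force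
  then show ?case by (rule composites_base)
next
  case 2
  have "val [cop 2 0 1] [0, 1] [2] = \<Delta>"
    using unit[OF hom_imp_ops[OF \<Delta>_hom]] by (simp add: val_def generator_def corolla_def numeral_2_eq_2 upt_rec)
  moreover have "cdag (Graph [cop 2 0 1] [0, 1] [2])"
    using cdag_corolla[of 2 1] by (simp add: corolla_def numeral_2_eq_2 upt_rec)
  ultimately have "\<Delta> \<in> trivalent_values 2 1" unfolding trivalent_values_def by force
  then show ?case by (rule composites_base)
next
  case (6 G ps)
  then show ?case by (intro compose_composites) (auto elim: list_all2_mono)
qed (auto intro: composites_zero composites_add composites_scal)

end

theorem corollary24:
  fixes P :: "('k::field_char_0, 'a::ab_group_add) properad" and m \<Delta> :: 'a
  assumes "is_BIB_dual P m \<Delta>"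
  shows "is_dioperad P"
proof -
  have str: "bib_structure P m \<Delta>" and gen: "\<And>k l x. x \<in> ops P k l \<Longrightarrow> generated P m \<Delta> k l x"
    using assms by (auto simp: is_BIB_dual_def)
  then interpret is_properad P by (simp add: bib_structure_def)
  interpret bib_properad P m \<Delta>
    using str by unfold_locales (auto simp: bib_structure_def)
  have "compose P G ps = 0" if "cdag G" "genus G > 0" "decoration P G ps" for G ps
  proof (rule compose_composites(2)[OF that(1) _ that(2)])
    show "list_all2 (\<lambda>v p. p \<in> composites (length (fst v)) (length (snd v))) (verts G) ps"
      using that(3) unfolding decoration_def by (rule list_all2_mono) (use gen generated_composites in blast)
  qed
  then show ?thesis using is_properad_axioms by (simp add: is_dioperad_def)
qed

end
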